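(* Let $k$ be a field of characteristic zero. The (scheme-theoretic) fiber of the morphism $H\colon \widetilde{\mathbb{P}}^{14}_k \to {\mathbb{P}^{14}_k}^\vee$ above the Fermat quartic $\mathrm{Fer}' \colon u^4+v^4+w^4=0$ consists of the five quartics $\mathrm{Fer}, C_0, C_1, C_2, C_3 \subset \mathbb{P}^2_k$, where the Fermat quartic $\mathrm{Fer}$ appears with multiplicity $11$ and each one of the remaining four quartics appears with multiplicity $1$.
   Context: $\mathbb{P}^{14}_k$ is the projective space of plane quartics in $\mathbb{P}^2_k$ (nonzero forms of degree $4$ in $x,y,z$ over $k$ up to scaling), and ${\mathbb{P}^{14}_k}^\vee$ is the projective space of plane quartics in the dual plane ${\mathbb{P}^2_k}^\vee$ (forms of degree $4$ in the dual coordinates $u,v,w$). For a quartic form $q$, set \[ H_4(q)(u,v,w)=q\bigl(w\,\partial_y - v\,\partial_z,\; u\,\partial_z - w\,\partial_x,\; v\,\partial_x-u\,\partial_y\bigr)\,q(x,y,z), \] where the operators act on $x,y,z$ only, treating $u,v,w$ as constants. This is a quartic form in $u,v,w$, and it defines a rational map $H_4\colon\mathbb{P}^{14}_k\dashrightarrow{\mathbb{P}^{14}_k}^\vee$. Let $\widetilde{\mathbb{P}}^{14}_k\subset\mathbb{P}^{14}_k\times{\mathbb{P}^{14}_k}^\vee$ be the closure of the graph of $H_4$, and let $H\colon\widetilde{\mathbb{P}}^{14}_k\to{\mathbb{P}^{14}_k}^\vee$ be the restriction of the second projection. If $H_4$ is defined at $C$, the point $(C,H_4(C))\in\widetilde{\mathbb{P}}^{14}_k$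 is identified with $C$. The multiplicity of a point in the fiber is the length of the local ring of the scheme-theoretic fiber at that point. The quartics are: $\mathrm{Fer}\colon x^4+y^4+z^4=0$; $C_0\colon (x^4+y^4+z^4)-6(x^2y^2+x^2z^2+y^2z^2)=0$; $C_1\colon (x^4+y^4+z^4)-6(x^2y^2-x^2z^2-y^2z^2)=0$; $C_2\colon (x^4+y^4+z^4)-6(-x^2y^2+x^2z^2-y^2z^2)=0$; $C_3\colon (x^4+y^4+z^4)-6(-x^2y^2-x^2z^2+y^2z^2)=0$. *)

theory Defs
  imports Complex_Main "HOL-Library.Poly_Mapping" "HOL-Library.Extended_Nat" "HOL-Algebra.Ideal"
begin

section \<open>Polynomials\<close>

type_synonym ('v, 'r) mpoly = "('v \<Rightarrow>\<^sub>0 nat) \<Rightarrow>\<^sub>0 'r"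

definition mConst :: "'r \<Rightarrow> ('v, 'r::zero) mpoly"
  where "mConst c = Poly_Mapping.single 0 c"

definition mVar :: "'v \<Rightarrow> ('v, 'r::zero_neq_one) mpoly"
  where "mVar v = Poly_Mapping.single (Poly_Mapping.single v 1) 1"

text \<open>Substitution \<open>v \<mapsto> \<sigma> v\<close>, where \<open>\<phi>\<close> says how coefficients act on the target ring.\<close>

definition msubst :: "('r::zero \<Rightarrow> 's) \<Rightarrow> ('v \<Rightarrow> 's) \<Rightarrow> ('v, 'r) mpoly \<Rightarrow> 's::comm_semiring_1"
  where "msubst \<phi> \<sigma> F = (\<Sum>m\<in>Poly_Mapping.keys F. \<phi> (Poly_Mapping.lookup F m) *
           (\<Prod>v\<in>Poly_Mapping.keys m. \<sigma> v ^ Poly_Mapping.lookup m v))"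

definition mderiv :: "'v \<Rightarrow> ('v, 'r) mpoly \<Rightarrow> ('v, 'r::comm_semiring_1) mpoly"
  where "mderiv v F = (\<Sum>m\<in>Poly_Mapping.keys F. Poly_Mapping.single (m - Poly_Mapping.single v 1)
           (of_nat (Poly_Mapping.lookup m v) * Poly_Mapping.lookup F m))"


section \<open>Plane quartics and the map \<open>H\<^sub>4\<close>\<close>

typedef mon4 = "{(i, j, l). i + j + l = (4::nat)}"
  by (rule exI[of _ "(4, 0, 0)"]) simp

instance mon4 :: finite
proof
  have "{(i, j, l). i + j + l = (4::nat)} \<subseteq> {..4} \<times> {..4} \<times> {..4}"
    by auto
  then have "finite {(i, j, l). i + j + l = (4::nat)}"
    by (rule finite_subset) auto
  then show "finite (UNIV :: mon4 set)"
    by (simp add: type_definition.Abs_image[OF type_definition_mon4, symmetric])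
qed

text \<open>A quartic form is given by its 15 coefficients. The same type serves for forms in \<open>x, y, z\<close>
  and for forms in \<open>u, v, w\<close>; a nonzero coefficient vector represents a point of \<open>\<P>\<^sup>1\<^sup>4\<close>.\<close>

type_synonym 'r quartic = "mon4 \<Rightarrow> 'r"

datatype plane_var = VX | VY | VZ | VU | VV | VW

definition xyz_form :: "'r quartic \<Rightarrow> (plane_var, 'r::comm_semiring_1) mpoly"
  where "xyz_form q = (\<Sum>m\<in>UNIV. case Rep_mon4 m of (i, j, l) \<Rightarrow>
           mConst (q m) * mVar VX ^ i * mVar VY ^ j * mVar VZ ^ l)"

definition xyz_quartic :: "(plane_var, 'r::zero) mpoly \<Rightarrow> 'r quartic"
  where "xyz_quartic F = (\<lambda>m. case Rep_mon4 m of (i, j, l) \<Rightarrow> Poly_Mapping.lookup F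
           (Poly_Mapping.single VX i + Poly_Mapping.single VY j + Poly_Mapping.single VZ l))"

definition uvw_quartic :: "(plane_var, 'r::zero) mpoly \<Rightarrow> 'r quartic"
  where "uvw_quartic F = (\<lambda>m. case Rep_mon4 m of (i, j, l) \<Rightarrow> Poly_Mapping.lookup F
           (Poly_Mapping.single VU i + Poly_Mapping.single VV j + Poly_Mapping.single VW l))"

text \<open>The operators substituted for \<open>x, y, z\<close>; they commute, so \<open>q\<close> can be evaluated at them.\<close>

definition op_x :: "(plane_var, 'r) mpoly \<Rightarrow> (plane_var, 'r::comm_ring_1) mpoly"
  where "op_x F = mVar VW * mderiv VY F - mVar VV * mderiv VZ F"

definition op_y :: "(plane_var, 'r) mpoly \<Rightarrow> (plane_var, 'r::comm_ring_1) mpoly"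
  where "op_y F = mVar VU * mderiv VZ F - mVar VW * mderiv VX F"

definition op_z :: "(plane_var, 'r) mpoly \<Rightarrow> (plane_var, 'r::comm_ring_1) mpoly"
  where "op_z F = mVar VV * mderiv VX F - mVar VU * mderiv VY F"

definition apply_op :: "'r quartic \<Rightarrow> (plane_var, 'r) mpoly \<Rightarrow> (plane_var, 'r::comm_ring_1) mpoly"
  where "apply_op q F = (\<Sum>m\<in>UNIV. case Rep_mon4 m of (i, j, l) \<Rightarrow>
           mConst (q m) * (op_x ^^ i) ((op_y ^^ j) ((op_z ^^ l) F)))"

text \<open>\<open>H4\<close> is defined over every commutative ring, because below it is also applied to the generic
  quartic. The rational map \<open>H\<^sub>4\<close> is defined at \<open>q\<close> iff \<open>H4 q\<close> is not the zero form.\<close>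

definition H4 :: "'r quartic \<Rightarrow> 'r::comm_ring_1 quartic"
  where "H4 q = uvw_quartic (apply_op q (xyz_form q))"

definition H4_defined_at :: "'r::comm_ring_1 quartic \<Rightarrow> bool"
  where "H4_defined_at q \<longleftrightarrow> H4 q \<noteq> (\<lambda>_. 0)"


section \<open>Closed subschemes of \<open>\<P>\<^sup>1\<^sup>4 \<times> \<P>\<^sup>1\<^sup>4\<close>\<close>

text \<open>Homogeneous coordinates: \<open>CoA m\<close> on the first factor, \<open>CoB m\<close> on the dual factor.\<close>

datatype coord = CoA mon4 | CoB mon4

type_synonym 'k bipoly = "(coord, 'k) mpoly"

definition bipoly_ring :: "'k::comm_ring_1 bipoly ring"
  where "bipoly_ring = \<lparr>carrier = UNIV, mult = (*), one = 1, zero = 0, add = (+)\<rparr>"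

definition bihom :: "nat \<Rightarrow> nat \<Rightarrow> 'k::zero bipoly \<Rightarrow> bool"
  where "bihom d e F \<longleftrightarrow> (\<forall>t\<in>Poly_Mapping.keys F.
           (\<Sum>m\<in>UNIV. Poly_Mapping.lookup t (CoA m)) = d \<and>
           (\<Sum>m\<in>UNIV. Poly_Mapping.lookup t (CoB m)) = e)"

text \<open>The ideal generated by the bihomogeneous elements of a set.\<close>

definition bihom_ideal :: "'k::comm_ring_1 bipoly set \<Rightarrow> 'k bipoly set"
  where "bihom_ideal S = Idl\<^bsub>bipoly_ring\<^esub> {F\<in>S. \<exists>d e. bihom d e F}"

text \<open>The scheme points of \<open>V(J)\<close>: bihomogeneous primes containing \<open>J\<close> but neither of the two
  irrelevant ideals.\<close>

definition scheme_points :: "'k::comm_ring_1 bipoly set \<Rightarrow> 'k bipoly set set"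
  where "scheme_points J = {P. primeideal P bipoly_ring \<and> bihom_ideal P = P \<and> J \<subseteq> P \<and>
           \<not> range (mVar \<circ> CoA) \<subseteq> P \<and> \<not> range (mVar \<circ> CoB) \<subseteq> P}"

text \<open>The local ring of \<open>V(J)\<close> at \<open>P\<close>: the part of bidegree \<open>(0, 0)\<close> of the bihomogeneous
  localisation at \<open>P\<close> of the bigraded ring modulo \<open>J\<close>. A pair \<open>(f, s)\<close> stands for \<open>f / s\<close>.\<close>

definition fracs :: "'k::comm_ring_1 bipoly set \<Rightarrow> ('k bipoly \<times> 'k bipoly) set"
  where "fracs P = {(f, s). s \<notin> P \<and> (\<exists>d e. bihom d e f \<and> bihom d e s)}"

definition frac_rel ::
    "'k::comm_ring_1 bipoly set \<Rightarrow> 'k bipoly set \<Rightarrow> (('k bipoly \<times> 'k bipoly) \<times> ('k bipoly \<times> 'k bipoly)) set"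
  where "frac_rel J P = {((f, s), (g, t)). (f, s) \<in> fracs P \<and> (g, t) \<in> fracs P \<and>
           (\<exists>c d e. bihom d e c \<and> c \<notin> P \<and> c * (f * t - g * s) \<in> J)}"

definition local_ring ::
    "'k::comm_ring_1 bipoly set \<Rightarrow> 'k bipoly set \<Rightarrow> ('k bipoly \<times> 'k bipoly) set ring"
  where "local_ring J P = \<lparr>carrier = fracs P // frac_rel J P,
     mult = (\<lambda>A B. \<Union>(f, s)\<in>A. \<Union>(g, t)\<in>B. frac_rel J P `` {(f * g, s * t)}),
     one = frac_rel J P `` {(1, 1)},
     zero = frac_rel J P `` {(0, 1)},
     add = (\<lambda>A B. \<Union>(f, s)\<in>A. \<Union>(g, t)\<in>B. frac_rel J P `` {(f * t + g * s, s * t)})\<rparr>"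

text \<open>Length of a ring as a module over itself.\<close>

definition ring_length :: "('a, 'b) ring_scheme \<Rightarrow> enat"
  where "ring_length R = Sup {enat n | n. \<exists>I :: nat \<Rightarrow> 'a set.
           (\<forall>i\<le>n. ideal (I i) R) \<and> (\<forall>i<n. I i \<subset> I (Suc i))}"

definition multiplicity_at :: "'k::comm_ring_1 bipoly set \<Rightarrow> 'k bipoly set \<Rightarrow> enat"
  where "multiplicity_at J P = ring_length (local_ring J P)"

definition eval_at :: "'k quartic \<Rightarrow> 'k quartic \<Rightarrow> 'k bipoly \<Rightarrow> 'k::comm_ring_1"
  where "eval_at p q = msubst id (case_coord p q)"

text \<open>The point \<open>(p, q)\<close>, for nonzero \<open>p\<close> and \<open>q\<close>, as a bihomogeneous prime.\<close>

definition rational_point :: "'k::comm_ring_1 quartic \<Rightarrow> 'k quartic \<Rightarrow> 'k bipoly set"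
  where "rational_point p q = bihom_ideal {F. eval_at p q F = 0}"


section \<open>The closure of the graph and its fibers\<close>

text \<open>The generic quartic, with coefficients in the coordinate ring of the first factor.\<close>

definition generic_quartic :: "(mon4, 'k::comm_ring_1) mpoly quartic"
  where "generic_quartic m = mVar m"

text \<open>The graph is the image of \<open>a \<mapsto> (a, H\<^sub>4(a))\<close> on the integral open set where \<open>H\<^sub>4\<close> is defined,
  so a bihomogeneous form vanishes on it iff its pullback \<open>F(a, H\<^sub>4(a))\<close> is the zero polynomial.
  Such forms cut out the closure of the graph, with its reduced structure.\<close>

definition graph_closure :: "'k::comm_ring_1 bipoly set"
  where "graph_closure = bihom_ideal
           {F. msubst mConst (case_coord generic_quartic (H4 generic_quartic)) F = 0}"

text \<open>The preimage of the rational point \<open>y\<close> under the second projection: the forms in the dual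
  coordinates alone (bidegree \<open>(0, e)\<close>) that vanish at \<open>y\<close>; the first argument of
  \<open>eval_at\<close> plays no role for them.\<close>

definition pr2_preimage :: "'k::comm_ring_1 quartic \<Rightarrow> 'k bipoly set"
  where "pr2_preimage y = Idl\<^bsub>bipoly_ring\<^esub> {F. (\<exists>e. bihom 0 e F) \<and> eval_at (\<lambda>_. 0) y F = 0}"

text \<open>The scheme-theoretic fiber of \<open>H\<close> over \<open>y\<close> is the scheme-theoretic intersection of the
  closure of the graph with \<open>\<P>\<^sup>1\<^sup>4 \<times> {y}\<close>.\<close>

definition H_fiber :: "'k::comm_ring_1 quartic \<Rightarrow> 'k bipoly set"
  where "H_fiber y = graph_closure <+>\<^bsub>bipoly_ring\<^esub> pr2_preimage y"

text \<open>The point of the graph that is identified with \<open>C\<close>, when \<open>H\<^sub>4\<close> is defined at \<open>C\<close>.\<close>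

definition graph_point :: "'k::comm_ring_1 quartic \<Rightarrow> 'k bipoly set"
  where "graph_point C = rational_point C (H4 C)"


section \<open>The quartics\<close>

definition Fer :: "'k::comm_ring_1 quartic"
  where "Fer = xyz_quartic (mVar VX ^ 4 + mVar VY ^ 4 + mVar VZ ^ 4)"

definition Fer' :: "'k::comm_ring_1 quartic"
  where "Fer' = uvw_quartic (mVar VU ^ 4 + mVar VV ^ 4 + mVar VW ^ 4)"

definition C0 :: "'k::comm_ring_1 quartic"
  where "C0 = xyz_quartic ((mVar VX ^ 4 + mVar VY ^ 4 + mVar VZ ^ 4) -
     6 * (mVar VX ^ 2 * mVar VY ^ 2 + mVar VX ^ 2 * mVar VZ ^ 2 + mVar VY ^ 2 * mVar VZ ^ 2))"

definition C1 :: "'k::comm_ring_1 quartic"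
  where "C1 = xyz_quartic ((mVar VX ^ 4 + mVar VY ^ 4 + mVar VZ ^ 4) -
     6 * (mVar VX ^ 2 * mVar VY ^ 2 - mVar VX ^ 2 * mVar VZ ^ 2 - mVar VY ^ 2 * mVar VZ ^ 2))"

definition C2 :: "'k::comm_ring_1 quartic"
  where "C2 = xyz_quartic ((mVar VX ^ 4 + mVar VY ^ 4 + mVar VZ ^ 4) -
     6 * (- (mVar VX ^ 2 * mVar VY ^ 2) + mVar VX ^ 2 * mVar VZ ^ 2 - mVar VY ^ 2 * mVar VZ ^ 2))"

definition C3 :: "'k::comm_ring_1 quartic"
  where "C3 = xyz_quartic ((mVar VX ^ 4 + mVar VY ^ 4 + mVar VZ ^ 4) -
     6 * (- (mVar VX ^ 2 * mVar VY ^ 2) - mVar VX ^ 2 * mVar VZ ^ 2 + mVar VY ^ 2 * mVar VZ ^ 2))"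

end

theory Submission
  imports Defs "HOL-Computational_Algebra.Polynomial" "HOL-Algebra.QuotRing"
begin

text \<open>
Write \<open>(A, B)\<close> for a point of the ambient space. Where \<open>H4\<close> is defined, its graph is cut out by the
minors \<open>B\<^sub>n H4(A)\<^sub>m - B\<^sub>m H4(A)\<^sub>n\<close>. They say nothing where \<open>H4(A) = 0\<close>, and the closure of the graph
has points there. What controls these points are equations of bidegree (1, 1): the partial derivatives
\<open>\<partial>A/\<partial>x\<^sub>i\<close> and \<open>\<partial>H4(A)/\<partial>u\<^sub>j\<close> are apolar cubics for distinct \<open>i, j\<close>, and their apolar pairing for
\<open>i = j\<close> does not depend on \<open>i\<close> (\<open>apolar_partials_H4\<close>). Over \<open>B = Fer'\<close> these equations are linear in \<open>A\<close>
and leave only the quartics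
\<open>A = s (x\<^sup>4 + y\<^sup>4 + z\<^sup>4) + p y\<^sup>2z\<^sup>2 + q x\<^sup>2z\<^sup>2 + r x\<^sup>2y\<^sup>2 + xyz (a x + b y + c z)\<close>.
For them the minors become (\<open>quadratic_relations\<close>)
\<open>p\<^sup>2 = q\<^sup>2 = r\<^sup>2\<close>, \<open>12 s p + 2 q r + a\<^sup>2 = 0\<close>, \<open>4 p a = b c\<close>, \<open>p b = p c = 0\<close>
together with the cyclic permutations of the last four equations.

If \<open>p\<close> is not 0, then \<open>q = \<epsilon> p\<close> and \<open>r = \<delta> p\<close> with signs \<open>\<epsilon>, \<delta>\<close>, the coefficients \<open>a, b, c\<close> vanish, and
\<open>p = - 6 \<epsilon> \<delta> s\<close>: these are the four quartics \<open>C0, ..., C3\<close>. If \<open>p = 0\<close>, then only \<open>s\<close> survives, and the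
point is the Fermat quartic. In neither case can \<open>s\<close> vanish, so the fiber contains no point at
which \<open>H4\<close> is undefined.

The same equations hold in the local rings of the fiber. Near \<open>C0, ..., C3\<close> the sign argument already determines \<open>A\<close> up to
scaling, so the points are reduced. Near the Fermat quartic, put \<open>s = 1\<close> and \<open>a = - 3 \<alpha>\<close>, \<open>b = - 3 \<beta>\<close>, \<open>c = - 3 \<gamma>\<close>.
The products \<open>q r, p r, p q\<close> vanish, whence \<open>p = - (3/4) \<alpha>\<^sup>2\<close> and cyclically, and what remains is
\<open>\<beta> \<gamma> = \<alpha>\<^sup>3\<close>, \<open>\<alpha> \<gamma> = \<beta>\<^sup>3\<close>, \<open>\<alpha> \<beta> = \<gamma>\<^sup>3\<close>, \<open>\<alpha>\<^sup>4 = \<beta>\<^sup>4 = \<gamma>\<^sup>4\<close>, with all products \<open>\<alpha>\<^sup>2 \<beta>, ...\<close> equal to 0.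
The local algebra has the basis \<open>1; \<alpha>, \<beta>, \<gamma>; \<alpha>\<^sup>2, \<beta>\<^sup>2, \<gamma>\<^sup>2; \<alpha>\<^sup>3, \<beta>\<^sup>3, \<gamma>\<^sup>3; \<alpha>\<^sup>4\<close>, which has 1 + 3 + 3 + 3 + 1 = 11
elements.

That no further equations hold follows from points with values in an algebra: if \<open>A\<close> is a quartic over an algebra
with \<open>H4(A) = w Fer'\<close> and \<open>w\<close> is a unit, then evaluation at \<open>(A, Fer')\<close> kills the ideal of the fiber
(\<open>H_fiber_vanish\<close>), because \<open>F(A, H4(A)) = w\<^sup>e F(A, Fer')\<close> for \<open>F\<close> of degree \<open>e\<close> in \<open>B\<close>. The lemma
\<open>local_ring_length\<close> turns such an evaluation into an isomorphism of local rings, and the local equations enter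
it through \<open>normal_form\<close>.
\<close>

section \<open>Substitution into multivariate polynomials\<close>

text \<open>Homomorphisms are a predicate on functions between types, so that the same rules serve substitutions
  into polynomial rings, evaluations in a field and maps to a finite-dimensional algebra.\<close>

definition ring_map :: "('r::comm_ring_1 \<Rightarrow> 's::comm_ring_1) \<Rightarrow> bool"
  where "ring_map h \<longleftrightarrow> h 1 = 1 \<and> (\<forall>a b. h (a + b) = h a + h b) \<and> (\<forall>a b. h (a * b) = h a * h b)"

lemma ring_mapD:
  assumes "ring_map h"
  shows "h 1 = 1" "h (a + b) = h a + h b" "h (a * b) = h a * h b" "h 0 = 0"
    "h (- a) = - h a" "h (a - b) = h a - h b" "h (a ^ n) = h a ^ n"
    "h (of_nat n) = of_nat n" "h (numeral v) = numeral v"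
    "h (sum f S) = (\<Sum>i\<in>S. h (f i))" "h (prod f S) = (\<Prod>i\<in>S. h (f i))"
proof -
  show 1: "h 1 = 1" and add: "h (a + b) = h a + h b" and mult: "h (a * b) = h a * h b" for a b
    using assms by (auto simp: ring_map_def)
  show zero: "h 0 = 0"
    using add[of 0 0] by simp
  show minus: "h (- a) = - h a" for a
    using add[of a "- a"] by (simp add: zero eq_neg_iff_add_eq_0 add.commute)
  show "h (a - b) = h a - h b"
    using add[of a "- b"] by (simp add: minus)
  show "h (a ^ n) = h a ^ n"
    by (induction n) (simp_all add: 1 mult)
  show nat: "h (of_nat n) = of_nat n" for n
    by (induction n) (simp_all add: 1 zero add)
  show "h (numeral v) = numeral v"
    using nat[of "numeral v"] by simp
  show "h (sum f S) = (\<Sum>i\<in>S. h (f i))"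
    by (induction S rule: infinite_finite_induct) (simp_all add: zero add)
  show "h (prod f S) = (\<Prod>i\<in>S. h (f i))"
    by (induction S rule: infinite_finite_induct) (simp_all add: 1 mult)
qed

lemma ring_map_id: "ring_map id"
  by (simp add: ring_map_def)

lemma ring_map_comp: "ring_map g \<Longrightarrow> ring_map h \<Longrightarrow> ring_map (g \<circ> h)"
  by (simp add: ring_map_def)

lemma poly_mapping_sum_single:
  fixes F :: "'a \<Rightarrow>\<^sub>0 'b::comm_monoid_add"
  shows "F = (\<Sum>m\<in>Poly_Mapping.keys F. Poly_Mapping.single m (Poly_Mapping.lookup F m))"
proof (rule poly_mapping_eqI)
  fix k
  have "(\<Sum>m\<in>Poly_Mapping.keys F. Poly_Mapping.lookup (Poly_Mapping.single m (Poly_Mapping.lookup F m)) k)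
      = (\<Sum>m\<in>Poly_Mapping.keys F. if m = k then Poly_Mapping.lookup F m else 0)"
    by (rule sum.cong) (simp_all add: lookup_single when_def)
  then show "Poly_Mapping.lookup F k = Poly_Mapping.lookup (\<Sum>m\<in>Poly_Mapping.keys F.
      Poly_Mapping.single m (Poly_Mapping.lookup F m)) k"
    by (simp add: lookup_sum sum.delta' in_keys_iff)
qed

lemma mpoly_add_induct [case_names single add]:
  fixes F :: "'a \<Rightarrow>\<^sub>0 'b::comm_monoid_add"
  assumes "\<And>m c. Q (Poly_Mapping.single m c)" "\<And>F G. Q F \<Longrightarrow> Q G \<Longrightarrow> Q (F + G)"
  shows "Q F"
proof -
  have "Q (\<Sum>m\<in>S. Poly_Mapping.single m (Poly_Mapping.lookup F m))" if "finite S" for S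
    using that
  proof (induction S rule: finite_induct)
    case empty
    then show ?case using assms(1)[of undefined 0] by simp
  qed (simp add: assms)
  from this[OF finite_keys, of F] show ?thesis
    by (subst poly_mapping_sum_single)
qed

lemma exponent_induct [case_names zero var]:
  fixes m :: "'v \<Rightarrow>\<^sub>0 nat"
  assumes "Q 0" "\<And>v m. Q m \<Longrightarrow> Q (Poly_Mapping.single v 1 + m)"
  shows "Q m"
proof -
  have step: "Q (Poly_Mapping.single v n + m)" if "Q m" for v n m
  proof (induction n)
    case (Suc n)
    have "Poly_Mapping.single v (Suc n) + m = Poly_Mapping.single v 1 + (Poly_Mapping.single v n + m)"
      by (simp add: single_add[symmetric] add.assoc[symmetric])
    then show ?case using assms(2)[OF Suc] by simp
  qed (simp add: that)
  have "Q (\<Sum>v\<in>S. Poly_Mapping.single v (Poly_Mapping.lookup m v))" if "finite S" for S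
    using that by (induction S rule: finite_induct) (simp_all add: assms(1) step)
  from this[OF finite_keys, of m] show ?thesis
    by (subst poly_mapping_sum_single)
qed

lemma mConst_mult: "mConst (a * b) = mConst a * mConst b"
  by (simp add: mConst_def mult_single)

lemma mConst_add: "mConst (a + b) = mConst a + mConst b"
  by (simp add: mConst_def single_add)

lemma mConst_0 [simp]: "mConst 0 = 0"
  by (simp add: mConst_def)

lemma mConst_1 [simp]: "mConst 1 = 1"
  by (simp add: mConst_def)

lemma ring_map_mConst: "ring_map (mConst :: 'r::comm_ring_1 \<Rightarrow> ('v, 'r) mpoly)"
  by (simp add: ring_map_def mConst_add mConst_mult)

lemma single_as_product:
  "Poly_Mapping.single (Poly_Mapping.single v 1 + m) (c::'r::comm_ring_1) = mVar v * Poly_Mapping.single m c"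
  by (simp add: mVar_def mult_single)

lemma mpoly_induct [case_names const var add mult]:
  fixes F :: "('v, 'r::comm_ring_1) mpoly"
  assumes "\<And>c. Q (mConst c)" "\<And>v. Q (mVar v)"
    and "\<And>F G. Q F \<Longrightarrow> Q G \<Longrightarrow> Q (F + G)" "\<And>F G. Q F \<Longrightarrow> Q G \<Longrightarrow> Q (F * G)"
  shows "Q F"
proof (induction F rule: mpoly_add_induct)
  case (single m c)
  show ?case
  proof (induction m rule: exponent_induct)
    case zero
    then show ?case using assms(1)[of c] by (simp add: mConst_def)
  next
    case (var v m)
    then show ?case unfolding single_as_product by (intro assms)
  qed
qed (rule assms(3))

lemma ring_map_eqI:
  fixes g h :: "('v, 'r::comm_ring_1) mpoly \<Rightarrow> 's::comm_ring_1"
  assumes "ring_map g" "ring_map h" "\<And>c. g (mConst c) = h (mConst c)" "\<And>v. g (mVar v) = h (mVar v)"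
  shows "g F = h F"
  by (induction F rule: mpoly_induct) (simp_all add: assms ring_mapD)

context
  fixes \<phi> :: "'r::comm_ring_1 \<Rightarrow> 's::comm_ring_1" and \<sigma> :: "'v \<Rightarrow> 's"
  assumes \<phi>: "ring_map \<phi>"
begin

lemma msubst_superset:
  assumes "finite S" "Poly_Mapping.keys F \<subseteq> S"
  shows "msubst \<phi> \<sigma> F = (\<Sum>m\<in>S. \<phi> (Poly_Mapping.lookup F m) *
           (\<Prod>v\<in>Poly_Mapping.keys m. \<sigma> v ^ Poly_Mapping.lookup m v))"
  unfolding msubst_def using assms
  by (intro sum.mono_neutral_left) (auto simp: in_keys_iff ring_mapD[OF \<phi>])

lemma msubst_add: "msubst \<phi> \<sigma> (F + G) = msubst \<phi> \<sigma> F + msubst \<phi> \<sigma> G"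
proof -
  let ?S = "Poly_Mapping.keys F \<union> Poly_Mapping.keys G"
  show ?thesis
    using keys_add[of F G]
    by (simp add: msubst_superset[of ?S] lookup_add ring_mapD[OF \<phi>] distrib_right sum.distrib)
qed

lemma msubst_single:
  "msubst \<phi> \<sigma> (Poly_Mapping.single m c) = \<phi> c * (\<Prod>v\<in>Poly_Mapping.keys m. \<sigma> v ^ Poly_Mapping.lookup m v)"
  by (simp add: msubst_superset[of "{m}"])

lemma power_product_superset:
  assumes "finite S" "Poly_Mapping.keys m \<subseteq> S"
  shows "(\<Prod>v\<in>Poly_Mapping.keys m. \<sigma> v ^ Poly_Mapping.lookup m v) = (\<Prod>v\<in>S. \<sigma> v ^ Poly_Mapping.lookup m v)"
  using assms by (intro prod.mono_neutral_left) (auto simp: in_keys_iff)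

lemma msubst_mult: "msubst \<phi> \<sigma> (F * G) = msubst \<phi> \<sigma> F * msubst \<phi> \<sigma> G"
proof (induction F rule: mpoly_add_induct)
  case (single m c)
  show ?case
  proof (induction G rule: mpoly_add_induct)
    case (single n d)
    let ?S = "Poly_Mapping.keys m \<union> Poly_Mapping.keys n"
    have S: "finite ?S" "Poly_Mapping.keys (m + n) \<subseteq> ?S" "Poly_Mapping.keys m \<subseteq> ?S" "Poly_Mapping.keys n \<subseteq> ?S"
      using keys_add[of m n] by auto
    show ?case
      unfolding mult_single msubst_single power_product_superset[OF S(1,2)]
        power_product_superset[OF S(1,3)] power_product_superset[OF S(1,4)]
      by (simp add: lookup_add ring_mapD[OF \<phi>] power_add prod.distrib mult_ac)
  qed (simp add: msubst_add distrib_left)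
qed (simp add: msubst_add distrib_right)

lemma msubst_mConst: "msubst \<phi> \<sigma> (mConst c) = \<phi> c"
  by (simp add: mConst_def msubst_single)

lemma msubst_mVar: "msubst \<phi> \<sigma> (mVar v) = \<sigma> v"
  by (simp add: mVar_def msubst_single ring_mapD[OF \<phi>])

lemma ring_map_msubst: "ring_map (msubst \<phi> \<sigma>)"
  using msubst_mConst[of 1] by (simp add: ring_map_def msubst_add msubst_mult ring_mapD[OF \<phi>])

end

lemma ring_map_msubst_comp:
  assumes "ring_map h" "ring_map \<phi>"
  shows "h (msubst \<phi> \<sigma> F) = msubst (h \<circ> \<phi>) (h \<circ> \<sigma>) F"
proof -
  have h\<phi>: "ring_map (h \<circ> \<phi>)"
    using assms by (rule ring_map_comp)
  show ?thesis
    using ring_map_eqI[of "h \<circ> msubst \<phi> \<sigma>" "msubst (h \<circ> \<phi>) (h \<circ> \<sigma>)" F]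
    by (simp add: assms h\<phi> ring_map_comp ring_map_msubst msubst_mConst msubst_mVar )
qed

section \<open>The coefficients of the form H4\<close>

abbreviation mo :: "nat \<Rightarrow> nat \<Rightarrow> nat \<Rightarrow> mon4"
  where "mo i j l \<equiv> Abs_mon4 (i, j, l)"

lemma UNIV_mon4: "(UNIV :: mon4 set) = {mo 4 0 0, mo 3 1 0, mo 3 0 1, mo 2 2 0, mo 2 1 1, mo 2 0 2,
    mo 1 3 0, mo 1 2 1, mo 1 1 2, mo 1 0 3, mo 0 4 0, mo 0 3 1, mo 0 2 2, mo 0 1 3, mo 0 0 4}"
proof -
  have "m \<in> {mo 4 0 0, mo 3 1 0, mo 3 0 1, mo 2 2 0, mo 2 1 1, mo 2 0 2,
    mo 1 3 0, mo 1 2 1, mo 1 1 2, mo 1 0 3, mo 0 4 0, mo 0 3 1, mo 0 2 2, mo 0 1 3, mo 0 0 4}" for m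
  proof (cases m)
    case (Abs_mon4 t)
    obtain i j l where t1: "t = (i, j, l)"
      by (cases t)
    with Abs_mon4(2) have t: "t = (i, j, l)" "i + j + l = 4"
      by simp_all
    have "i \<in> {0,1,2,3,4}" "j \<in> {0,1,2,3,4}" "l = 4 - i - j"
      using t(2) by auto
    then show ?thesis using t by (auto simp: Abs_mon4(1))
  qed
  then show ?thesis by blast
qed

lemma Rep_mo: "i + j + l = 4 \<Longrightarrow> Rep_mon4 (mo i j l) = (i, j, l)"
  by (simp add: Abs_mon4_inverse)

lemma mo_eq_iff: "i + j + l = 4 \<Longrightarrow> i' + j' + l' = 4 \<Longrightarrow> mo i j l = mo i' j' l' \<longleftrightarrow> i = i' \<and> j = j' \<and> l = l'"
  by (simp add: Abs_mon4_inject)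

lemma sum_mon4: "(\<Sum>m\<in>UNIV. f m) = f (mo 4 0 0) + f (mo 3 1 0) + f (mo 3 0 1) + f (mo 2 2 0) +
    f (mo 2 1 1) + f (mo 2 0 2) + f (mo 1 3 0) + f (mo 1 2 1) + f (mo 1 1 2) + f (mo 1 0 3) +
    f (mo 0 4 0) + f (mo 0 3 1) + f (mo 0 2 2) + f (mo 0 1 3) + f (mo 0 0 4)"
  unfolding UNIV_mon4 by (simp add: mo_eq_iff add.assoc)

lemma all_mon4: "(\<forall>m. Q m) \<longleftrightarrow> Q (mo 4 0 0) \<and> Q (mo 3 1 0) \<and> Q (mo 3 0 1) \<and> Q (mo 2 2 0) \<and>
    Q (mo 2 1 1) \<and> Q (mo 2 0 2) \<and> Q (mo 1 3 0) \<and> Q (mo 1 2 1) \<and> Q (mo 1 1 2) \<and> Q (mo 1 0 3) \<and>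
    Q (mo 0 4 0) \<and> Q (mo 0 3 1) \<and> Q (mo 0 2 2) \<and> Q (mo 0 1 3) \<and> Q (mo 0 0 4)"
proof -
  have "(\<forall>m. Q m) \<longleftrightarrow> (\<forall>m\<in>UNIV. Q m)" by simp
  then show ?thesis unfolding UNIV_mon4 by simp
qed

text \<open>The term \<open>c x\<^sup>i y\<^sup>j z\<^sup>l u\<^sup>r v\<^sup>s w\<^sup>t\<close>. Each of the three operators sends such a term to a sum of two,
  so \<open>H4\<close> can be computed by rewriting.\<close>

definition term6 :: "nat \<Rightarrow> nat \<Rightarrow> nat \<Rightarrow> nat \<Rightarrow> nat \<Rightarrow> nat \<Rightarrow> 'r \<Rightarrow> (plane_var, 'r::comm_ring_1) mpoly"
  where "term6 i j l r s t c = Poly_Mapping.single (Poly_Mapping.single VX i + Poly_Mapping.single VY j +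
    Poly_Mapping.single VZ l + Poly_Mapping.single VU r + Poly_Mapping.single VV s + Poly_Mapping.single VW t) c"

lemma mderiv_add: "mderiv v (F + G) = mderiv v F + mderiv v G"
proof -
  have sup: "mderiv v F = (\<Sum>m\<in>S. Poly_Mapping.single (m - Poly_Mapping.single v 1)
           (of_nat (Poly_Mapping.lookup m v) * Poly_Mapping.lookup F m))"
    if "finite S" "Poly_Mapping.keys F \<subseteq> S" for S and F :: "('a, 'b) mpoly"
    unfolding mderiv_def using that
    by (intro sum.mono_neutral_left) (auto simp: in_keys_iff)
  let ?S = "Poly_Mapping.keys F \<union> Poly_Mapping.keys G"
  show ?thesis
    using keys_add[of F G]
    by (simp add: sup[of ?S] lookup_add distrib_left single_add sum.distrib)
qed

lemma mderiv_0: "mderiv v 0 = 0"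
  by (simp add: mderiv_def)

lemma mderiv_single: "mderiv v (Poly_Mapping.single m c) =
    Poly_Mapping.single (m - Poly_Mapping.single v 1) (of_nat (Poly_Mapping.lookup m v) * c)"
  by (cases "c = 0") (simp_all add: mderiv_def)

lemma op_add: "op_x (F + G) = op_x F + op_x G" "op_y (F + G) = op_y F + op_y G" "op_z (F + G) = op_z F + op_z G"
  by (simp_all add: op_x_def op_y_def op_z_def mderiv_add algebra_simps)

lemma op_0: "op_x 0 = 0" "op_y 0 = 0" "op_z 0 = 0"
  by (simp_all add: op_x_def op_y_def op_z_def mderiv_0)

lemma term6_0: "term6 i j l r s t 0 = 0"
  by (simp add: term6_def)

lemma mult_term6: 
  "mVar VU * term6 i j l r s t c = term6 i j l (r + 1) s t c"
  "mVar VV * term6 i j l r s t c = term6 i j l r (s + 1) t c"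
  "mVar VW * term6 i j l r s t c = term6 i j l r s (t + 1) c"
  unfolding mVar_def term6_def mult_single
  by (rule arg_cong2[where f = Poly_Mapping.single];
      (rule poly_mapping_eqI)?; simp add: lookup_add lookup_single when_def)+

lemma mderiv_term6: 
  "mderiv VX (term6 i j l r s t c) = term6 (i - 1) j l r s t (of_nat i * c)"
  "mderiv VY (term6 i j l r s t c) = term6 i (j - 1) l r s t (of_nat j * c)"
  "mderiv VZ (term6 i j l r s t c) = term6 i j (l - 1) r s t (of_nat l * c)"
  unfolding term6_def mderiv_single
  by (rule arg_cong2[where f = Poly_Mapping.single];
      (rule poly_mapping_eqI)?; simp add: lookup_add lookup_minus lookup_single when_def)+

lemma op_term6:
  "op_x (term6 i j l r s t c) = term6 i (j - 1) l r s (t + 1) (of_nat j * c) + term6 i j (l - 1) r (s + 1) t (- (of_nat l * c))"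
  "op_y (term6 i j l r s t c) = term6 i j (l - 1) (r + 1) s t (of_nat l * c) + term6 (i - 1) j l r s (t + 1) (- (of_nat i * c))"
  "op_z (term6 i j l r s t c) = term6 (i - 1) j l r (s + 1) t (of_nat i * c) + term6 i (j - 1) l (r + 1) s t (- (of_nat j * c))"
  by (simp_all add: op_x_def op_y_def op_z_def mderiv_term6 mult_term6)
    (simp_all add: term6_def single_uminus)

lemma mConst_mult_term6: "mConst a * term6 i j l r s t c = term6 i j l r s t (a * c)"
  by (simp add: mConst_def term6_def mult_single)

lemma xyz_form_term6: "xyz_form q = (\<Sum>m\<in>UNIV. case Rep_mon4 m of (i, j, l) \<Rightarrow> term6 i j l 0 0 0 (q m))"
proof -
  have pow: "mVar v ^ n = Poly_Mapping.single (Poly_Mapping.single v n) (1::'a)" for v :: plane_var and n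
    by (induction n) (simp_all add: mVar_def mult_single single_add[symmetric])
  show ?thesis
    unfolding xyz_form_def by (simp add: mConst_def pow term6_def mult_single)
qed

lemma lookup_term6:
  "Poly_Mapping.lookup (term6 i j l r s t c) (Poly_Mapping.single VU r' + Poly_Mapping.single VV s' + Poly_Mapping.single VW t') =
     (if i = 0 \<and> j = 0 \<and> l = 0 \<and> r = r' \<and> s = s' \<and> t = t' then c else 0)"
proof -
  have "(Poly_Mapping.single VX i + Poly_Mapping.single VY j +
    Poly_Mapping.single VZ l + Poly_Mapping.single VU r + Poly_Mapping.single VV s + Poly_Mapping.single VW t =
    Poly_Mapping.single VU r' + Poly_Mapping.single VV s' + Poly_Mapping.single VW t')
    \<longleftrightarrow> (i = 0 \<and> j = 0 \<and> l = 0 \<and> r = r' \<and> s = s' \<and> t = t')" (is "?l = ?r \<longleftrightarrow> ?c")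
  proof
    assume eq: "?l = ?r"
    show ?c
      using arg_cong[OF eq, of "\<lambda>m. Poly_Mapping.lookup m VX"] arg_cong[OF eq, of "\<lambda>m. Poly_Mapping.lookup m VY"]
        arg_cong[OF eq, of "\<lambda>m. Poly_Mapping.lookup m VZ"] arg_cong[OF eq, of "\<lambda>m. Poly_Mapping.lookup m VU"]
        arg_cong[OF eq, of "\<lambda>m. Poly_Mapping.lookup m VV"] arg_cong[OF eq, of "\<lambda>m. Poly_Mapping.lookup m VW"]
      by (simp add: lookup_add lookup_single)
  qed simp
  then show ?thesis
    by (simp add: term6_def lookup_single when_def)
qed

lemma funpow_small: "(f ^^ 2) x = f (f x)" "(f ^^ 3) x = f (f (f x))" "(f ^^ 4) x = f (f (f (f x)))"
  by (simp_all add: numeral_eq_Suc)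

definition uvw_coeff :: "(plane_var, 'r::zero) mpoly \<Rightarrow> nat \<Rightarrow> nat \<Rightarrow> nat \<Rightarrow> 'r"
  where "uvw_coeff F r s t = Poly_Mapping.lookup F
           (Poly_Mapping.single VU r + Poly_Mapping.single VV s + Poly_Mapping.single VW t)"

lemma uvw_coeff_add: "uvw_coeff (F + G) r s t = uvw_coeff F r s t + uvw_coeff G r s t"
  by (simp add: uvw_coeff_def lookup_add)

lemma uvw_coeff_term6:
  "uvw_coeff (term6 i j l r s t c) r' s' t' =
     (if i = 0 \<and> j = 0 \<and> l = 0 \<and> r = r' \<and> s = s' \<and> t = t' then c else 0)"
  by (simp add: uvw_coeff_def lookup_term6)

lemma uvw_coeff_0: "uvw_coeff 0 r s t = 0"
  by (simp add: uvw_coeff_def)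

lemma uvw_quartic_mo: "i + j + l = 4 \<Longrightarrow> uvw_quartic F (mo i j l) = uvw_coeff F i j l"
  by (simp add: uvw_quartic_def uvw_coeff_def Rep_mo)

lemma numeral_mult_term6: "numeral n * term6 i j l r s t c = term6 i j l r s t (numeral n * c)"
  using mConst_mult_term6[of "numeral n"] by (simp add: ring_mapD(9)[OF ring_map_mConst])

lemmas op_expand = funpow_small op_term6 op_add op_0 term6_0 numeral_mult_term6

lemma form_expand: "xyz_form q = term6 4 0 0 0 0 0 (q (mo 4 0 0)) + term6 3 1 0 0 0 0 (q (mo 3 1 0)) +
   term6 3 0 1 0 0 0 (q (mo 3 0 1)) + term6 2 2 0 0 0 0 (q (mo 2 2 0)) + term6 2 1 1 0 0 0 (q (mo 2 1 1)) +
   term6 2 0 2 0 0 0 (q (mo 2 0 2)) + term6 1 3 0 0 0 0 (q (mo 1 3 0)) + term6 1 2 1 0 0 0 (q (mo 1 2 1)) +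
   term6 1 1 2 0 0 0 (q (mo 1 1 2)) + term6 1 0 3 0 0 0 (q (mo 1 0 3)) + term6 0 4 0 0 0 0 (q (mo 0 4 0)) +
   term6 0 3 1 0 0 0 (q (mo 0 3 1)) + term6 0 2 2 0 0 0 (q (mo 0 2 2)) + term6 0 1 3 0 0 0 (q (mo 0 1 3)) +
   term6 0 0 4 0 0 0 (q (mo 0 0 4))"
  unfolding xyz_form_term6 sum_mon4 by (simp add: Rep_mo)



text \<open>The operators preserve the torus weights, so the coefficient of \<open>u\<^sup>i v\<^sup>j w\<^sup>l\<close> only involves pairs of monomials with
  product \<open>x\<^sup>4\<^sup>-\<^sup>i y\<^sup>4\<^sup>-\<^sup>j z\<^sup>4\<^sup>-\<^sup>l\<close>; this is why each of the fifteen quadrics is short.\<close>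

lemma H4_coeffs:
  fixes q :: "'r::comm_ring_1 quartic"
  shows
    "H4 q (mo 4 0 0) = 48 * q (mo 0 4 0) * q (mo 0 0 4) - 12 * q (mo 0 3 1) * q (mo 0 1 3) + 4 * q (mo 0 2 2)^2"
    "H4 q (mo 3 1 0) = - 48 * q (mo 1 3 0) * q (mo 0 0 4) + 12 * q (mo 1 2 1) * q (mo 0 1 3) - 8 * q (mo 1 1 2) * q (mo 0 2 2) + 12 * q (mo 1 0 3) * q (mo 0 3 1)"
    "H4 q (mo 3 0 1) = 12 * q (mo 1 3 0) * q (mo 0 1 3) - 8 * q (mo 1 2 1) * q (mo 0 2 2) + 12 * q (mo 1 1 2) * q (mo 0 3 1) - 48 * q (mo 1 0 3) * q (mo 0 4 0)"
    "H4 q (mo 2 2 0) = 48 * q (mo 2 2 0) * q (mo 0 0 4) - 12 * q (mo 2 1 1) * q (mo 0 1 3) + 8 * q (mo 2 0 2) * q (mo 0 2 2) - 12 * q (mo 1 2 1) * q (mo 1 0 3) + 4 * q (mo 1 1 2)^2"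
    "H4 q (mo 2 1 1) = - 24 * q (mo 2 2 0) * q (mo 0 1 3) + 16 * q (mo 2 1 1) * q (mo 0 2 2) - 24 * q (mo 2 0 2) * q (mo 0 3 1) + 36 * q (mo 1 3 0) * q (mo 1 0 3) - 4 * q (mo 1 2 1) * q (mo 1 1 2)"
    "H4 q (mo 2 0 2) = 8 * q (mo 2 2 0) * q (mo 0 2 2) - 12 * q (mo 2 1 1) * q (mo 0 3 1) + 48 * q (mo 2 0 2) * q (mo 0 4 0) - 12 * q (mo 1 3 0) * q (mo 1 1 2) + 4 * q (mo 1 2 1)^2"
    "H4 q (mo 1 3 0) = - 48 * q (mo 3 1 0) * q (mo 0 0 4) + 12 * q (mo 3 0 1) * q (mo 0 1 3) + 12 * q (mo 2 1 1) * q (mo 1 0 3) - 8 * q (mo 2 0 2) * q (mo 1 1 2)"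
    "H4 q (mo 1 2 1) = 36 * q (mo 3 1 0) * q (mo 0 1 3) - 24 * q (mo 3 0 1) * q (mo 0 2 2) - 24 * q (mo 2 2 0) * q (mo 1 0 3) - 4 * q (mo 2 1 1) * q (mo 1 1 2) + 16 * q (mo 2 0 2) * q (mo 1 2 1)"
    "H4 q (mo 1 1 2) = - 24 * q (mo 3 1 0) * q (mo 0 2 2) + 36 * q (mo 3 0 1) * q (mo 0 3 1) + 16 * q (mo 2 2 0) * q (mo 1 1 2) - 4 * q (mo 2 1 1) * q (mo 1 2 1) - 24 * q (mo 2 0 2) * q (mo 1 3 0)"
    "H4 q (mo 1 0 3) = 12 * q (mo 3 1 0) * q (mo 0 3 1) - 48 * q (mo 3 0 1) * q (mo 0 4 0) - 8 * q (mo 2 2 0) * q (mo 1 2 1) + 12 * q (mo 2 1 1) * q (mo 1 3 0)"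
    "H4 q (mo 0 4 0) = 48 * q (mo 4 0 0) * q (mo 0 0 4) - 12 * q (mo 3 0 1) * q (mo 1 0 3) + 4 * q (mo 2 0 2)^2"
    "H4 q (mo 0 3 1) = - 48 * q (mo 4 0 0) * q (mo 0 1 3) + 12 * q (mo 3 1 0) * q (mo 1 0 3) + 12 * q (mo 3 0 1) * q (mo 1 1 2) - 8 * q (mo 2 1 1) * q (mo 2 0 2)"
    "H4 q (mo 0 2 2) = 48 * q (mo 4 0 0) * q (mo 0 2 2) - 12 * q (mo 3 1 0) * q (mo 1 1 2) - 12 * q (mo 3 0 1) * q (mo 1 2 1) + 8 * q (mo 2 2 0) * q (mo 2 0 2) + 4 * q (mo 2 1 1)^2"
    "H4 q (mo 0 1 3) = - 48 * q (mo 4 0 0) * q (mo 0 3 1) + 12 * q (mo 3 1 0) * q (mo 1 2 1) + 12 * q (mo 3 0 1) * q (mo 1 3 0) - 8 * q (mo 2 2 0) * q (mo 2 1 1)"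
    "H4 q (mo 0 0 4) = 48 * q (mo 4 0 0) * q (mo 0 4 0) - 12 * q (mo 3 1 0) * q (mo 1 3 0) + 4 * q (mo 2 2 0)^2"

  unfolding H4_def apply_op_def sum_mon4
  by ((simp add: uvw_quartic_mo Rep_mo uvw_coeff_add form_expand; simp add: op_expand;
      simp add: distrib_left mConst_mult_term6 uvw_coeff_add uvw_coeff_term6 uvw_coeff_0;
      (simp add: algebra_simps power2_eq_square)?)+)

text \<open>The second copy matches the form that indices take after the simplifier has replaced \<open>1\<close> by \<open>Suc 0\<close>.\<close>

lemmas H4_simps = H4_coeffs H4_coeffs[unfolded One_nat_def]

lemma ring_map_H4:
  assumes "ring_map h"
  shows "h (H4 q m) = H4 (\<lambda>m. h (q m)) m"
proof -
  have "\<forall>m. h (H4 q m) = H4 (\<lambda>m. h (q m)) m"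
    unfolding all_mon4 by (simp add: H4_simps ring_mapD[OF assms])
  then show ?thesis by blast
qed

definition cubic_exponents :: "(nat \<times> nat \<times> nat) list"
  where "cubic_exponents = [(3,0,0), (2,1,0), (2,0,1), (1,2,0), (1,1,1), (1,0,2), (0,3,0), (0,2,1), (0,1,2), (0,0,3)]"

text \<open>A coefficient of the partial derivative in the direction \<open>(i, j, l)\<close>, which is meant to be a unit vector; the factor is then
  the exponent of the differentiated variable.\<close>

fun partial_coeff :: "nat \<times> nat \<times> nat \<Rightarrow> 'r::comm_ring_1 quartic \<Rightarrow> nat \<times> nat \<times> nat \<Rightarrow> 'r"
  where "partial_coeff (i, j, l) q (a, b, c) = of_nat (i * a + j * b + l * c + 1) * q (mo (i + a) (j + b) (l + c))"

text \<open>The apolar pairing of two cubics multiplies the coefficients of equal monomials with the weight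
  \<open>a! b! c!\<close>; it lets one cubic act on the other as a differential operator. It is applied here to partial derivatives of a
  quartic in \<open>x, y, z\<close> and of a quartic in the dual coordinates.\<close>

definition apolar_partials :: "nat \<times> nat \<times> nat \<Rightarrow> nat \<times> nat \<times> nat \<Rightarrow> 'r::comm_ring_1 quartic \<Rightarrow> 'r quartic \<Rightarrow> 'r"
  where "apolar_partials d e p q = (\<Sum>(a, b, c)\<leftarrow>cubic_exponents.
           of_nat (fact a * fact b * fact c) * partial_coeff d p (a, b, c) * partial_coeff e q (a, b, c))"

lemma ring_map_apolar_partials:
  assumes "ring_map h"
  shows "h (apolar_partials d e p q) = apolar_partials d e (\<lambda>m. h (p m)) (\<lambda>m. h (q m))"
  by (cases d; cases e) (simp add: apolar_partials_def cubic_exponents_def ring_mapD[OF assms] del: of_nat_add of_nat_mult of_nat_Suc)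

text \<open>The matrix of all these pairings is a scalar matrix, whose diagonal entry is an
  invariant of \<open>q\<close> of degree three. The resulting equations of bidegree (1, 1) on the graph persist on its closure, also over the
  quartics \<open>q\<close> with \<open>H4 q = 0\<close>, and are what excludes these quartics from the fiber. The identities are polynomial
  identities in the fifteen coefficients of \<open>q\<close>.\<close>

lemma apolar_partials_H4:
  fixes q :: "'r::comm_ring_1 quartic"
  shows "apolar_partials (1,0,0) (0,1,0) q (H4 q) = 0" "apolar_partials (1,0,0) (0,0,1) q (H4 q) = 0"
    "apolar_partials (0,1,0) (1,0,0) q (H4 q) = 0" "apolar_partials (0,1,0) (0,0,1) q (H4 q) = 0"
    "apolar_partials (0,0,1) (1,0,0) q (H4 q) = 0" "apolar_partials (0,0,1) (0,1,0) q (H4 q) = 0"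
    "apolar_partials (0,1,0) (0,1,0) q (H4 q) - apolar_partials (1,0,0) (1,0,0) q (H4 q) = 0"
    "apolar_partials (0,0,1) (0,0,1) q (H4 q) - apolar_partials (1,0,0) (1,0,0) q (H4 q) = 0"
  by ((simp add: apolar_partials_def cubic_exponents_def H4_coeffs fact_numeral del: One_nat_def;
      simp add: algebra_simps power2_eq_square)+)

lemma term6_mult: "term6 i j l r s t c * term6 i' j' l' r' s' t' c' =
   term6 (i + i') (j + j') (l + l') (r + r') (s + s') (t + t') (c * c')"
  by (simp add: term6_def mult_single single_add ac_simps)

lemma term6_power: "term6 i j l r s t c ^ n = term6 (n * i) (n * j) (n * l) (n * r) (n * s) (n * t) (c ^ n)"
  by (induction n) (simp_all add: term6_mult, simp add: term6_def)

lemma mVar_term6: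
  "mVar VX = term6 1 0 0 0 0 0 1" "mVar VY = term6 0 1 0 0 0 0 1" "mVar VZ = term6 0 0 1 0 0 0 1"
  "mVar VU = term6 0 0 0 1 0 0 1" "mVar VV = term6 0 0 0 0 1 0 1" "mVar VW = term6 0 0 0 0 0 1 1"
  by (simp_all add: term6_def mVar_def)

lemma lookup_term6_xyz:
  "Poly_Mapping.lookup (term6 i j l r s t c) (Poly_Mapping.single VX i' + Poly_Mapping.single VY j' + Poly_Mapping.single VZ l') =
     (if i = i' \<and> j = j' \<and> l = l' \<and> r = 0 \<and> s = 0 \<and> t = 0 then c else 0)"
proof -
  have "(Poly_Mapping.single VX i + Poly_Mapping.single VY j +
    Poly_Mapping.single VZ l + Poly_Mapping.single VU r + Poly_Mapping.single VV s + Poly_Mapping.single VW t =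
    Poly_Mapping.single VX i' + Poly_Mapping.single VY j' + Poly_Mapping.single VZ l')
    \<longleftrightarrow> (i = i' \<and> j = j' \<and> l = l' \<and> r = 0 \<and> s = 0 \<and> t = 0)" (is "?l = ?r \<longleftrightarrow> ?c")
  proof
    assume eq: "?l = ?r"
    show ?c
      using arg_cong[OF eq, of "\<lambda>m. Poly_Mapping.lookup m VX"] arg_cong[OF eq, of "\<lambda>m. Poly_Mapping.lookup m VY"]
        arg_cong[OF eq, of "\<lambda>m. Poly_Mapping.lookup m VZ"] arg_cong[OF eq, of "\<lambda>m. Poly_Mapping.lookup m VU"]
        arg_cong[OF eq, of "\<lambda>m. Poly_Mapping.lookup m VV"] arg_cong[OF eq, of "\<lambda>m. Poly_Mapping.lookup m VW"]
      by (simp add: lookup_add lookup_single)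
  qed simp
  then show ?thesis
    by (simp add: term6_def lookup_single when_def)
qed

definition xyz_coeff :: "(plane_var, 'r::zero) mpoly \<Rightarrow> nat \<Rightarrow> nat \<Rightarrow> nat \<Rightarrow> 'r"
  where "xyz_coeff F r s t = Poly_Mapping.lookup F
           (Poly_Mapping.single VX r + Poly_Mapping.single VY s + Poly_Mapping.single VZ t)"

lemma xyz_coeff_simps: 
  "xyz_coeff (F + G) r s t = xyz_coeff F r s t + xyz_coeff G r s t"
  "xyz_coeff (F' - G') r s t = xyz_coeff F' r s t - xyz_coeff G' r s t"
  "xyz_coeff (- G') r s t = - xyz_coeff G' r s t"
  "xyz_coeff (term6 i j l r' s' t' c) r s t = (if i = r \<and> j = s \<and> l = t \<and> r' = 0 \<and> s' = 0 \<and> t' = 0 then c else 0)"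
  for F' G' :: "(plane_var, 'a::comm_ring_1) mpoly"
  by (simp_all add: xyz_coeff_def lookup_add lookup_term6_xyz lookup_minus)

lemma xyz_quartic_mo: "i + j + l = 4 \<Longrightarrow> xyz_quartic F (mo i j l) = xyz_coeff F i j l"
  by (simp add: xyz_quartic_def xyz_coeff_def Rep_mo)

text \<open>The quartic \<open>s (x\<^sup>4 + y\<^sup>4 + z\<^sup>4) + p y\<^sup>2z\<^sup>2 + q x\<^sup>2z\<^sup>2 + r x\<^sup>2y\<^sup>2 + xyz (a x + b y + c z)\<close>: the shape that the
  equations of bidegree (1, 1) impose over \<open>Fer'\<close>.\<close>

definition special_quartic :: "'r \<Rightarrow> 'r \<Rightarrow> 'r \<Rightarrow> 'r \<Rightarrow> 'r \<Rightarrow> 'r \<Rightarrow> 'r \<Rightarrow> 'r::comm_ring_1 quartic"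
  where "special_quartic s p q r a b c m = (case Rep_mon4 m of (i, j, l) \<Rightarrow>
     if (i, j, l) \<in> {(4,0,0), (0,4,0), (0,0,4)} then s else
     if (i, j, l) = (0,2,2) then p else if (i, j, l) = (2,0,2) then q else if (i, j, l) = (2,2,0) then r else
     if (i, j, l) = (2,1,1) then a else if (i, j, l) = (1,2,1) then b else if (i, j, l) = (1,1,2) then c else 0)"

lemma special_quartic_mo: "i + j + l = 4 \<Longrightarrow> special_quartic s p q r a b c (mo i j l) = (
     if (i, j, l) \<in> {(4,0,0), (0,4,0), (0,0,4)} then s else
     if (i, j, l) = (0,2,2) then p else if (i, j, l) = (2,0,2) then q else if (i, j, l) = (2,2,0) then r else
     if (i, j, l) = (2,1,1) then a else if (i, j, l) = (1,2,1) then b else if (i, j, l) = (1,1,2) then c else 0)"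
  by (simp add: special_quartic_def Rep_mo)

lemma quartic_eqI: "(\<forall>m. p m = q m) \<Longrightarrow> p = (q :: 'r quartic)"
  by blast

lemma quartics_special:
  "Fer = special_quartic 1 0 0 0 0 0 0" "Fer' = special_quartic 1 0 0 0 0 0 0"
  "C0 = special_quartic 1 (-6) (-6) (-6) 0 0 0" "C1 = special_quartic 1 6 6 (-6) 0 0 0"
  "C2 = special_quartic 1 6 (-6) 6 0 0 0" "C3 = special_quartic 1 (-6) 6 6 0 0 0"
      apply (rule quartic_eqI, unfold all_mon4 Fer_def, simp add: xyz_quartic_mo mVar_term6 term6_power term6_mult
       numeral_mult_term6 distrib_left right_diff_distrib xyz_coeff_simps special_quartic_mo)
     apply (rule quartic_eqI, unfold all_mon4 Fer'_def, simp add: uvw_quartic_mo mVar_term6 term6_power term6_mult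
       numeral_mult_term6 uvw_coeff_add uvw_coeff_term6 special_quartic_mo)
    apply (rule quartic_eqI, unfold all_mon4 C0_def, simp add: xyz_quartic_mo mVar_term6 term6_power term6_mult
       numeral_mult_term6 distrib_left right_diff_distrib xyz_coeff_simps special_quartic_mo)
   apply (rule quartic_eqI, unfold all_mon4 C1_def, simp add: xyz_quartic_mo mVar_term6 term6_power term6_mult
       numeral_mult_term6 distrib_left right_diff_distrib xyz_coeff_simps special_quartic_mo)
   apply (rule quartic_eqI, unfold all_mon4 C2_def, simp add: xyz_quartic_mo mVar_term6 term6_power term6_mult
       numeral_mult_term6 distrib_left right_diff_distrib xyz_coeff_simps special_quartic_mo)
   apply (rule quartic_eqI, unfold all_mon4 C3_def, simp add: xyz_quartic_mo mVar_term6 term6_power term6_mult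
       numeral_mult_term6 distrib_left right_diff_distrib xyz_coeff_simps special_quartic_mo)
  done

lemma H4_special:
  fixes s p q r a b c :: "'r::comm_ring_1"
  defines "C \<equiv> special_quartic s p q r a b c"
  shows "H4 C (mo 4 0 0) = 48 * s^2 + 4 * p^2" "H4 C (mo 0 4 0) = 48 * s^2 + 4 * q^2"
    "H4 C (mo 0 0 4) = 48 * s^2 + 4 * r^2"
    "H4 C (mo 3 1 0) = - 8 * (p * c)" "H4 C (mo 3 0 1) = - 8 * (p * b)" "H4 C (mo 1 3 0) = - 8 * (q * c)"
    "H4 C (mo 0 3 1) = - 8 * (q * a)" "H4 C (mo 1 0 3) = - 8 * (r * b)" "H4 C (mo 0 1 3) = - 8 * (r * a)"
    "H4 C (mo 0 2 2) = 48 * s * p + 8 * q * r + 4 * a^2" "H4 C (mo 2 0 2) = 48 * s * q + 8 * p * r + 4 * b^2"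
    "H4 C (mo 2 2 0) = 48 * s * r + 8 * p * q + 4 * c^2"
    "H4 C (mo 2 1 1) = 16 * p * a - 4 * b * c" "H4 C (mo 1 2 1) = 16 * q * b - 4 * a * c"
    "H4 C (mo 1 1 2) = 16 * r * c - 4 * a * b"
  unfolding C_def by (simp_all add: H4_simps special_quartic_mo[unfolded One_nat_def] special_quartic_mo power2_eq_square mult_ac)

section \<open>Ideals of commutative rings\<close>

text \<open>The record structure of a type-class ring. It covers both \<open>bipoly_ring\<close> and the algebras with which local
  rings are compared.\<close>

definition type_ring :: "'a::comm_ring_1 ring"
  where "type_ring = \<lparr>carrier = UNIV, monoid.mult = (*), one = 1, zero = 0, add = (+)\<rparr>"

lemma type_ring_simps [simp]:
  "carrier type_ring = UNIV" "a \<otimes>\<^bsub>type_ring\<^esub> b = a * b" "\<one>\<^bsub>type_ring\<^esub> = 1"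
  "\<zero>\<^bsub>type_ring\<^esub> = 0" "a \<oplus>\<^bsub>type_ring\<^esub> b = a + b"
  by (simp_all add: type_ring_def)

lemma bipoly_ring_eq: "bipoly_ring = type_ring"
  by (simp add: bipoly_ring_def type_ring_def)

lemma cring_type_ring: "cring (type_ring :: 'a::comm_ring_1 ring)"
proof (rule cringI)
  have "\<exists>b. b + a = 0 \<and> a + b = 0" for a :: 'a
    by (rule exI[of _ "- a"]) simp
  then show "abelian_group (type_ring :: 'a ring)"
    by (intro abelian_groupI) (auto simp: ac_simps)
  show "Group.comm_monoid (type_ring :: 'a ring)"
    by (intro Group.comm_monoidI) (auto simp: ac_simps)
qed (auto simp: algebra_simps)

lemma ring_type_ring: "ring (type_ring :: 'a::comm_ring_1 ring)"
  by (intro cring.axioms(1) cring_type_ring)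

lemma a_inv_type_ring: "\<ominus>\<^bsub>type_ring\<^esub> a = - (a :: 'a::comm_ring_1)"
proof -
  interpret ring "type_ring :: 'a ring" by (rule ring_type_ring)
  show ?thesis by (rule minus_equality) simp_all
qed

lemma ideal_type_ring_iff:
  "ideal I (type_ring :: 'a::comm_ring_1 ring) \<longleftrightarrow>
     0 \<in> I \<and> (\<forall>a\<in>I. \<forall>b\<in>I. a + b \<in> I) \<and> (\<forall>a\<in>I. \<forall>r. r * a \<in> I)" (is "_ \<longleftrightarrow> ?R")
proof
  assume "ideal I (type_ring :: 'a ring)"
  then interpret ideal I "type_ring :: 'a ring" .
  show ?R
    using additive_subgroup.zero_closed[OF additive_subgroup_axioms]
      additive_subgroup.a_closed[OF additive_subgroup_axioms] I_l_closed by auto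
next
  assume R: ?R
  have "- a \<in> I" if "a \<in> I" for a
    using R that by (metis mult_minus1)
  then have inv: "inv\<^bsub>add_monoid type_ring\<^esub> a \<in> I" if "a \<in> I" for a
    using that by (simp only: a_inv_type_ring[unfolded a_inv_def])
  have "subgroup I (add_monoid (type_ring :: 'a ring))"
    using R by (intro subgroup.intro inv) auto
  then show "ideal I (type_ring :: 'a ring)"
    using R by (intro idealI[OF ring_type_ring]) (auto simp: mult.commute)
qed

lemma ideal_bipolyD:
  assumes "ideal I bipoly_ring"
  shows "0 \<in> I" "a \<in> I \<Longrightarrow> b \<in> I \<Longrightarrow> a + b \<in> I" "a \<in> I \<Longrightarrow> r * a \<in> I" "a \<in> I \<Longrightarrow> a * r \<in> I"
    "a \<in> I \<Longrightarrow> - a \<in> I" "a \<in> I \<Longrightarrow> b \<in> I \<Longrightarrow> a - b \<in> I"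
    "(\<And>i. i \<in> S \<Longrightarrow> f i \<in> I) \<Longrightarrow> sum f S \<in> I"
proof -
  note I = assms[unfolded bipoly_ring_eq ideal_type_ring_iff]
  show zero: "0 \<in> I" and add: "a \<in> I \<Longrightarrow> b \<in> I \<Longrightarrow> a + b \<in> I" and mult: "a \<in> I \<Longrightarrow> r * a \<in> I" for a b r
    using I by auto
  show "a \<in> I \<Longrightarrow> a * r \<in> I"
    using mult[of a r] by (simp add: mult.commute)
  show minus: "a \<in> I \<Longrightarrow> - a \<in> I" for a
    using mult[of a "-1"] by simp
  show "a \<in> I \<Longrightarrow> b \<in> I \<Longrightarrow> a - b \<in> I"
    using add[of a "- b"] minus[of b] by simp
  show "(\<And>i. i \<in> S \<Longrightarrow> f i \<in> I) \<Longrightarrow> sum f S \<in> I"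
    by (induction S rule: infinite_finite_induct) (auto simp: zero add)
qed

lemma ideal_generated: "ideal (Idl\<^bsub>bipoly_ring\<^esub> S) bipoly_ring"
  unfolding bipoly_ring_eq by (rule ring.genideal_ideal[OF ring_type_ring]) simp

lemma generators_subset: "S \<subseteq> Idl\<^bsub>bipoly_ring\<^esub> S"
  unfolding bipoly_ring_eq by (rule ring.genideal_self[OF ring_type_ring]) simp

lemma generated_subset_iff: "ideal I bipoly_ring \<Longrightarrow> Idl\<^bsub>bipoly_ring\<^esub> S \<subseteq> I \<longleftrightarrow> S \<subseteq> I"
  using generators_subset[of S] unfolding bipoly_ring_eq
  by (auto dest: ring.genideal_minimal[OF ring_type_ring, THEN subsetD])

lemma ideal_sum:
  assumes "ideal I bipoly_ring" "ideal J bipoly_ring"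
  shows "ideal (I <+>\<^bsub>bipoly_ring\<^esub> J) bipoly_ring"
  using assms unfolding bipoly_ring_eq by (intro ring.add_ideals[OF ring_type_ring])

lemma mem_set_add_bipoly: "F \<in> I <+>\<^bsub>bipoly_ring\<^esub> J \<longleftrightarrow> (\<exists>G\<in>I. \<exists>H\<in>J. F = G + H)"
  by (auto simp: set_add_def' bipoly_ring_eq)

lemma ideal_sum_subset_iff:
  assumes "ideal I bipoly_ring" "ideal J bipoly_ring" "ideal K bipoly_ring"
  shows "I <+>\<^bsub>bipoly_ring\<^esub> J \<subseteq> K \<longleftrightarrow> I \<subseteq> K \<and> J \<subseteq> K"
proof (intro iffI conjI subsetI)
  assume *: "I <+>\<^bsub>bipoly_ring\<^esub> J \<subseteq> K"
  fix F
  show "F \<in> I \<Longrightarrow> F \<in> K" 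
    using * ideal_bipolyD(1)[OF assms(2)] unfolding subset_iff mem_set_add_bipoly by (metis add_0_right)
  show "F \<in> J \<Longrightarrow> F \<in> K"
    using * ideal_bipolyD(1)[OF assms(1)] unfolding subset_iff mem_set_add_bipoly by (metis add_0_left)
next
  fix F assume "I \<subseteq> K \<and> J \<subseteq> K" "F \<in> I <+>\<^bsub>bipoly_ring\<^esub> J"
  then show "F \<in> K"
    unfolding mem_set_add_bipoly using ideal_bipolyD(2)[OF assms(3)] by blast
qed

lemma prime_bipolyD:
  assumes "primeideal P bipoly_ring"
  shows "ideal P bipoly_ring" "1 \<notin> P" "a * b \<in> P \<longleftrightarrow> a \<in> P \<or> b \<in> P"
proof -
  interpret primeideal P bipoly_ring by fact
  show id: "ideal P bipoly_ring" by (rule is_ideal)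
  show "1 \<notin> P"
  proof
    assume "1 \<in> P"
    then have "F \<in> P" for F
      using ideal_bipolyD(3)[OF id, of 1 F] by simp
    then show False
      using I_notcarr by (auto simp: bipoly_ring_eq)
  qed
  show "a * b \<in> P \<longleftrightarrow> a \<in> P \<or> b \<in> P"
  proof
    assume "a * b \<in> P"
    then show "a \<in> P \<or> b \<in> P" 
      using I_prime[of a b] by (simp add: bipoly_ring_eq)
  next
    assume "a \<in> P \<or> b \<in> P"
    then show "a * b \<in> P"
      using ideal_bipolyD(3)[OF id, of b a] ideal_bipolyD(4)[OF id, of a b] by blast
  qed
qed

lemma ring_map_kernel_ideal:
  assumes "ring_map h"
  shows "ideal {F. h F = 0} bipoly_ring"
  by (simp add: bipoly_ring_eq ideal_type_ring_iff ring_mapD[OF assms])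

lemma ring_map_kernel_prime:
  fixes h :: "'k::comm_ring_1 bipoly \<Rightarrow> 's::idom"
  assumes "ring_map h"
  shows "primeideal {F. h F = 0} bipoly_ring"
proof (rule primeidealI[OF ring_map_kernel_ideal[OF assms]])
  show "cring (bipoly_ring :: 'k bipoly ring)"
    by (simp add: bipoly_ring_eq cring_type_ring)
  have "1 \<notin> {F. h F = 0}"
    by (simp add: ring_mapD(1)[OF assms])
  then show "carrier bipoly_ring \<noteq> {F. h F = 0}"
    by (auto simp: bipoly_ring_eq)
qed (simp add: bipoly_ring_eq ring_mapD[OF assms])

text \<open>Replacing the variables by congruent elements does not change residue classes. In this way the
  equations of the fiber are simplified: coordinates are replaced by the representatives already known.\<close>

lemma msubst_congruent:
  fixes F :: "'k::comm_ring_1 bipoly"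
  assumes I: "ideal I bipoly_ring" and \<sigma>: "\<And>c. \<sigma> c - mVar c \<in> I"
  shows "msubst mConst \<sigma> F - F \<in> I"
proof (induction F rule: mpoly_induct)
  case (const c)
  show ?case by (simp add: msubst_mConst ring_map_mConst ideal_bipolyD(1)[OF I])
next
  case (var v)
  show ?case by (simp add: msubst_mVar ring_map_mConst \<sigma>)
next
  case (add F G)
  then have "(msubst mConst \<sigma> F - F) + (msubst mConst \<sigma> G - G) \<in> I"
    by (rule ideal_bipolyD(2)[OF I])
  then show ?case
    by (simp only: msubst_add[OF ring_map_mConst] add_diff_add)
next
  case (mult F G)
  then have "msubst mConst \<sigma> F * (msubst mConst \<sigma> G - G) + (msubst mConst \<sigma> F - F) * G \<in> I"
    by (intro ideal_bipolyD(2)[OF I] ideal_bipolyD(3,4)[OF I])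
  then show ?case
    by (simp add: msubst_mult[OF ring_map_mConst] right_diff_distrib left_diff_distrib)
qed

lemma msubst_congruent_mem:
  assumes "ideal I bipoly_ring" "\<And>c. \<sigma> c - mVar c \<in> I"
  shows "msubst mConst \<sigma> F \<in> I \<longleftrightarrow> F \<in> I"
proof
  assume "msubst mConst \<sigma> F \<in> I"
  from ideal_bipolyD(6)[OF assms(1) this msubst_congruent[OF assms, of F]] show "F \<in> I"
    by simp
next
  assume "F \<in> I"
  from ideal_bipolyD(2)[OF assms(1) msubst_congruent[OF assms, of F] this] show "msubst mConst \<sigma> F \<in> I"
    by simp
qed

section \<open>Bihomogeneous polynomials\<close>

definition bidegree :: "(coord \<Rightarrow>\<^sub>0 nat) \<Rightarrow> nat \<times> nat"
  where "bidegree t = (\<Sum>m\<in>UNIV. Poly_Mapping.lookup t (CoA m), \<Sum>m\<in>UNIV. Poly_Mapping.lookup t (CoB m))"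

lemma bihom_iff: "bihom d e F \<longleftrightarrow> (\<forall>t\<in>Poly_Mapping.keys F. bidegree t = (d, e))"
  by (auto simp: bihom_def bidegree_def)

lemma bidegree_add: "bidegree (s + t) = (fst (bidegree s) + fst (bidegree t), snd (bidegree s) + snd (bidegree t))"
  by (simp add: bidegree_def lookup_add sum.distrib)

lemma bidegree_0: "bidegree 0 = (0, 0)"
  by (simp add: bidegree_def)

lemma bidegree_single_1: "bidegree (Poly_Mapping.single c 1) = (case c of CoA m \<Rightarrow> (1, 0) | CoB m \<Rightarrow> (0, 1))"
  by (simp add: bidegree_def lookup_single when_def split: coord.split)

lemma bihom_0 [simp, intro]: "bihom d e 0"
  by (simp add: bihom_iff)

lemma bihom_add [intro]: "bihom d e F \<Longrightarrow> bihom d e G \<Longrightarrow> bihom d e (F + G)"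
  using keys_add[of F G] by (auto simp: bihom_iff)

lemma bihom_uminus [intro]: "bihom d e F \<Longrightarrow> bihom d e (- F)" for F :: "'k::comm_ring_1 bipoly"
  by (auto simp: bihom_iff in_keys_iff)

lemma bihom_diff [intro]: "bihom d e F \<Longrightarrow> bihom d e G \<Longrightarrow> bihom d e (F - G)" for F :: "'k::comm_ring_1 bipoly"
  using bihom_add[of d e F "- G"] bihom_uminus[of d e G] by simp

lemma bihom_mult:
  "bihom d e F \<Longrightarrow> bihom d' e' G \<Longrightarrow> bihom (d + d') (e + e') (F * G)" for F :: "'k::comm_ring_1 bipoly"
  using keys_mult[of F G] by (fastforce simp: bihom_iff bidegree_add)

lemma bihom_mult_eq:
  "bihom d e F \<Longrightarrow> bihom d' e' G \<Longrightarrow> a = d + d' \<Longrightarrow> b = e + e' \<Longrightarrow> bihom a b (F * G)" for F :: "'k::comm_ring_1 bipoly"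
  using bihom_mult by blast

lemma bihom_mConst [intro]: "bihom 0 0 (mConst c)"
  by (simp add: bihom_iff mConst_def bidegree_0)

lemma bihom_1 [intro]: "bihom 0 0 (1 :: 'k::comm_ring_1 bipoly)"
  using bihom_mConst[of "1 :: 'k"] by simp

lemma bihom_numeral [intro]: "bihom 0 0 (numeral n :: 'k::comm_ring_1 bipoly)"
  using bihom_mConst[of "numeral n :: 'k"] by (simp add: ring_mapD(9)[OF ring_map_mConst])

lemma bihom_power: "bihom d e F \<Longrightarrow> bihom (n * d) (n * e) (F ^ n)" for F :: "'k::comm_ring_1 bipoly"
  by (induction n) (auto intro: bihom_mult_eq)

lemma bihom_CoA [intro]: "bihom 1 0 (mVar (CoA m) :: 'k::comm_ring_1 bipoly)"
  using bidegree_single_1[of "CoA m"] by (simp add: bihom_iff mVar_def)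

lemma bihom_CoB [intro]: "bihom 0 1 (mVar (CoB m) :: 'k::comm_ring_1 bipoly)"
  using bidegree_single_1[of "CoB m"] by (simp add: bihom_iff mVar_def)

text \<open>A bihomogeneous polynomial is a sum of terms of one bidegree, and a term is a product of coordinates and a constant; so
  only sums within one bidegree have to be treated.\<close>

lemma bihom_induct [consumes 1, case_names zero add const CoA CoB mult]:
  fixes F :: "'k::comm_ring_1 bipoly"
  assumes "bihom d e F"
    and "\<And>d e. Q d e 0" "\<And>d e F G. Q d e F \<Longrightarrow> Q d e G \<Longrightarrow> Q d e (F + G)"
    and "\<And>c. Q 0 0 (mConst c)" "\<And>m. Q 1 0 (mVar (CoA m))" "\<And>m. Q 0 1 (mVar (CoB m))"
    and "\<And>d e d' e' F G. Q d e F \<Longrightarrow> Q d' e' G \<Longrightarrow> Q (d + d') (e + e') (F * G)"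
  shows "Q d e F"
proof -
  have vars: "Q (fst (bidegree (Poly_Mapping.single v 1))) (snd (bidegree (Poly_Mapping.single v 1))) (mVar v)" for v
  proof (cases v)
    case (CoA m)
    show ?thesis unfolding bidegree_single_1 CoA using assms(5)[of m] by simp
  next
    case (CoB m)
    show ?thesis unfolding bidegree_single_1 CoB using assms(6)[of m] by simp
  qed
  have mono: "Q (fst (bidegree t)) (snd (bidegree t)) (Poly_Mapping.single t c)" for t c
  proof (induction t rule: exponent_induct)
    case zero
    then show ?case using assms(4)[of c] by (simp add: mConst_def bidegree_0)
  next
    case (var v t)
    show ?case
      unfolding single_as_product bidegree_add fst_conv snd_conv by (intro assms(7) vars var)
  qed
  have "Q d e (\<Sum>t\<in>S. Poly_Mapping.single t (Poly_Mapping.lookup F t))"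
    if "finite S" "S \<subseteq> Poly_Mapping.keys F" for S
    using that
  proof (induction S rule: finite_induct)
    case (insert t S)
    then have "bidegree t = (d, e)"
      using assms(1) by (auto simp: bihom_iff)
    then show ?case
      using insert mono[of t "Poly_Mapping.lookup F t"] by (auto intro: assms(3))
  qed (simp add: assms(2))
  then show ?thesis
    by (subst poly_mapping_sum_single) auto
qed

definition bihom_part :: "nat \<times> nat \<Rightarrow> 'k::comm_ring_1 bipoly \<Rightarrow> 'k bipoly"
  where "bihom_part x F = (\<Sum>t\<in>{t \<in> Poly_Mapping.keys F. bidegree t = x}. Poly_Mapping.single t (Poly_Mapping.lookup F t))"

lemma bihom_sum: "(\<And>i. i \<in> S \<Longrightarrow> bihom d e (f i)) \<Longrightarrow> bihom d e (sum f S)"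
  by (induction S rule: infinite_finite_induct) auto

lemma bihom_bihom_part: "bihom d e (bihom_part (d, e) F)"
  unfolding bihom_part_def by (rule bihom_sum) (auto simp: bihom_iff split: if_splits)

lemma bihom_parts_sum: "F = (\<Sum>x\<in>bidegree ` Poly_Mapping.keys F. bihom_part x F)"
  unfolding bihom_part_def sum.image_gen[OF finite_keys, symmetric] by (rule poly_mapping_sum_single)

lemma msubst_scale:
  fixes F :: "'k::comm_ring_1 bipoly" and \<phi> :: "'k \<Rightarrow> 's::comm_ring_1"
  assumes "bihom d e F" "ring_map \<phi>"
  shows "msubst \<phi> (case_coord (\<lambda>m. a * p m) (\<lambda>m. b * q m)) F = a ^ d * b ^ e * msubst \<phi> (case_coord p q) F"
proof -
  note rules = ring_mapD(4)[OF ring_map_msubst[OF assms(2)]] msubst_add[OF assms(2)] msubst_mult[OF assms(2)]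
      msubst_mConst[OF assms(2)] msubst_mVar[OF assms(2)]
  show ?thesis
    using assms(1)
  proof (induction rule: bihom_induct)
    case (mult d e d' e' F G)
    show ?case
      unfolding rules mult power_add by (simp only: mult_ac)
  qed (simp_all add: rules distrib_left)
qed

section \<open>Rational points as primes\<close>

lemma ring_map_eval_at: "ring_map (eval_at p q)"
  unfolding eval_at_def by (rule ring_map_msubst[OF ring_map_id])

lemma eval_at_simps: "eval_at p q (mConst c) = c" "eval_at p q (mVar (CoA m)) = p m" "eval_at p q (mVar (CoB m)) = q m"
  by (simp_all add: eval_at_def msubst_mConst msubst_mVar ring_map_id)

text \<open>Evaluation at \<open>(X p, Y q)\<close> with two new variables, \<open>X\<close> inside and \<open>Y\<close> outside. The powers of \<open>X\<close> and \<open>Y\<close>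
  separate the bihomogeneous parts of a polynomial, which evaluation at \<open>(p, q)\<close> would mix.\<close>

definition graded_eval :: "'k::field quartic \<Rightarrow> 'k quartic \<Rightarrow> 'k bipoly \<Rightarrow> 'k poly poly"
  where "graded_eval p q = msubst (\<lambda>c. [:[:c:]:]) (case_coord (\<lambda>m. [:[:0, p m:]:]) (\<lambda>m. [:0, [:q m:]:]))"

lemma ring_map_graded_eval: "ring_map (graded_eval p q)"
  unfolding graded_eval_def by (rule ring_map_msubst) (simp add: ring_map_def one_pCons)

lemma graded_eval_bihom:
  assumes "bihom d e F"
  shows "graded_eval p q F = monom (monom (eval_at p q F) d) e"
proof -
  have *: "ring_map (\<lambda>c::'a. [:[:c:]:])"
    by (simp add: ring_map_def one_pCons)
  note ge = ring_mapD[OF ring_map_graded_eval[of p q]] and ev = ring_mapD[OF ring_map_eval_at[of p q]]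
  show ?thesis
    using assms
  proof (induction rule: bihom_induct)
    case (const c)
    show ?case by (simp add: graded_eval_def msubst_mConst * eval_at_simps monom_0)
  next
    case (CoA m)
    show ?case by (simp add: graded_eval_def msubst_mVar * eval_at_simps monom_Suc monom_0)
  next
    case (CoB m)
    show ?case by (simp add: graded_eval_def msubst_mVar * eval_at_simps monom_Suc monom_0)
  qed (simp_all add: ge ev add_monom mult_monom)
qed

lemma ideal_bihom_ideal: "ideal (bihom_ideal S) bipoly_ring"
  unfolding bihom_ideal_def by (rule ideal_generated)

text \<open>The values of the bihomogeneous parts are the coefficients of \<open>graded_eval\<close>. As this map has values in
  a domain, the ideal of a rational point is prime.\<close>

lemma rational_point_eq_kernel: "rational_point p q = {F. graded_eval p q F = 0}"
proof
  show "rational_point p q \<subseteq> {F. graded_eval p q F = 0}"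
    unfolding rational_point_def bihom_ideal_def
      generated_subset_iff[OF ring_map_kernel_ideal[OF ring_map_graded_eval]]
    by (auto simp: graded_eval_bihom)
  show "{F. graded_eval p q F = 0} \<subseteq> rational_point p q"
  proof
    fix F assume "F \<in> {F. graded_eval p q F = 0}"
    then have "0 = graded_eval p q F" by simp
    also have "\<dots> = (\<Sum>x\<in>bidegree ` Poly_Mapping.keys F. graded_eval p q (bihom_part x F))"
      by (rule trans[OF arg_cong[OF bihom_parts_sum, of "graded_eval p q" F] ring_mapD(10)[OF ring_map_graded_eval]])
    also have "\<dots> = (\<Sum>x\<in>bidegree ` Poly_Mapping.keys F. monom (monom (eval_at p q (bihom_part x F)) (fst x)) (snd x))"
    proof (rule sum.cong[OF refl])
      fix x
      show "graded_eval p q (bihom_part x F) = monom (monom (eval_at p q (bihom_part x F)) (fst x)) (snd x)"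
        using graded_eval_bihom[OF bihom_bihom_part[of "fst x" "snd x" F], of p q] by simp
    qed
    finally have eq: "(\<Sum>x\<in>bidegree ` Poly_Mapping.keys F. monom (monom (eval_at p q (bihom_part x F)) (fst x)) (snd x)) = 0"
      by (rule sym)
    have zero: "eval_at p q (bihom_part x F) = 0" if "x \<in> bidegree ` Poly_Mapping.keys F" for x
    proof -
      have "coeff (coeff (\<Sum>x\<in>bidegree ` Poly_Mapping.keys F. monom (monom (eval_at p q (bihom_part x F)) (fst x)) (snd x)) (snd x)) (fst x)
          = (\<Sum>y\<in>bidegree ` Poly_Mapping.keys F. if x = y then eval_at p q (bihom_part y F) else 0)"
        unfolding coeff_sum by (rule sum.cong[OF refl]) (simp add: prod_eq_iff)
      also have "\<dots> = eval_at p q (bihom_part x F)"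
        using that by (subst sum.delta') simp_all
      finally show ?thesis unfolding eq coeff_0 by (rule sym)
    qed
    have "(\<Sum>x\<in>bidegree ` Poly_Mapping.keys F. bihom_part x F) \<in> rational_point p q"
    proof (rule ideal_bipolyD(7))
      show "ideal (rational_point p q) bipoly_ring"
        unfolding rational_point_def by (rule ideal_bihom_ideal)
      fix x assume "x \<in> bidegree ` Poly_Mapping.keys F"
      then have "eval_at p q (bihom_part x F) = 0" "bihom (fst x) (snd x) (bihom_part x F)"
        using bihom_bihom_part[of "fst x" "snd x" F] by (simp_all only: zero prod.collapse)
      then have "bihom_part x F \<in> {F \<in> {F. eval_at p q F = 0}. \<exists>d e. bihom d e F}"
        by blast
      then show "bihom_part x F \<in> rational_point p q"
        unfolding rational_point_def bihom_ideal_def by (rule subsetD[OF generators_subset])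
    qed
    then show "F \<in> rational_point p q"
      by (subst bihom_parts_sum)
  qed
qed

lemma bihom_mem_rational_point_iff:
  fixes p q :: "'k::field quartic"
  shows "bihom d e F \<Longrightarrow> F \<in> rational_point p q \<longleftrightarrow> eval_at p q F = 0"
  by (simp add: rational_point_eq_kernel graded_eval_bihom)

lemma prime_rational_point:
  fixes p q :: "'k::field quartic"
  shows "primeideal (rational_point p q) bipoly_ring"
  unfolding rational_point_eq_kernel by (rule ring_map_kernel_prime[OF ring_map_graded_eval])

lemma bihom_ideal_idem: "bihom_ideal (bihom_ideal S) = bihom_ideal S"
proof
  show "bihom_ideal (bihom_ideal S) \<subseteq> bihom_ideal S"
    unfolding bihom_ideal_def[of "bihom_ideal S"] generated_subset_iff[OF ideal_bihom_ideal] by blast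
  have "{F\<in>S. \<exists>d e. bihom d e F} \<subseteq> bihom_ideal S"
    unfolding bihom_ideal_def by (rule generators_subset)
  then have "{F\<in>S. \<exists>d e. bihom d e F} \<subseteq> {F\<in>bihom_ideal S. \<exists>d e. bihom d e F}"
    by blast
  also have "\<dots> \<subseteq> bihom_ideal (bihom_ideal S)"
    unfolding bihom_ideal_def[of "bihom_ideal S"] by (rule generators_subset)
  finally show "bihom_ideal S \<subseteq> bihom_ideal (bihom_ideal S)"
    unfolding bihom_ideal_def[of S] generated_subset_iff[OF ideal_bihom_ideal] .
qed

lemma rational_point_scale:
  fixes w :: "'k::field"
  assumes "w \<noteq> 0"
  shows "rational_point p (\<lambda>m. w * q m) = rational_point p q"
proof -
  have "eval_at p (\<lambda>m. w * q m) F = 0 \<longleftrightarrow> eval_at p q F = 0" if "bihom d e F" for d e F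
    using msubst_scale[OF that ring_map_id, of 1 p w q] assms by (simp add: eval_at_def)
  then show ?thesis
    unfolding rational_point_def bihom_ideal_def by (metis (mono_tags, lifting) mem_Collect_eq)
qed

section \<open>Local rings and their lengths\<close>

text \<open>The kernel of the localisation at \<open>P\<close> of the ring modulo \<open>J\<close>. Equations that hold near \<open>P\<close> are memberships
  in this ideal, and bihomogeneous elements outside \<open>P\<close> may be cancelled from them.\<close>

definition local_kernel :: "'k::comm_ring_1 bipoly set \<Rightarrow> 'k bipoly set \<Rightarrow> 'k bipoly set"
  where "local_kernel J P = {F. \<exists>c d e. bihom d e c \<and> c \<notin> P \<and> c * F \<in> J}"

lemma local_kernelI: "bihom d e c \<Longrightarrow> c \<notin> P \<Longrightarrow> c * F \<in> J \<Longrightarrow> F \<in> local_kernel J P"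
  by (auto simp: local_kernel_def)

lemma local_kernel_cancel:
  assumes P: "primeideal P bipoly_ring" and c: "bihom d e c" "c \<notin> P" "c * F \<in> local_kernel J P"
  shows "F \<in> local_kernel J P"
proof -
  obtain c' d' e' where c': "bihom d' e' c'" "c' \<notin> P" "c' * (c * F) \<in> J"
    using c(3) by (auto simp: local_kernel_def)
  show ?thesis
  proof (rule local_kernelI)
    show "bihom (d' + d) (e' + e) (c' * c)" by (rule bihom_mult[OF c'(1) c(1)])
    show "c' * c \<notin> P" using c(2) c'(2) by (simp add: prime_bipolyD(3)[OF P])
    show "c' * c * F \<in> J" using c'(3) by (simp add: mult.assoc)
  qed
qed

lemma ideal_local_kernel:
  assumes P: "primeideal P bipoly_ring" and J: "ideal J bipoly_ring"
  shows "ideal (local_kernel J P) bipoly_ring"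
  unfolding bipoly_ring_eq ideal_type_ring_iff
proof (intro conjI ballI allI)
  show "0 \<in> local_kernel J P"
    using prime_bipolyD(2)[OF P] ideal_bipolyD(1)[OF J] by (intro local_kernelI[of 0 0 1]) auto
  fix F assume "F \<in> local_kernel J P"
  then obtain c d e where c: "bihom d e c" "c \<notin> P" "c * F \<in> J"
    by (auto simp: local_kernel_def)
  show "G * F \<in> local_kernel J P" for G
    using ideal_bipolyD(3)[OF J c(3), of G] by (intro local_kernelI[OF c(1,2)]) (simp only: mult.left_commute)
  fix G assume "G \<in> local_kernel J P"
  then obtain c' d' e' where c': "bihom d' e' c'" "c' \<notin> P" "c' * G \<in> J"
    by (auto simp: local_kernel_def)
  show "F + G \<in> local_kernel J P"
  proof (rule local_kernelI)
    show "bihom (d + d') (e + e') (c * c')" by (rule bihom_mult[OF c(1) c'(1)])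
    show "c * c' \<notin> P" using c(2) c'(2) by (simp add: prime_bipolyD(3)[OF P])
    have "c' * (c * F) + c * (c' * G) \<in> J"
      by (intro ideal_bipolyD(2,3)[OF J] c c')
    then show "c * c' * (F + G) \<in> J"
      by (simp only: distrib_left mult_ac)
  qed
qed

lemma subset_local_kernel: "primeideal P bipoly_ring \<Longrightarrow> J \<subseteq> local_kernel J P"
  using prime_bipolyD(2)[of P] by (auto intro!: local_kernelI[of 0 0 1])

lemma local_kernel_subset: "primeideal P bipoly_ring \<Longrightarrow> J \<subseteq> P \<Longrightarrow> local_kernel J P \<subseteq> P"
  using prime_bipolyD(3)[of P] by (auto simp: local_kernel_def)

lemma mConst_notin_prime:
  fixes c :: "'k::field"
  assumes P: "primeideal P bipoly_ring" "c \<noteq> 0"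
  shows "mConst c \<notin> P"
proof
  assume "mConst c \<in> P"
  from ideal_bipolyD(3)[OF prime_bipolyD(1)[OF P(1)] this, of "mConst (inverse c)"] show False
    using P prime_bipolyD(2)[OF P(1)] by (simp add: mConst_mult[symmetric])
qed

lemma numeral_notin_prime:
  fixes P :: "'k::field_char_0 bipoly set"
  assumes "primeideal P bipoly_ring"
  shows "numeral n \<notin> P"
  using mConst_notin_prime[OF assms, of "numeral n"] by (simp add: ring_mapD(9)[OF ring_map_mConst])

text \<open>The preimages of a chain of ideals under a surjection form a chain of the same length.\<close>

lemma ring_length_le_surj:
  fixes R :: "('a, 'c) ring_scheme" and S :: "('b, 'd) ring_scheme"
  assumes "ring_hom_ring R S h" "h ` carrier R = carrier S"
  shows "ring_length S \<le> ring_length R"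
  unfolding ring_length_def
proof (rule Sup_subset_mono, clarify)
  fix n and I :: "nat \<Rightarrow> 'b set"
  assume I: "\<forall>i\<le>n. ideal (I i) S" "\<forall>i<n. I i \<subset> I (Suc i)"
  let ?I = "\<lambda>i. {r \<in> carrier R. h r \<in> I i}"
  have 1: "ideal (?I i) R" if "i \<le> n" for i
    using I(1) that by (intro ring_hom_ring.ideal_vimage[OF assms(1)]) simp
  have 2: "?I i \<subset> ?I (Suc i)" if i: "i < n" for i
  proof -
    obtain s where s: "s \<in> I (Suc i)" "s \<notin> I i" using I(2) i by blast
    have "ideal (I (Suc i)) S" using I(1) i by simp
    then have "I (Suc i) \<subseteq> carrier S" by (intro additive_subgroup.a_subset ideal.axioms(1))
    with s(1) have "s \<in> h ` carrier R" by (auto simp: assms(2))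
    then obtain r where "r \<in> carrier R" "h r = s" by (auto simp del: assms(2))
    then have "r \<in> ?I (Suc i) - ?I i" using s by simp
    moreover have "?I i \<subseteq> ?I (Suc i)" using I(2) i by blast
    ultimately show ?thesis by blast
  qed
  show "\<exists>n'. enat n = enat n' \<and> (\<exists>I. (\<forall>i\<le>n'. ideal (I i) R) \<and> (\<forall>i<n'. I i \<subset> I (Suc i)))"
    by (rule exI[of _ n], rule conjI[OF refl], rule exI[of _ ?I]) (intro conjI allI impI 1 2)
qed

lemma ring_length_iso_le:
  assumes "ring R" "ring S" "h \<in> ring_iso R S"
  shows "ring_length S \<le> ring_length R"
proof (rule ring_length_le_surj)
  show "ring_hom_ring R S h"
    by (rule ring_hom_ringI[OF assms(1,2)]) (use ring_iso_memE[OF assms(3)] in auto)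
  show "h ` carrier R = carrier S"
    using ring_iso_memE(5)[OF assms(3)] by (simp add: bij_betw_def)
qed

lemma ring_length_iso:
  assumes R: "ring R" and S: "ring S" and h: "h \<in> ring_iso R S"
  shows "ring_length R = ring_length S"
  using ring_length_iso_le[OF R S h] ring_length_iso_le[OF S R ring_iso_set_sym[OF R h]] by simp

lemma ring_length_eqI:
  assumes "\<And>i. i \<le> n \<Longrightarrow> ideal (I i) R" "\<And>i. i < n \<Longrightarrow> I i \<subset> I (Suc i)"
    and "\<And>m I. (\<And>i. i \<le> m \<Longrightarrow> ideal (I i) R) \<Longrightarrow> (\<And>i. i < m \<Longrightarrow> I i \<subset> I (Suc i)) \<Longrightarrow> m \<le> n"
  shows "ring_length R = enat n"
  unfolding ring_length_def
proof (rule antisym)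
  show "Sup {enat n |n. \<exists>I :: nat \<Rightarrow> 'a set. (\<forall>i\<le>n. ideal (I i) R) \<and> (\<forall>i<n. I i \<subset> I (Suc i))} \<le> enat n"
  proof (rule Sup_least, clarify)
    fix m and J :: "nat \<Rightarrow> 'a set"
    assume "\<forall>i\<le>m. ideal (J i) R" "\<forall>i<m. J i \<subset> J (Suc i)"
    then show "enat m \<le> enat n" using assms(3)[of m J] by simp
  qed
  show "enat n \<le> Sup {enat n |n. \<exists>I :: nat \<Rightarrow> 'a set. (\<forall>i\<le>n. ideal (I i) R) \<and> (\<forall>i<n. I i \<subset> I (Suc i))}"
    by (rule Sup_upper) (use assms(1,2) in blast)
qed

text \<open>Sums and products in \<open>local_ring\<close> are unions over all pairs of representatives, which all yield the same class.\<close>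

lemma Union_pairs_const:
  assumes "\<And>f s g t. (f, s) \<in> A \<Longrightarrow> (g, t) \<in> B \<Longrightarrow> X f s g t = C" "A \<noteq> {}" "B \<noteq> {}"
  shows "(\<Union>(f, s)\<in>A. \<Union>(g, t)\<in>B. X f s g t) = C"
proof (intro equalityI subsetI)
  fix x assume "x \<in> (\<Union>(f, s)\<in>A. \<Union>(g, t)\<in>B. X f s g t)"
  then obtain f s g t where "(f, s) \<in> A" "(g, t) \<in> B" "x \<in> X f s g t" by blast
  then show "x \<in> C" by (simp only: assms(1))
next
  fix x assume "x \<in> C"
  obtain f s g t where fg: "(f, s) \<in> A" "(g, t) \<in> B" using assms(2,3) by auto
  with \<open>x \<in> C\<close> have "x \<in> X f s g t" by (simp only: assms(1))
  with fg show "x \<in> (\<Union>(f, s)\<in>A. \<Union>(g, t)\<in>B. X f s g t)" by blast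
qed

text \<open>The fraction \<open>f / s\<close> has the value \<open>h f / h s\<close>, since \<open>h\<close> sends denominators to units. By
  \<open>h_J\<close> and \<open>h_kernel\<close>, two fractions have the same value iff they are identified in the local ring, and by \<open>h_surj\<close> every
  element of \<open>'t\<close> is a value. Hence the value is an isomorphism from the local ring to \<open>'t\<close>, with inverse \<open>cls\<close>.\<close>

theorem local_ring_length:
  fixes h :: "'k::comm_ring_1 bipoly \<Rightarrow> 't::comm_ring_1"
  assumes P: "primeideal P bipoly_ring" and h: "ring_map h"
    and h_J: "\<And>F. F \<in> J \<Longrightarrow> h F = 0"
    and h_unit: "\<And>d e s. bihom d e s \<Longrightarrow> s \<notin> P \<Longrightarrow> \<exists>u. h s * u = 1"
    and h_kernel: "\<And>d e F. bihom d e F \<Longrightarrow> h F = 0 \<Longrightarrow> F \<in> local_kernel J P"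
    and h_surj: "\<And>t. \<exists>f s. (f, s) \<in> fracs P \<and> h f = t * h s"
  shows "multiplicity_at J P = ring_length (type_ring :: 't ring)"
proof -
  define r where "r s = (SOME u. h s * u = 1)" for s
  define val where "val x = h (fst x) * r (snd x)" for x
  define cls where "cls t = {x \<in> fracs P. val x = t}" for t
  note hr = ring_mapD[OF h]
  have r: "h s * r s = 1" if "(f, s) \<in> fracs P" for f s
    unfolding r_def using that h_unit by (intro someI_ex[of "\<lambda>u. h s * u = 1"]) (auto simp: fracs_def)
  have val: "val (f, s) = t \<longleftrightarrow> h f = t * h s" if "(f, s) \<in> fracs P" for f s t
  proof
    assume "val (f, s) = t"
    then have "t * h s = h f * (h s * r s)" by (auto simp: val_def mult_ac)
    then show "h f = t * h s" by (simp add: r[OF that])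
  next
    assume "h f = t * h s"
    then have "val (f, s) = t * (h s * r s)" by (simp add: val_def mult_ac)
    then show "val (f, s) = t" by (simp add: r[OF that])
  qed
  have val': "h f = val (f, s) * h s" if "(f, s) \<in> fracs P" for f s
    using val[OF that, of "val (f, s)"] by simp
  have rel: "((f, s), (g, t)) \<in> frac_rel J P \<longleftrightarrow>
      (f, s) \<in> fracs P \<and> (g, t) \<in> fracs P \<and> val (f, s) = val (g, t)" for f s g t
  proof (cases "(f, s) \<in> fracs P \<and> (g, t) \<in> fracs P")
    case True
    then obtain d e d' e' where hom: "bihom d e f" "bihom d e s" "bihom d' e' g" "bihom d' e' t"
      by (auto simp: fracs_def)
    have bh: "bihom (d + d') (e + e') (f * t - g * s)"
      using hom by (intro bihom_diff) (auto intro: bihom_mult bihom_mult_eq simp: add.commute)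
    have "val (f, s) = val (g, t) \<longleftrightarrow> h (f * t - g * s) = 0"
    proof -
      have "h (f * t - g * s) = (val (f, s) - val (g, t)) * (h s * h t)"
        using True by (simp add: hr val'[of f s] val'[of g t] left_diff_distrib right_diff_distrib mult_ac)
      moreover have "val (f, s) - val (g, t) = ((val (f, s) - val (g, t)) * (h s * h t)) * (r s * r t)"
      proof -
        have "(h s * h t) * (r s * r t) = (h s * r s) * (h t * r t)" by (simp only: mult_ac)
        also have "\<dots> = 1" using r[of f s] r[of g t] True by simp
        finally show ?thesis by (simp add: mult.assoc)
      qed
      ultimately show ?thesis by (metis mult_zero_left eq_iff_diff_eq_0)
    qed
    also have "\<dots> \<longleftrightarrow> f * t - g * s \<in> local_kernel J P"
    proof
      assume "f * t - g * s \<in> local_kernel J P"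
      then obtain c d e where c: "bihom d e c" "c \<notin> P" "c * (f * t - g * s) \<in> J"
        by (auto simp: local_kernel_def)
      obtain u where u: "h c * u = 1" using h_unit c by blast
      have "h (f * t - g * s) = u * h (c * (f * t - g * s))"
        using u by (simp only: hr(3)) (simp add: mult.assoc[symmetric] mult.commute[of u])
      then show "h (f * t - g * s) = 0" by (simp only: h_J[OF c(3)]) simp
    qed (rule h_kernel[OF bh])
    finally show ?thesis
      using True unfolding frac_rel_def local_kernel_def by auto
  qed (auto simp: frac_rel_def)
  have frac_mult: "(f * g, s * t) \<in> fracs P" "val (f * g, s * t) = val (f, s) * val (g, t)"
    and frac_add: "(f * t + g * s, s * t) \<in> fracs P" "val (f * t + g * s, s * t) = val (f, s) + val (g, t)"
    if fg: "(f, s) \<in> fracs P" "(g, t) \<in> fracs P" for f s g t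
  proof -
    obtain d e d' e' where hom: "bihom d e f" "bihom d e s" "bihom d' e' g" "bihom d' e' t"
      using fg unfolding fracs_def by blast
    have st: "s * t \<notin> P" "bihom (d + d') (e + e') (s * t)" "bihom (d + d') (e + e') (f * g)"
        "bihom (d + d') (e + e') (f * t + g * s)"
      using that hom by (auto simp: fracs_def prime_bipolyD(3)[OF P] add.commute intro!: bihom_add intro: bihom_mult bihom_mult_eq)
    show m: "(f * g, s * t) \<in> fracs P" and a: "(f * t + g * s, s * t) \<in> fracs P"
      using st by (auto simp: fracs_def)
    show "val (f * g, s * t) = val (f, s) * val (g, t)"
      unfolding val[OF m] hr val'[OF that(1)] val'[OF that(2)] by (simp only: mult_ac)
    show "val (f * t + g * s, s * t) = val (f, s) + val (g, t)"
      unfolding val[OF a] hr val'[OF that(1)] val'[OF that(2)] by (simp only: mult_ac distrib_left distrib_right)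
  qed
  have one: "(1, 1) \<in> fracs P" and zero: "(0, 1) \<in> fracs P"
    using prime_bipolyD(2)[OF P] by (auto simp: fracs_def)
  have img: "frac_rel J P `` {x} = cls (val x)" if "x \<in> fracs P" for x
    using that by (cases x) (auto simp: rel cls_def)
  have cls_ne: "\<exists>x. x \<in> cls t" for t
    using h_surj[of t] val by (fastforce simp: cls_def)
  let ?L = "local_ring J P"
  have iso: "cls \<in> ring_iso type_ring ?L"
  proof (rule ring_iso_memI)
    have carrier: "carrier ?L = range cls"
    proof -
      have "carrier ?L = (\<lambda>x. cls (val x)) ` fracs P"
        by (auto simp: local_ring_def quotient_def img)
      also have "\<dots> = range cls"
      proof -
        have "cls t \<in> (\<lambda>x. cls (val x)) ` fracs P" for t
          using cls_ne[of t] by (auto simp: cls_def)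
        then show ?thesis by blast
      qed
      finally show ?thesis .
    qed
    then show "cls t \<in> carrier ?L" for t by blast
    have "inj cls"
    proof (rule injI)
      fix a b assume "cls a = cls b"
      then show "a = b" using cls_ne[of a] by (auto simp: cls_def)
    qed
    then show "bij_betw cls (carrier type_ring) (carrier ?L)"
      by (simp add: bij_betw_def carrier)
    have "frac_rel J P `` {(1, 1)} = cls 1"
      using img[OF one] val[OF one, of 1] by (simp add: hr(1))
    then show "cls \<one>\<^bsub>type_ring\<^esub> = \<one>\<^bsub>?L\<^esub>"
      by (simp add: local_ring_def)
    fix a b
    have ne: "cls a \<noteq> {}" "cls b \<noteq> {}"
      using cls_ne by blast+
    show "cls (a \<otimes>\<^bsub>type_ring\<^esub> b) = cls a \<otimes>\<^bsub>?L\<^esub> cls b"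
      unfolding local_ring_def monoid.simps ring.simps type_ring_simps
      by (intro Union_pairs_const[symmetric] ne) (auto simp: cls_def img frac_mult)
    show "cls (a \<oplus>\<^bsub>type_ring\<^esub> b) = cls a \<oplus>\<^bsub>?L\<^esub> cls b"
      unfolding local_ring_def monoid.simps ring.simps type_ring_simps
      by (intro Union_pairs_const[symmetric] ne) (auto simp: cls_def img frac_add)
  qed
  have "frac_rel J P `` {(0, 1)} = cls 0"
    using img[OF zero] val[OF zero, of 0] by (simp add: hr(4))
  then have "?L\<lparr>zero := cls \<zero>\<^bsub>type_ring\<^esub>\<rparr> = ?L"
    by (simp add: local_ring_def)
  then have "ring ?L"
    using ring.ring_iso_imp_img_ring[OF ring_type_ring iso] by simp
  then show ?thesis
    unfolding multiplicity_at_def using ring_length_iso[OF ring_type_ring _ iso] by simp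
qed

text \<open>The map \<open>N\<close> lifts the algebra \<open>'t\<close> to forms of degree \<open>n\<close> in \<open>A\<close>, with \<open>s\<close> as homogenising coordinate.
  If \<open>N\<close> is multiplicative and inverts \<open>h\<close> on the coordinates, both modulo \<open>K\<close> and up to powers of \<open>s\<close> and \<open>b\<close>, then
  it inverts \<open>h\<close> on all bihomogeneous polynomials. So \<open>h F = 0\<close> implies \<open>F \<in> K\<close>, which is the hypothesis \<open>h_kernel\<close> of
  \<open>local_ring_length\<close>.\<close>

lemma normal_form:
  fixes h :: "'k::comm_ring_1 bipoly \<Rightarrow> 't::comm_ring_1" and N :: "'t \<Rightarrow> 'k bipoly"
  assumes K: "ideal K bipoly_ring" and h: "ring_map h"
    and cancel: "\<And>F. s * F \<in> K \<Longrightarrow> F \<in> K"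
    and N_add: "\<And>a b. N (a + b) = N a + N b" and N_0: "N 0 = 0"
    and N_mult: "\<And>a b. N a * N b - s ^ n * N (a * b) \<in> K"
    and N_const: "\<And>c. N (h (mConst c)) = mConst c * s ^ n"
    and N_CoA: "\<And>m. s ^ n * mVar (CoA m) - s * N (h (mVar (CoA m))) \<in> K"
    and N_CoB: "\<And>m. s ^ n * mVar (CoB m) - b * N (h (mVar (CoB m))) \<in> K"
    and F: "bihom d e F"
  shows "s ^ n * F - s ^ d * b ^ e * N (h F) \<in> K"
  using F
proof (induction rule: bihom_induct)
  note hr = ring_mapD[OF h]
  {
    case (zero d e)
    then show ?case by (simp add: hr(4) N_0 ideal_bipolyD(1)[OF K])
  next
    case (add d e F G)
    from ideal_bipolyD(2)[OF K add] show ?case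
      by (simp only: hr(2) N_add distrib_left add_diff_add)
  next
    case (const c)
    show ?case by (simp add: N_const mult.commute ideal_bipolyD(1)[OF K])
  next
    case (CoA m)
    show ?case using N_CoA[of m] by simp
  next
    case (CoB m)
    show ?case using N_CoB[of m] by simp
  next
    case (mult d e d' e' F G)
    have cancel_n: "F \<in> K" if "s ^ j * F \<in> K" for F j
      using that by (induction j) (auto simp: mult.assoc intro: cancel)
    let ?E = "s ^ d * b ^ e" and ?E' = "s ^ d' * b ^ e'"
    have "(s ^ n * F - ?E * N (h F)) * (s ^ n * G) + (?E * N (h F)) * (s ^ n * G - ?E' * N (h G))
        + ?E * ?E' * (N (h F) * N (h G) - s ^ n * N (h F * h G)) \<in> K"
      by (intro ideal_bipolyD(2,3,4)[OF K] mult N_mult)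
    also have "(s ^ n * F - ?E * N (h F)) * (s ^ n * G) + (?E * N (h F)) * (s ^ n * G - ?E' * N (h G))
        + ?E * ?E' * (N (h F) * N (h G) - s ^ n * N (h F * h G))
        = s ^ n * (s ^ n * (F * G) - ?E * ?E' * N (h (F * G)))"
      by (simp add: hr(3) algebra_simps)
    finally have "s ^ n * (F * G) - ?E * ?E' * N (h (F * G)) \<in> K"
      by (rule cancel_n)
    then show ?case by (simp only: power_add mult_ac)
  }
qed

section \<open>The ideal of a fiber\<close>

abbreviation Avec :: "mon4 \<Rightarrow> 'k::comm_ring_1 bipoly" where "Avec m \<equiv> mVar (CoA m)"
abbreviation Bvec :: "mon4 \<Rightarrow> 'k::comm_ring_1 bipoly" where "Bvec m \<equiv> mVar (CoB m)"

abbreviation graph_pullback :: "'k::comm_ring_1 bipoly \<Rightarrow> (mon4, 'k) mpoly"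
  where "graph_pullback \<equiv> msubst mConst (case_coord generic_quartic (H4 generic_quartic))"

lemma ideal_graph_closure: "ideal graph_closure bipoly_ring"
  unfolding graph_closure_def by (rule ideal_bihom_ideal)

lemma ideal_pr2_preimage: "ideal (pr2_preimage y) bipoly_ring"
  unfolding pr2_preimage_def by (rule ideal_generated)

lemma ideal_H_fiber: "ideal (H_fiber y) bipoly_ring"
  unfolding H_fiber_def by (rule ideal_sum[OF ideal_graph_closure ideal_pr2_preimage])

lemma H_fiber_subset_iff:
  assumes "ideal K bipoly_ring"
  shows "H_fiber y \<subseteq> K \<longleftrightarrow> (\<forall>d e F. bihom d e F \<longrightarrow> graph_pullback F = 0 \<longrightarrow> F \<in> K) \<and>
     (\<forall>e F. bihom 0 e F \<longrightarrow> eval_at (\<lambda>_. 0) y F = 0 \<longrightarrow> F \<in> K)"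
  unfolding H_fiber_def ideal_sum_subset_iff[OF ideal_graph_closure ideal_pr2_preimage assms]
  unfolding graph_closure_def pr2_preimage_def bihom_ideal_def generated_subset_iff[OF assms]
  by blast

lemma graph_mem_H_fiber: "bihom d e F \<Longrightarrow> graph_pullback F = 0 \<Longrightarrow> F \<in> H_fiber y"
  using H_fiber_subset_iff[OF ideal_H_fiber, of y y] by blast

lemma pr2_mem_H_fiber: "bihom 0 e F \<Longrightarrow> eval_at (\<lambda>_. 0) y F = 0 \<Longrightarrow> F \<in> H_fiber y"
  using H_fiber_subset_iff[OF ideal_H_fiber, of y y] by blast

lemma msubst_eval_at:
  assumes \<phi>: "ring_map \<phi>"
  shows "msubst \<phi> (case_coord (\<phi> \<circ> p) (\<phi> \<circ> q)) F = \<phi> (eval_at p q F)"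
proof -
  have "\<phi> \<circ> case_coord p q = case_coord (\<phi> \<circ> p) (\<phi> \<circ> q)"
    by (rule ext) (simp split: coord.split)
  then show ?thesis
    unfolding eval_at_def using ring_map_msubst_comp[OF \<phi> ring_map_id, of "case_coord p q" F] by simp
qed

lemma msubst_graph_pullback:
  assumes \<phi>: "ring_map \<phi>"
  shows "msubst \<phi> p (graph_pullback F) = msubst \<phi> (case_coord p (H4 p)) F"
proof -
  have 1: "msubst \<phi> p \<circ> mConst = \<phi>"
    by (rule ext) (simp add: msubst_mConst[OF \<phi>])
  have "msubst \<phi> p (H4 generic_quartic m) = H4 p m" for m
    by (simp add: ring_map_H4[OF ring_map_msubst[OF \<phi>]] generic_quartic_def msubst_mVar[OF \<phi>])
  then have 2: "msubst \<phi> p \<circ> case_coord generic_quartic (H4 generic_quartic) = case_coord p (H4 p)"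
    by (intro ext) (simp add: generic_quartic_def msubst_mVar[OF \<phi>] split: coord.split)
  show ?thesis
    using ring_map_msubst_comp[OF ring_map_msubst[OF \<phi>] ring_map_mConst, of p "case_coord generic_quartic (H4 generic_quartic)" F]
    unfolding 1 2 .
qed

text \<open>For a form \<open>F\<close> of bidegree \<open>(d, e)\<close> that vanishes on the graph, \<open>0 = F(p, H4 p) = F(p, w y) = w\<^sup>e F(p, y)\<close>, and
  \<open>w\<close> is a unit. A form of bidegree \<open>(0, e)\<close> does not depend on its first argument, which may be rescaled by 0.\<close>

lemma H_fiber_generators_vanish:
  assumes \<phi>: "ring_map \<phi>" and p: "H4 p = (\<lambda>m. w * \<phi> (y m))" and w: "w * w' = 1"
  shows "bihom d e F \<Longrightarrow> graph_pullback F = 0 \<Longrightarrow> msubst \<phi> (case_coord p (\<phi> \<circ> y)) F = 0"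
    and "bihom 0 e F \<Longrightarrow> eval_at (\<lambda>_. 0) y F = 0 \<Longrightarrow> msubst \<phi> (case_coord p (\<phi> \<circ> y)) F = 0"
proof -
  assume F: "bihom d e F" "graph_pullback F = 0"
  have "0 = msubst \<phi> p (graph_pullback F)"
    using F(2) by (simp add: ring_mapD(4)[OF ring_map_msubst[OF \<phi>]])
  also have "\<dots> = msubst \<phi> (case_coord (\<lambda>m. 1 * p m) (\<lambda>m. w * (\<phi> \<circ> y) m)) F"
    unfolding msubst_graph_pullback[OF \<phi>] p by simp
  also have "\<dots> = w ^ e * msubst \<phi> (case_coord p (\<phi> \<circ> y)) F"
    using msubst_scale[OF F(1) \<phi>, of 1 p w "\<phi> \<circ> y"] by simp
  finally have "0 = w' ^ e * (w ^ e * msubst \<phi> (case_coord p (\<phi> \<circ> y)) F)"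
    by (simp only: mult_zero_right)
  also have "\<dots> = (w * w') ^ e * msubst \<phi> (case_coord p (\<phi> \<circ> y)) F"
    by (simp only: power_mult_distrib mult_ac)
  finally show "msubst \<phi> (case_coord p (\<phi> \<circ> y)) F = 0"
    by (simp add: w)
next
  assume F: "bihom 0 e F" "eval_at (\<lambda>_. 0) y F = 0"
  have "msubst \<phi> (case_coord p (\<phi> \<circ> y)) F = msubst \<phi> (case_coord (\<lambda>m. 0 * p m) (\<lambda>m. 1 * (\<phi> \<circ> y) m)) F"
    using msubst_scale[OF F(1) \<phi>, of 0 p 1 "\<phi> \<circ> y"] by simp
  also have "\<dots> = msubst \<phi> (case_coord (\<phi> \<circ> (\<lambda>_. 0)) (\<phi> \<circ> y)) F"
    by (simp add: comp_def ring_mapD(4)[OF \<phi>])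
  finally show "msubst \<phi> (case_coord p (\<phi> \<circ> y)) F = 0"
    by (simp add: msubst_eval_at[OF \<phi>] F(2) ring_mapD(4)[OF \<phi>])
qed

lemma H_fiber_vanish:
  assumes "ring_map \<phi>" "H4 p = (\<lambda>m. w * \<phi> (y m))" "w * w' = 1" "F \<in> H_fiber y"
  shows "msubst \<phi> (case_coord p (\<phi> \<circ> y)) F = 0"
proof -
  have "H_fiber y \<subseteq> {F. msubst \<phi> (case_coord p (\<phi> \<circ> y)) F = 0}"
    unfolding H_fiber_subset_iff[OF ring_map_kernel_ideal[OF ring_map_msubst[OF assms(1)]]] mem_Collect_eq
    using H_fiber_generators_vanish[OF assms(1-3)] by blast
  then show ?thesis using assms(4) by blast
qed

lemma graph_point_eq:
  fixes C y :: "'k::field quartic"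
  assumes "H4 C = (\<lambda>m. w * y m)" "w \<noteq> 0"
  shows "graph_point C = rational_point C y"
  unfolding graph_point_def assms(1) by (rule rational_point_scale[OF assms(2)])

text \<open>The value at the point is an evaluation of the kind treated in \<open>H_fiber_generators_vanish\<close>, with
  the ground field as algebra.\<close>

lemma rational_point_in_scheme_points:
  fixes C y :: "'k::field quartic"
  assumes C: "H4 C = (\<lambda>m. w * y m)" "w \<noteq> 0" and ne: "C i \<noteq> 0" "y j \<noteq> 0"
  shows "rational_point C y \<in> scheme_points (H_fiber y)"
  unfolding scheme_points_def mem_Collect_eq
proof (intro conjI)
  show prime: "primeideal (rational_point C y) bipoly_ring" by (rule prime_rational_point)
  show "bihom_ideal (rational_point C y) = rational_point C y"
    unfolding rational_point_def by (rule bihom_ideal_idem)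
  have w: "w * inverse w = 1" using C(2) by simp
  show "H_fiber y \<subseteq> rational_point C y"
    unfolding H_fiber_subset_iff[OF prime_bipolyD(1)[OF prime]]
    using H_fiber_generators_vanish[OF ring_map_id, of C w y "inverse w"] C(1) w
    by (simp add: bihom_mem_rational_point_iff eval_at_def)
  have "Avec i \<notin> rational_point C y" "Bvec j \<notin> rational_point C y"
    using ne bihom_mem_rational_point_iff[OF bihom_CoA[of i], of C y]
      bihom_mem_rational_point_iff[OF bihom_CoB[of j], of C y] by (simp_all add: eval_at_simps)
  then show "\<not> range (mVar \<circ> CoA) \<subseteq> rational_point C y" "\<not> range (mVar \<circ> CoB) \<subseteq> rational_point C y"
    by auto
qed

lemma bihom_H4: "bihom 2 0 (H4 Avec m :: 'k::comm_ring_1 bipoly)"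
proof -
  have 2: "bihom 2 0 (c * Avec i * Avec j :: 'k bipoly)" if "bihom 0 0 c" for c i j
    by (rule bihom_mult_eq[OF bihom_mult[OF that bihom_CoA] bihom_CoA]) simp_all
  have sq: "bihom 2 0 (c * Avec i ^ 2 :: 'k bipoly)" if "bihom 0 0 c" for c i
    using 2[OF that, of i i] by (simp add: power2_eq_square mult.assoc)
  have neg: "bihom 0 0 (- numeral n :: 'k bipoly)" for n
    by (rule bihom_uminus[OF bihom_numeral])
  have "\<forall>m. bihom 2 0 (H4 Avec m :: 'k bipoly)"
    unfolding all_mon4 H4_coeffs by (intro conjI bihom_add bihom_diff 2 sq neg bihom_numeral)
  then show ?thesis by blast
qed

lemma bihom_apolar_partials: "bihom 1 1 (apolar_partials d e Avec Bvec)"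
proof -
  obtain i j l i' j' l' where de: "d = (i, j, l)" "e = (i', j', l')"
    by (cases d, cases e)
  have c: "bihom 0 0 (of_nat n :: 'a bipoly)" for n
    using bihom_mConst[of "of_nat n :: 'a"] by (simp add: ring_mapD(8)[OF ring_map_mConst])
  have "bihom 1 1 (\<Sum>(a, b, c)\<leftarrow>xs. of_nat (fact a * fact b * fact c) * partial_coeff d Avec (a, b, c) * partial_coeff e Bvec (a, b, c) :: 'a bipoly)" for xs
  proof (induction xs)
    case (Cons x xs)
    have "bihom 1 1 (of_nat n * (of_nat n1 * Avec m) * (of_nat n2 * Bvec m') :: 'a bipoly)" for n n1 n2 m m'
      by (rule bihom_mult_eq[OF bihom_mult[OF c bihom_mult[OF c bihom_CoA]] bihom_mult[OF c bihom_CoB]]) simp_all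
    then show ?case using Cons by (cases x) (simp add: de bihom_add del: of_nat_add of_nat_mult of_nat_Suc)
  qed simp
  then show ?thesis unfolding apolar_partials_def .
qed

lemma graph_pullback_simps:
  "graph_pullback (Avec m) = generic_quartic m" "graph_pullback (Bvec m) = H4 generic_quartic m"
  by (simp_all add: msubst_mVar[OF ring_map_mConst])

lemma minor_mem_H_fiber: "Bvec n * H4 Avec m - Bvec m * H4 Avec n \<in> H_fiber y"
proof (rule graph_mem_H_fiber)
  show "bihom 2 1 (Bvec n * H4 Avec m - Bvec m * H4 Avec n :: 'a bipoly)"
    by (rule bihom_diff; rule bihom_mult_eq[OF bihom_CoB bihom_H4]; simp)
  note gp = ring_mapD[OF ring_map_msubst[OF ring_map_mConst]]
  show "graph_pullback (Bvec n * H4 Avec m - Bvec m * H4 Avec n :: 'a bipoly) = 0"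
    by (simp add: gp ring_map_H4[OF ring_map_msubst[OF ring_map_mConst]] graph_pullback_simps)
qed

lemma apolar_mem_H_fiber:
  "(\<And>q :: (mon4, 'k) mpoly quartic. apolar_partials d e q (H4 q) = 0) \<Longrightarrow>
     (apolar_partials d e Avec Bvec :: 'k::comm_ring_1 bipoly) \<in> H_fiber y"
  "(\<And>q :: (mon4, 'k) mpoly quartic. apolar_partials d e q (H4 q) - apolar_partials d' e' q (H4 q) = 0) \<Longrightarrow>
     (apolar_partials d e Avec Bvec - apolar_partials d' e' Avec Bvec :: 'k bipoly) \<in> H_fiber y"
proof -
  note gp = ring_mapD(6)[OF ring_map_msubst[OF ring_map_mConst]]
    ring_map_apolar_partials[OF ring_map_msubst[OF ring_map_mConst]] graph_pullback_simps
  show "(\<And>q :: (mon4, 'k) mpoly quartic. apolar_partials d e q (H4 q) = 0) \<Longrightarrow>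
     (apolar_partials d e Avec Bvec :: 'k bipoly) \<in> H_fiber y"
    by (rule graph_mem_H_fiber[OF bihom_apolar_partials]) (simp only: gp)
  show "(\<And>q :: (mon4, 'k) mpoly quartic. apolar_partials d e q (H4 q) - apolar_partials d' e' q (H4 q) = 0) \<Longrightarrow>
     (apolar_partials d e Avec Bvec - apolar_partials d' e' Avec Bvec :: 'k bipoly) \<in> H_fiber y"
    by (rule graph_mem_H_fiber[OF bihom_diff[OF bihom_apolar_partials bihom_apolar_partials]]) (simp only: gp)
qed

section \<open>Local equations of the fiber over the Fermat quartic\<close>

declare One_nat_def [simp del]

abbreviation s_form where "s_form \<equiv> Avec (mo 4 0 0)"
abbreviation u_form where "u_form \<equiv> Bvec (mo 4 0 0)"

lemma Fer'_mo: "i + j + l = 4 \<Longrightarrow> Fer' (mo i j l) = (if (i, j, l) \<in> {(4,0,0), (0,4,0), (0,0,4)} then 1 else 0)"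
  by (simp add: quartics_special(2) special_quartic_mo)

lemma Bvec_congruent: "Bvec m - mConst (Fer' m) * u_form \<in> H_fiber Fer'"
proof (rule pr2_mem_H_fiber)
  show "bihom 0 1 (Bvec m - mConst (Fer' m) * u_form :: 'a bipoly)"
    by (intro bihom_diff bihom_CoB bihom_mult_eq[OF bihom_mConst bihom_CoB]) simp_all
  show "eval_at (\<lambda>_. 0) Fer' (Bvec m - mConst (Fer' m) * u_form :: 'a bipoly) = 0"
    by (simp add: ring_mapD[OF ring_map_eval_at] eval_at_simps Fer'_mo)
qed

text \<open>Here \<open>P\<close> is any point of the fiber, and \<open>K\<close> collects the equations that hold in the local ring at \<open>P\<close>. Memberships in
  \<open>K\<close> give the multiplicities, and memberships in the larger ideal \<open>P\<close> determine the point.\<close>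

context
  fixes P K :: "'k::field_char_0 bipoly set"
  assumes P: "P \<in> scheme_points (H_fiber Fer')"
  defines "K \<equiv> local_kernel (H_fiber Fer') P"
begin

lemma P_prime: "primeideal P bipoly_ring" and fiber_subset_P: "H_fiber Fer' \<subseteq> P"
  and P_bihom: "bihom_ideal P = P"
  and A_not_subset_P: "\<not> range (mVar \<circ> CoA) \<subseteq> P" and B_not_subset_P: "\<not> range (mVar \<circ> CoB) \<subseteq> P"
  using P by (auto simp: scheme_points_def)

lemma K_ideal: "ideal K bipoly_ring"
  unfolding K_def by (rule ideal_local_kernel[OF P_prime ideal_H_fiber])

lemma fiber_subset_K: "H_fiber Fer' \<subseteq> K"
  unfolding K_def by (rule subset_local_kernel[OF P_prime])

lemma K_subset_P: "K \<subseteq> P"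
  unfolding K_def by (rule local_kernel_subset[OF P_prime fiber_subset_P])

lemma K_cancel: "c * F \<in> K \<Longrightarrow> bihom d e c \<Longrightarrow> c \<notin> P \<Longrightarrow> F \<in> K"
  unfolding K_def by (rule local_kernel_cancel[OF P_prime])

lemma K_cancel_numeral: "numeral n * F \<in> K \<Longrightarrow> F \<in> K"
  by (erule K_cancel[OF _ bihom_numeral numeral_notin_prime[OF P_prime]])

text \<open>On the fiber all dual coordinates are multiples of the coefficient of \<open>u\<^sup>4\<close>, so this coefficient is not 0.\<close>

lemma u_notin_P: "u_form \<notin> P"
proof
  assume u: "u_form \<in> P"
  have "Bvec m \<in> P" for m
  proof -
    have "(Bvec m - mConst (Fer' m) * u_form) + mConst (Fer' m) * u_form \<in> P"
      using Bvec_congruent[of m] fiber_subset_P u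
      by (intro ideal_bipolyD(2,3)[OF prime_bipolyD(1)[OF P_prime]]) auto
    then show ?thesis by simp
  qed
  then show False using B_not_subset_P by auto
qed

lemma K_cancel_u: "u_form * F \<in> K \<Longrightarrow> F \<in> K"
  by (erule K_cancel[OF _ bihom_CoB u_notin_P])

lemma K_substitute:
  assumes "\<And>m. p m - Avec m \<in> K" "F \<in> K"
  shows "msubst mConst (case_coord p (\<lambda>m. mConst (Fer' m) * u_form)) F \<in> K"
proof (subst msubst_congruent_mem[OF K_ideal])
  fix c
  have "- (Bvec m - mConst (Fer' m) * u_form) \<in> K" for m
    using Bvec_congruent[of m] fiber_subset_K by (intro ideal_bipolyD(5)[OF K_ideal]) auto
  then show "case_coord p (\<lambda>m. mConst (Fer' m) * u_form) c - mVar c \<in> K"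
    using assms(1) by (cases c) simp_all
qed (rule assms(2))

lemma apolar_in_K:
  "apolar_partials d e Avec Bvec \<in> K \<Longrightarrow> apolar_partials d e Avec (\<lambda>m. mConst (Fer' m) * u_form) \<in> K"
  "apolar_partials d e Avec Bvec - apolar_partials d' e' Avec Bvec \<in> K \<Longrightarrow>
    apolar_partials d e Avec (\<lambda>m. mConst (Fer' m) * u_form)
    - apolar_partials d' e' Avec (\<lambda>m. mConst (Fer' m) * u_form) \<in> K"
proof -
  note subst = ring_map_apolar_partials[OF ring_map_msubst[OF ring_map_mConst]] msubst_mVar[OF ring_map_mConst]
      ring_mapD(6)[OF ring_map_msubst[OF ring_map_mConst]] coord.case
  have mem: "F \<in> K \<Longrightarrow> msubst mConst (case_coord Avec (\<lambda>m. mConst (Fer' m) * u_form)) F \<in> K" for F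
    by (rule K_substitute) (simp_all add: ideal_bipolyD(1)[OF K_ideal])
  show "apolar_partials d e Avec Bvec \<in> K \<Longrightarrow> apolar_partials d e Avec (\<lambda>m. mConst (Fer' m) * u_form) \<in> K"
    by (drule mem) (simp only: subst)
  show "apolar_partials d e Avec Bvec - apolar_partials d' e' Avec Bvec \<in> K \<Longrightarrow>
    apolar_partials d e Avec (\<lambda>m. mConst (Fer' m) * u_form)
    - apolar_partials d' e' Avec (\<lambda>m. mConst (Fer' m) * u_form) \<in> K"
    by (drule mem) (simp only: subst)
qed

text \<open>If the second cubic in the apolar pairing is a multiple of \<open>u\<^sup>3\<close>, \<open>v\<^sup>3\<close> or \<open>w\<^sup>3\<close>, then a single coefficient of the first
  cubic remains.\<close>

lemma linear_relations:
  "Avec (mo 3 1 0) \<in> K" "Avec (mo 3 0 1) \<in> K" "Avec (mo 1 3 0) \<in> K" "Avec (mo 1 0 3) \<in> K"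
  "Avec (mo 0 3 1) \<in> K" "Avec (mo 0 1 3) \<in> K"
  "Avec (mo 0 4 0) - s_form \<in> K" "Avec (mo 0 0 4) - s_form \<in> K"
proof -
  note eval = apolar_partials_def cubic_exponents_def Fer'_mo fact_numeral
  have off: "numeral n * (u_form * F) \<in> K \<Longrightarrow> F \<in> K" for n F
    by (rule K_cancel_u, rule K_cancel_numeral)
  have A: "apolar_partials (1,0,0) (0,1,0) Avec (\<lambda>m. mConst (Fer' m) * u_form) = 24 * (u_form * Avec (mo 1 3 0))"
    "apolar_partials (1,0,0) (0,0,1) Avec (\<lambda>m. mConst (Fer' m) * u_form) = 24 * (u_form * Avec (mo 1 0 3))"
    "apolar_partials (0,1,0) (1,0,0) Avec (\<lambda>m. mConst (Fer' m) * u_form) = 24 * (u_form * Avec (mo 3 1 0))"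
    "apolar_partials (0,1,0) (0,0,1) Avec (\<lambda>m. mConst (Fer' m) * u_form) = 24 * (u_form * Avec (mo 0 1 3))"
    "apolar_partials (0,0,1) (1,0,0) Avec (\<lambda>m. mConst (Fer' m) * u_form) = 24 * (u_form * Avec (mo 3 0 1))"
    "apolar_partials (0,0,1) (0,1,0) Avec (\<lambda>m. mConst (Fer' m) * u_form) = 24 * (u_form * Avec (mo 0 3 1))"
    "apolar_partials (0,1,0) (0,1,0) Avec (\<lambda>m. mConst (Fer' m) * u_form)
      - apolar_partials (1,0,0) (1,0,0) Avec (\<lambda>m. mConst (Fer' m) * u_form) = 96 * (u_form * (Avec (mo 0 4 0) - s_form))"
    "apolar_partials (0,0,1) (0,0,1) Avec (\<lambda>m. mConst (Fer' m) * u_form)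
      - apolar_partials (1,0,0) (1,0,0) Avec (\<lambda>m. mConst (Fer' m) * u_form) = 96 * (u_form * (Avec (mo 0 0 4) - s_form))"
    by (simp_all add: eval) (simp_all add: right_diff_distrib)
  note mem = apolar_mem_H_fiber[THEN subsetD[OF fiber_subset_K]]
  note H = apolar_partials_H4
  show "Avec (mo 3 1 0) \<in> K"
    using apolar_in_K(1)[OF mem(1)[OF H(3)]] unfolding A(3) by (rule off)
  show "Avec (mo 3 0 1) \<in> K"
    using apolar_in_K(1)[OF mem(1)[OF H(5)]] unfolding A(5) by (rule off)
  show "Avec (mo 1 3 0) \<in> K"
    using apolar_in_K(1)[OF mem(1)[OF H(1)]] unfolding A(1) by (rule off)
  show "Avec (mo 1 0 3) \<in> K"
    using apolar_in_K(1)[OF mem(1)[OF H(2)]] unfolding A(2) by (rule off)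
  show "Avec (mo 0 3 1) \<in> K"
    using apolar_in_K(1)[OF mem(1)[OF H(6)]] unfolding A(6) by (rule off)
  show "Avec (mo 0 1 3) \<in> K"
    using apolar_in_K(1)[OF mem(1)[OF H(4)]] unfolding A(4) by (rule off)
  show "Avec (mo 0 4 0) - s_form \<in> K"
    using apolar_in_K(2)[OF mem(2)[OF H(7)]] unfolding A(7) by (rule off)
  show "Avec (mo 0 0 4) - s_form \<in> K"
    using apolar_in_K(2)[OF mem(2)[OF H(8)]] unfolding A(8) by (rule off)
qed


abbreviation "special_A \<equiv> special_quartic s_form (Avec (mo 0 2 2)) (Avec (mo 2 0 2)) (Avec (mo 2 2 0))
    (Avec (mo 2 1 1)) (Avec (mo 1 2 1)) (Avec (mo 1 1 2))"

lemma special_congruent: "special_A m - Avec m \<in> K"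
proof -
  have neg: "a - b \<in> K \<Longrightarrow> b - a \<in> K" for a b
    using ideal_bipolyD(5)[OF K_ideal, of "a - b"] by simp
  have "\<forall>m. special_A m - Avec m \<in> K"
    unfolding all_mon4 
    by (simp add: special_quartic_mo ideal_bipolyD(1)[OF K_ideal]
      linear_relations(1-6)[THEN ideal_bipolyD(5)[OF K_ideal]] linear_relations(7,8)[THEN neg])
  then show ?thesis by blast
qed

lemma minor_in_K: "mConst (Fer' n) * H4 special_A m - mConst (Fer' m) * H4 special_A n \<in> K"
proof -
  have "msubst mConst (case_coord special_A (\<lambda>m. mConst (Fer' m) * u_form)) (Bvec n * H4 Avec m - Bvec m * H4 Avec n) \<in> K"
    by (rule K_substitute[OF special_congruent]) (rule subsetD[OF fiber_subset_K minor_mem_H_fiber])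
  then have "mConst (Fer' n) * u_form * H4 special_A m - mConst (Fer' m) * u_form * H4 special_A n \<in> K"
    by (simp only: ring_mapD[OF ring_map_msubst[OF ring_map_mConst]] ring_map_H4[OF ring_map_msubst[OF ring_map_mConst]]
      msubst_mVar[OF ring_map_mConst] coord.case)
  also have "mConst (Fer' n) * u_form * H4 special_A m - mConst (Fer' m) * u_form * H4 special_A n
      = u_form * (mConst (Fer' n) * H4 special_A m - mConst (Fer' m) * H4 special_A n)"
    by (simp only: right_diff_distrib mult_ac)
  finally show ?thesis by (rule K_cancel_u)
qed

lemma quadric_in_K: "(Fer' m :: 'k) = 0 \<Longrightarrow> H4 special_A m \<in> K"
  using minor_in_K[of "mo 4 0 0" m] by (simp add: Fer'_mo)

lemma quadric_difference_in_K: "(Fer' m :: 'k) = 1 \<Longrightarrow> H4 special_A (mo 4 0 0) - H4 special_A m \<in> K"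
  using minor_in_K[of m "mo 4 0 0"] by (simp add: Fer'_mo)

text \<open>These are the coefficients of \<open>H4\<close> at the quartic that the linear relations leave, up to numerical factors: the mixed
  coefficients vanish and those of \<open>u\<^sup>4\<close>, \<open>v\<^sup>4\<close>, \<open>w\<^sup>4\<close> agree.\<close>

lemma quadratic_relations:
  fixes p q r a b c :: "'k bipoly"
  defines "p \<equiv> Avec (mo 0 2 2)" and "q \<equiv> Avec (mo 2 0 2)" and "r \<equiv> Avec (mo 2 2 0)"
    and "a \<equiv> Avec (mo 2 1 1)" and "b \<equiv> Avec (mo 1 2 1)" and "c \<equiv> Avec (mo 1 1 2)"
  shows "p^2 - q^2 \<in> K" "p^2 - r^2 \<in> K"
    "p * b \<in> K" "p * c \<in> K" "q * a \<in> K" "q * c \<in> K" "r * a \<in> K" "r * b \<in> K"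
    "12 * s_form * p + 2 * q * r + a^2 \<in> K" "12 * s_form * q + 2 * p * r + b^2 \<in> K"
    "12 * s_form * r + 2 * p * q + c^2 \<in> K"
    "4 * p * a - b * c \<in> K" "4 * q * b - a * c \<in> K" "4 * r * c - a * b \<in> K"
proof -
  note H = H4_special[of s_form p q r a b c]
  note fold = p_def[symmetric] q_def[symmetric] r_def[symmetric] a_def[symmetric] b_def[symmetric] c_def[symmetric]
  have cancel_neg: "F \<in> K" if "- numeral n * F \<in> K" for n F
    using ideal_bipolyD(5)[OF K_ideal that] by (intro K_cancel_numeral[of n F]) simp
  have Q: "H4 special_A (mo 3 0 1) \<in> K" "H4 special_A (mo 3 1 0) \<in> K" "H4 special_A (mo 0 3 1) \<in> K"
    "H4 special_A (mo 1 3 0) \<in> K" "H4 special_A (mo 0 1 3) \<in> K" "H4 special_A (mo 1 0 3) \<in> K"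
    "H4 special_A (mo 0 2 2) \<in> K" "H4 special_A (mo 2 0 2) \<in> K" "H4 special_A (mo 2 2 0) \<in> K"
    "H4 special_A (mo 2 1 1) \<in> K" "H4 special_A (mo 1 2 1) \<in> K" "H4 special_A (mo 1 1 2) \<in> K"
    by (rule quadric_in_K; simp add: Fer'_mo)+
  have D: "H4 special_A (mo 4 0 0) - H4 special_A (mo 0 4 0) \<in> K" "H4 special_A (mo 4 0 0) - H4 special_A (mo 0 0 4) \<in> K"
    by (rule quadric_difference_in_K; simp add: Fer'_mo)+
  note Q' = Q[unfolded fold H] and D' = D[unfolded fold H]
  show "p * b \<in> K" "p * c \<in> K" "q * a \<in> K" "q * c \<in> K" "r * a \<in> K" "r * b \<in> K"
    by (rule cancel_neg, rule Q')+
  have 4: "F \<in> K" if "G \<in> K" "G = 4 * F" for F G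
    using that(1) unfolding that(2) by (rule K_cancel_numeral)
  show "12 * s_form * p + 2 * q * r + a^2 \<in> K" "12 * s_form * q + 2 * p * r + b^2 \<in> K"
    "12 * s_form * r + 2 * p * q + c^2 \<in> K"
    by (rule 4[OF Q'(7)], simp, rule 4[OF Q'(8)], simp, rule 4[OF Q'(9)], simp)
  show "4 * p * a - b * c \<in> K" "4 * q * b - a * c \<in> K" "4 * r * c - a * b \<in> K"
    by (rule 4[OF Q'(10)], simp add: right_diff_distrib, rule 4[OF Q'(11)], simp add: right_diff_distrib,
      rule 4[OF Q'(12)], simp add: right_diff_distrib)
  show "p^2 - q^2 \<in> K" "p^2 - r^2 \<in> K"
    by (rule 4[OF D'(1)], simp add: right_diff_distrib, rule 4[OF D'(2)], simp add: right_diff_distrib)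
qed

lemma s_notin_P: "(\<And>m. Avec m - mConst (C m) * s_form \<in> P) \<Longrightarrow> s_form \<notin> P"
proof
  assume A: "Avec m - mConst (C m) * s_form \<in> P" for m
  assume s: "s_form \<in> P"
  have "Avec m \<in> P" for m
    using ideal_bipolyD(2)[OF prime_bipolyD(1)[OF P_prime] A[of m]
        ideal_bipolyD(3)[OF prime_bipolyD(1)[OF P_prime] s, of "mConst (C m)"]] by simp
  then show False using A_not_subset_P by auto
qed

text \<open>If \<open>A\<close> is congruent to the multiple \<open>s C\<close> of a fixed quartic, normal forms are constants.\<close>

lemma congruent_evaluation:
  assumes L: "ideal L bipoly_ring" "H_fiber Fer' \<subseteq> L" "\<And>F. s_form * F \<in> L \<Longrightarrow> F \<in> L"
    and A: "\<And>m. Avec m - mConst (C m) * s_form \<in> L"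
    and F: "bihom d e F"
  shows "F - s_form ^ d * u_form ^ e * mConst (eval_at C Fer' F) \<in> L"
proof -
  have "s_form ^ 0 * F - s_form ^ d * u_form ^ e * mConst (eval_at C Fer' F) \<in> L"
  proof (rule normal_form[OF L(1) ring_map_eval_at L(3) _ _ _ _ _ _ F])
    show "s_form ^ 0 * Bvec m - u_form * mConst (eval_at C Fer' (Bvec m)) \<in> L" for m
      using Bvec_congruent[of m] L(2) by (auto simp: eval_at_simps mult.commute)
    show "s_form ^ 0 * Avec m - s_form * mConst (eval_at C Fer' (Avec m)) \<in> L" for m
      using A[of m] by (simp add: eval_at_simps mult.commute)
  qed (simp_all add: mConst_add mConst_mult eval_at_simps ideal_bipolyD(1)[OF L(1)])
  then show ?thesis by simp
qed

lemma P_eq_rational_point: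
  assumes A: "\<And>m. Avec m - mConst (C m) * s_form \<in> P"
  shows "P = rational_point C Fer'"
proof -
  note prime = prime_bipolyD[OF P_prime]
  note s = s_notin_P[OF A]
  have "F \<in> P \<longleftrightarrow> eval_at C Fer' F = 0" if F: "bihom d e F" for d e F
  proof -
    have cong: "F - s_form ^ d * u_form ^ e * mConst (eval_at C Fer' F) \<in> P"
      by (rule congruent_evaluation[OF prime(1) fiber_subset_P _ A F]) (use s prime(3) in blast)
    have pow: "x ^ n \<notin> P" if "x \<notin> P" for x n
      using that by (induction n) (simp_all add: prime(2,3))
    show ?thesis
    proof
      assume "eval_at C Fer' F = 0"
      then show "F \<in> P" using cong by simp
    next
      assume "F \<in> P"
      from ideal_bipolyD(6)[OF prime(1) this cong]
      have "s_form ^ d * u_form ^ e * mConst (eval_at C Fer' F) \<in> P" by simp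
      then have "mConst (eval_at C Fer' F) \<in> P"
        using pow[OF s] pow[OF u_notin_P] by (simp add: prime(3))
      then show "eval_at C Fer' F = 0"
        using mConst_notin_prime[OF P_prime] by blast
    qed
  qed
  then have "{F \<in> P. \<exists>d e. bihom d e F} = {F \<in> {F. eval_at C Fer' F = 0}. \<exists>d e. bihom d e F}"
    by blast
  then have "bihom_ideal P = rational_point C Fer'"
    unfolding rational_point_def bihom_ideal_def by simp
  then show ?thesis by (simp add: P_bihom)
qed

lemma congruent_evaluation_K:
  assumes A: "\<And>m. Avec m - mConst (C m) * s_form \<in> K"
    and F: "bihom d e F" "eval_at C Fer' F = 0"
  shows "F \<in> K"
proof -
  have s: "s_form \<notin> P"
    using A K_subset_P by (intro s_notin_P[of C]) blast
  have "F \<in> K" if "s_form * F \<in> K" for F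
    by (rule K_cancel[OF that bihom_CoA s])
  from congruent_evaluation[OF K_ideal fiber_subset_K this A F(1)] show ?thesis
    by (simp add: F(2))
qed

text \<open>The equation \<open>p\<^sup>2 = q\<^sup>2\<close> reads \<open>(p - q) (p + q) = 0\<close>. Both factors cannot vanish at the point, as \<open>p\<close> does not;
  so one of them is a unit and the other is 0 even in the local ring. This gives the signs \<open>\<epsilon>\<close> and \<open>\<delta>\<close>, and
  the remaining equations are linear after cancelling \<open>p\<close>.\<close>

lemma reduced_points:
  assumes p: "Avec (mo 0 2 2) \<notin> P"
  shows "\<exists>C\<in>{C0, C1, C2, C3}. \<forall>m. Avec m - mConst (C m) * s_form \<in> K"
proof -
  define p q r a b c where defs: "p \<equiv> Avec (mo 0 2 2) :: 'k bipoly" "q \<equiv> Avec (mo 2 0 2) :: 'k bipoly"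
    "r \<equiv> Avec (mo 2 2 0) :: 'k bipoly" "a \<equiv> Avec (mo 2 1 1) :: 'k bipoly" "b \<equiv> Avec (mo 1 2 1) :: 'k bipoly"
    "c \<equiv> Avec (mo 1 1 2) :: 'k bipoly"
  note rel = quadratic_relations[folded defs]
  note prime = prime_bipolyD[OF P_prime]
  note K = ideal_bipolyD[OF K_ideal]
  have p: "p \<notin> P" using p by (simp add: defs)
  have hom: "bihom 1 0 p" "bihom 1 0 q" "bihom 1 0 r"
    unfolding defs by (rule bihom_CoA)+
  have twice: "2 * p \<notin> P"
    using p numeral_notin_prime[OF P_prime] by (simp add: prime(3))
  have sign: "\<exists>\<epsilon>\<in>{1, -1 :: 'k}. x - mConst \<epsilon> * p \<in> K" if x: "p^2 - x^2 \<in> K" "bihom 1 0 x" for x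
  proof (cases "p + x \<in> P")
    case True
    have unit: "p - x \<notin> P"
    proof
      assume "p - x \<in> P"
      from ideal_bipolyD(2)[OF prime(1) this True] show False using twice by simp
    qed
    have "(p - x) * (x + p) = p^2 - x^2"
      by (simp add: power2_eq_square algebra_simps)
    then have "(p - x) * (x + p) \<in> K"
      using x(1) by simp
    then have "x + p \<in> K"
      by (rule K_cancel[OF _ bihom_diff[OF hom(1) x(2)] unit])
    then show ?thesis
      by (intro bexI[of _ "-1"]) (simp_all add: ring_mapD(5)[OF ring_map_mConst])
  next
    case False
    have "(p + x) * (x - p) = - (p^2 - x^2)"
      by (simp add: power2_eq_square algebra_simps)
    then have "(p + x) * (x - p) \<in> K"
      using K(5)[OF x(1)] by simp
    then have "x - p \<in> K"
      by (rule K_cancel[OF _ bihom_add[OF hom(1) x(2)] False])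
    then show ?thesis
      by (intro bexI[of _ 1]) simp_all
  qed
  \<comment> \<open>The four sign choices correspond to the four quartics.\<close>
  obtain \<epsilon> \<delta> :: 'k where \<epsilon>: "\<epsilon> \<in> {1, -1}" "q - mConst \<epsilon> * p \<in> K" and \<delta>: "\<delta> \<in> {1, -1}" "r - mConst \<delta> * p \<in> K"
    using sign[OF rel(1) hom(2)] sign[OF rel(2) hom(3)] by blast
  define \<epsilon>' \<delta>' where e': "\<epsilon>' = (mConst \<epsilon> :: 'k bipoly)" "\<delta>' = (mConst \<delta> :: 'k bipoly)"
  have sq: "\<epsilon>' * \<epsilon>' = 1" "\<delta>' * \<delta>' = 1"
    using \<epsilon>(1) \<delta>(1) by (auto simp: e' mConst_mult[symmetric])
  note q = \<epsilon>(2)[folded e'] and r = \<delta>(2)[folded e']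
  have q_unit: "q \<notin> P" if "p^2 - q^2 \<in> K" for q
  proof
    assume "q \<in> P"
    then have "q^2 \<in> P" by (simp add: power2_eq_square prime(3))
    from ideal_bipolyD(2)[OF prime(1) subsetD[OF K_subset_P that] this] show False
      using p by (simp add: power2_eq_square prime(3))
  qed
  have abc: "a \<in> K" "b \<in> K" "c \<in> K"
    using K_cancel[OF rel(5) hom(2) q_unit[OF rel(1)]] K_cancel[OF rel(3) hom(1) p] K_cancel[OF rel(4) hom(1) p]
    by simp_all
  have "2 * (p * (6 * s_form + \<epsilon>' * \<delta>' * p)) =
    (12 * s_form * p + 2 * q * r + a^2) - a * a - 2 * (r * (q - \<epsilon>' * p) + \<epsilon>' * p * (r - \<delta>' * p))"
    by (simp add: power2_eq_square algebra_simps)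
  also have "\<dots> \<in> K"
    by (intro K(2,3,6) rel q r abc)
  finally have "p * (6 * s_form + \<epsilon>' * \<delta>' * p) \<in> K"
    by (rule K_cancel_numeral)
  then have s: "6 * s_form + \<epsilon>' * \<delta>' * p \<in> K"
    by (rule K_cancel[OF _ hom(1) p])
  have p6: "p - (- 6 * (\<epsilon>' * \<delta>')) * s_form \<in> K"
  proof -
    have "p - (- 6 * (\<epsilon>' * \<delta>')) * s_form = \<epsilon>' * \<delta>' * (6 * s_form + \<epsilon>' * \<delta>' * p) + (1 - (\<epsilon>' * \<epsilon>') * (\<delta>' * \<delta>')) * p"
      by (simp add: algebra_simps)
    then show ?thesis using K(3)[OF s, of "\<epsilon>' * \<delta>'"] by (simp add: sq)
  qed
  have q6: "q - (- 6 * \<delta>') * s_form \<in> K"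
  proof -
    have "\<epsilon>' * (p - (- 6 * (\<epsilon>' * \<delta>')) * s_form) = \<epsilon>' * p + 6 * ((\<epsilon>' * \<epsilon>') * \<delta>') * s_form"
      by (simp add: algebra_simps)
    then have "q - (- 6 * \<delta>') * s_form = (q - \<epsilon>' * p) + \<epsilon>' * (p - (- 6 * (\<epsilon>' * \<delta>')) * s_form)"
      by (simp add: sq)
    then show ?thesis using K(2)[OF q K(3)[OF p6, of "\<epsilon>'"]] by (simp only:)
  qed
  have r6: "r - (- 6 * \<epsilon>') * s_form \<in> K"
  proof -
    have "\<delta>' * (p - (- 6 * (\<epsilon>' * \<delta>')) * s_form) = \<delta>' * p + 6 * ((\<delta>' * \<delta>') * \<epsilon>') * s_form"
      by (simp add: algebra_simps)
    then have "r - (- 6 * \<epsilon>') * s_form = (r - \<delta>' * p) + \<delta>' * (p - (- 6 * (\<epsilon>' * \<delta>')) * s_form)"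
      by (simp add: sq)
    then show ?thesis using K(2)[OF r K(3)[OF p6, of "\<delta>'"]] by (simp only:)
  qed
  let ?C = "special_quartic 1 (- 6 * (\<epsilon> * \<delta>)) (- 6 * \<delta>) (- 6 * \<epsilon>) 0 0 0 :: 'k quartic"
  have "\<forall>m. Avec m - mConst (?C m) * s_form \<in> K"
    unfolding all_mon4 using linear_relations p6 q6 r6 abc
    by (simp add: special_quartic_mo e' defs K(1) mConst_mult ring_mapD(5,9)[OF ring_map_mConst])
  moreover have "?C \<in> {C0, C1, C2, C3}"
    using \<epsilon>(1) \<delta>(1) by (auto simp: quartics_special)
  ultimately show ?thesis by blast
qed

text \<open>The squares \<open>q\<^sup>2, r\<^sup>2\<close> are equal to \<open>p\<^sup>2\<close>, and \<open>a\<^sup>2\<close> is a combination of \<open>p\<close> and \<open>q r\<close>; so all six coefficients vanish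
  with \<open>p\<close>.\<close>

lemma Fermat_case:
  assumes "Avec (mo 0 2 2) \<in> P"
  shows "Avec (mo 0 2 2) \<in> P" "Avec (mo 2 0 2) \<in> P" "Avec (mo 2 2 0) \<in> P"
    "Avec (mo 2 1 1) \<in> P" "Avec (mo 1 2 1) \<in> P" "Avec (mo 1 1 2) \<in> P"
    "Avec m - mConst (Fer m) * s_form \<in> P" "s_form \<notin> P"
proof -
  define p q r a b c where defs: "p \<equiv> Avec (mo 0 2 2) :: 'k bipoly" "q \<equiv> Avec (mo 2 0 2) :: 'k bipoly"
    "r \<equiv> Avec (mo 2 2 0) :: 'k bipoly" "a \<equiv> Avec (mo 2 1 1) :: 'k bipoly" "b \<equiv> Avec (mo 1 2 1) :: 'k bipoly"
    "c \<equiv> Avec (mo 1 1 2) :: 'k bipoly"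
  note rel = quadratic_relations[folded defs, THEN subsetD[OF K_subset_P]]
  note prime = prime_bipolyD[OF P_prime]
  note PI = ideal_bipolyD[OF prime(1)]
  have p: "p \<in> P" using assms by (simp add: defs)
  have sq: "x \<in> P" if "x^2 \<in> P" for x
    using that by (simp add: power2_eq_square prime(3))
  have "p^2 - (p^2 - q^2) \<in> P" "p^2 - (p^2 - r^2) \<in> P"
    by (intro PI rel; simp add: power2_eq_square prime(3) p)+
  then have qr: "q \<in> P" "r \<in> P"
    by (simp_all add: sq)
  have "(12 * s_form * p + 2 * q * r + a^2) - (12 * s_form) * p - (2 * q) * r \<in> P"
     "(12 * s_form * q + 2 * p * r + b^2) - (12 * s_form) * q - (2 * p) * r \<in> P"
     "(12 * s_form * r + 2 * p * q + c^2) - (12 * s_form) * r - (2 * p) * q \<in> P"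
    by (intro PI(3,6) rel p qr)+
  then have abc: "a \<in> P" "b \<in> P" "c \<in> P"
    by (simp_all add: sq)
  show "Avec (mo 0 2 2) \<in> P" "Avec (mo 2 0 2) \<in> P" "Avec (mo 2 2 0) \<in> P"
    "Avec (mo 2 1 1) \<in> P" "Avec (mo 1 2 1) \<in> P" "Avec (mo 1 1 2) \<in> P"
    using p qr abc by (simp_all add: defs)
  have "\<forall>m. Avec m - mConst (Fer m) * s_form \<in> P"
    unfolding all_mon4 using linear_relations[THEN subsetD[OF K_subset_P]] p qr abc
    by (simp add: quartics_special(1) special_quartic_mo defs PI(1))
  then show A: "Avec m - mConst (Fer m) * s_form \<in> P" for m by blast
  show "s_form \<notin> P" by (rule s_notin_P[OF A])
qed

text \<open>The factor \<open>- 1/3\<close> normalises the coefficients of the cubic relations to 1. The main step is that \<open>q r\<close> vanishes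
  locally. Multiplying two of the quadratic relations by \<open>r\<close> gives \<open>6 s p r + q r\<^sup>2 = 0\<close> and \<open>6 s q r + p r\<^sup>2 = 0\<close>, hence
  \<open>(36 s\<^sup>2 - r\<^sup>2) q r = 0\<close>, where the first factor is a unit because \<open>r\<close> vanishes at the point. Then \<open>p\<close> is a
  multiple of \<open>\<alpha>\<^sup>2 / s\<close>, and the other relations follow by substitution.\<close>

lemma Fermat_local_relations:
  fixes \<alpha> \<beta> \<gamma> p q r :: "'k bipoly"
  assumes "Avec (mo 0 2 2) \<in> P"
  defines "\<alpha> \<equiv> mConst (- 1 / 3) * Avec (mo 2 1 1)" and "\<beta> \<equiv> mConst (- 1 / 3) * Avec (mo 1 2 1)"
    and "\<gamma> \<equiv> mConst (- 1 / 3) * Avec (mo 1 1 2)"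
    and "p \<equiv> Avec (mo 0 2 2)" and "q \<equiv> Avec (mo 2 0 2)" and "r \<equiv> Avec (mo 2 2 0)"
  shows "4 * s_form * p + 3 * \<alpha>^2 \<in> K" "4 * s_form * q + 3 * \<beta>^2 \<in> K" "4 * s_form * r + 3 * \<gamma>^2 \<in> K"
    "s_form * \<beta> * \<gamma> - \<alpha>^3 \<in> K" "s_form * \<alpha> * \<gamma> - \<beta>^3 \<in> K" "s_form * \<alpha> * \<beta> - \<gamma>^3 \<in> K"
    "\<alpha>^2 * \<beta> \<in> K" "\<alpha>^2 * \<gamma> \<in> K" "\<beta>^2 * \<alpha> \<in> K" "\<beta>^2 * \<gamma> \<in> K" "\<gamma>^2 * \<alpha> \<in> K" "\<gamma>^2 * \<beta> \<in> K"
    "\<alpha>^4 - \<beta>^4 \<in> K" "\<alpha>^4 - \<gamma>^4 \<in> K"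
proof -
  define s a b c where defs: "s \<equiv> s_form :: 'k bipoly" "a \<equiv> Avec (mo 2 1 1) :: 'k bipoly"
    "b \<equiv> Avec (mo 1 2 1) :: 'k bipoly" "c \<equiv> Avec (mo 1 1 2) :: 'k bipoly"
  note rel0 = quadratic_relations[folded p_def q_def r_def defs]
  note F = Fermat_case[OF assms(1), folded p_def q_def r_def defs]
  note prime = prime_bipolyD[OF P_prime]
  note K = ideal_bipolyD[OF K_ideal]
  note P_closed = ideal_bipolyD[OF prime(1)]
  have hom: "bihom 1 0 s" "bihom 1 0 p" "bihom 1 0 q" "bihom 1 0 r"
    unfolding defs p_def q_def r_def by (rule bihom_CoA)+
  have cancel_s: "G \<in> K" if "s * G \<in> K" for G
    by (rule K_cancel[OF that hom(1) F(8)])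
  have qr: "q * r \<in> K"
  proof -
    \<comment> \<open>The last summand vanishes; \<open>mConst (1/2)\<close> is kept as a symbol to stay inside ring identities.\<close>
    have "(36 * s^2 - r^2) * (q * r) = 3 * s * (r * (12 * s * q + 2 * p * r + b^2) - b * (r * b))
        - (mConst (1/2) * r) * (r * (12 * s * p + 2 * q * r + a^2) - a * (r * a)) 
        + (2 * mConst (1/2) - 1) * (6 * s * r * (p * r) + r * r * q * r)"
      by (simp add: power2_eq_square algebra_simps)
    moreover have "2 * mConst (1/2) = (1 :: 'k bipoly)"
      by (simp add: ring_mapD(9)[OF ring_map_mConst, symmetric] mConst_mult[symmetric])
    moreover have "3 * s * (r * (12 * s * q + 2 * p * r + b^2) - b * (r * b))
        - (mConst (1/2) * r) * (r * (12 * s * p + 2 * q * r + a^2) - a * (r * a)) \<in> K"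
      by (intro K(3,6) rel0)
    ultimately have "(36 * s^2 - r^2) * (q * r) \<in> K" by simp
    moreover have unit: "36 * s^2 - r^2 \<notin> P"
    proof
      assume "36 * s^2 - r^2 \<in> P"
      from P_closed(2)[OF this P_closed(3)[OF F(3), of r]] have "36 * s^2 \<in> P"
        by (simp add: power2_eq_square)
      then show False
        using F(8) numeral_notin_prime[OF P_prime] by (simp add: prime(3) power2_eq_square)
    qed
    moreover have hom2: "bihom 2 0 (36 * s^2 - r^2)"
      unfolding power2_eq_square
      by (intro bihom_diff bihom_mult_eq[OF bihom_numeral bihom_mult[OF hom(1) hom(1)]] bihom_mult_eq[OF hom(4) hom(4)]) simp_all
    ultimately show "q * r \<in> K"
      using K_cancel[of "36 * s^2 - r^2" "q * r" 2 0] by blast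
  qed
  have pr: "p * r \<in> K"
  proof -
    have "12 * (s * (p * r)) = r * (12 * s * p + 2 * q * r + a^2) - a * (r * a) - 2 * r * (q * r)"
      by (simp add: power2_eq_square algebra_simps)
    also have "\<dots> \<in> K" by (intro K(3,6) rel0 qr)
    finally show ?thesis by (intro cancel_s[of "p * r"] K_cancel_numeral[of _ "s * (p * r)"])
  qed
  have pq: "p * q \<in> K"
  proof -
    have "12 * (s * (p * q)) = p * (12 * s * q + 2 * p * r + b^2) - b * (p * b) - 2 * p * (p * r)"
      by (simp add: power2_eq_square algebra_simps)
    also have "\<dots> \<in> K" by (intro K(3,6) rel0 pr)
    finally show ?thesis by (intro cancel_s[of "p * q"] K_cancel_numeral[of _ "s * (p * q)"])
  qed
  have abc: "a = - 3 * \<alpha>" "b = - 3 * \<beta>" "c = - 3 * \<gamma>"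
  proof -
    have "3 * mConst (- 1 / 3) = (- 1 :: 'k bipoly)"
      by (simp add: ring_mapD(1,5,9)[OF ring_map_mConst, symmetric] mConst_mult[symmetric] del: mConst_1)
    then have "- 3 * (mConst (- 1 / 3) * x) = x" for x :: "'k bipoly"
      by (simp add: mult.assoc[symmetric])
    then show "a = - 3 * \<alpha>" "b = - 3 * \<beta>" "c = - 3 * \<gamma>"
      by (simp_all add: \<alpha>_def \<beta>_def \<gamma>_def defs)
  qed
  note rel = rel0[unfolded abc]
  have sq: "4 * s * p + 3 * x^2 \<in> K" if "12 * s * p + 2 * y * z + (- 3 * x)^2 \<in> K" "y * z \<in> K" for p x y z
  proof -
    have "3 * (4 * s * p + 3 * x^2) = (12 * s * p + 2 * y * z + (- 3 * x)^2) - 2 * (y * z)"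
      by (simp add: power2_eq_square algebra_simps)
    also have "\<dots> \<in> K" by (intro K(3,6) that)
    finally show ?thesis by (rule K_cancel_numeral)
  qed
  have p2: "4 * s * p + 3 * \<alpha>^2 \<in> K" and q2: "4 * s * q + 3 * \<beta>^2 \<in> K" and r2: "4 * s * r + 3 * \<gamma>^2 \<in> K"
    by (rule sq[OF rel(9) qr], rule sq[OF rel(10) pr], rule sq[OF rel(11) pq])
  then show "4 * s_form * p + 3 * \<alpha>^2 \<in> K" "4 * s_form * q + 3 * \<beta>^2 \<in> K" "4 * s_form * r + 3 * \<gamma>^2 \<in> K"
    by (simp_all add: defs)
  have cubic: "s * y * z - x^3 \<in> K" if "4 * s * p + 3 * x^2 \<in> K" "4 * p * (- 3 * x) - (- 3 * y) * (- 3 * z) \<in> K" for p x y z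
  proof -
    have "9 * (s * y * z - x^3) = - (s * (4 * p * (- 3 * x) - (- 3 * y) * (- 3 * z))) - 3 * x * (4 * s * p + 3 * x^2)"
      by (simp add: power2_eq_square power3_eq_cube algebra_simps)
    also have "\<dots> \<in> K" by (intro K(3,5,6) that)
    finally show ?thesis by (rule K_cancel_numeral)
  qed
  show "s_form * \<beta> * \<gamma> - \<alpha>^3 \<in> K" "s_form * \<alpha> * \<gamma> - \<beta>^3 \<in> K" "s_form * \<alpha> * \<beta> - \<gamma>^3 \<in> K"
    using cubic[OF p2 rel(12)] cubic[OF q2 rel(13)] cubic[OF r2 rel(14)] by (simp_all add: defs)
  have mixed: "x^2 * y \<in> K" if "4 * s * p + 3 * x^2 \<in> K" "p * (- 3 * y) \<in> K" for p x y
  proof -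
    have "9 * (x^2 * y) = 3 * y * (4 * s * p + 3 * x^2) + 4 * s * (p * (- 3 * y))"
      by (simp add: power2_eq_square algebra_simps)
    also have "\<dots> \<in> K" by (intro K(2,3) that)
    finally show ?thesis by (rule K_cancel_numeral)
  qed
  show "\<alpha>^2 * \<beta> \<in> K" "\<alpha>^2 * \<gamma> \<in> K" "\<beta>^2 * \<alpha> \<in> K" "\<beta>^2 * \<gamma> \<in> K" "\<gamma>^2 * \<alpha> \<in> K" "\<gamma>^2 * \<beta> \<in> K"
    by (rule mixed[OF p2 rel(3)], rule mixed[OF p2 rel(4)], rule mixed[OF q2 rel(5)], rule mixed[OF q2 rel(6)],
        rule mixed[OF r2 rel(7)], rule mixed[OF r2 rel(8)])
  have quartic: "x^4 - y^4 \<in> K" if "4 * s * p + 3 * x^2 \<in> K" "4 * s * q + 3 * y^2 \<in> K" "p^2 - q^2 \<in> K" for p q x y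
  proof -
    have "9 * (x^4 - y^4) = 16 * s^2 * (p^2 - q^2) + (3 * x^2 - 4 * s * p) * (4 * s * p + 3 * x^2)
        - (3 * y^2 - 4 * s * q) * (4 * s * q + 3 * y^2)"
      by (simp add: power2_eq_square power4_eq_xxxx algebra_simps)
    also have "\<dots> \<in> K" by (intro K(2,3,6) that)
    finally show ?thesis by (rule K_cancel_numeral)
  qed
  show "\<alpha>^4 - \<beta>^4 \<in> K" "\<alpha>^4 - \<gamma>^4 \<in> K"
    by (rule quartic[OF p2 q2 rel(1)], rule quartic[OF p2 r2 rel(2)])
qed

end

section \<open>Length of finite-dimensional algebras\<close>

text \<open>Choosing a vector in each step of the chain yields linearly independent vectors.\<close>

lemma (in vector_space) subspace_chain_length:
  assumes B: "finite B" "span B = UNIV"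
    and sub: "\<And>i. i \<le> m \<Longrightarrow> subspace (I i)" and strict: "\<And>i. i < m \<Longrightarrow> I i \<subset> I (Suc i)"
  shows "m \<le> card B"
proof -
  have "\<forall>i\<in>{..<m}. \<exists>x. x \<in> I (Suc i) - I i"
    using strict by blast
  then obtain x where x: "\<forall>i\<in>{..<m}. x i \<in> I (Suc i) - I i"
    by (rule bchoice[THEN exE])
  have "independent (x ` {..<n}) \<and> card (x ` {..<n}) = n \<and> x ` {..<n} \<subseteq> I n" if "n \<le> m" for n
    using that
  proof (induction n)
    case 0
    then show ?case by (simp add: dependent_def)
  next
    case (Suc n)
    then have n: "n < m" "n \<le> m" by simp_all
    have ind: "independent (x ` {..<n})" and crd: "card (x ` {..<n}) = n" and mem: "x ` {..<n} \<subseteq> I n"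
      using Suc.IH[OF n(2)] by blast+
    have xn: "x n \<in> I (Suc n)" "x n \<notin> I n"
      using x n by blast+
    have new: "x n \<notin> span (x ` {..<n})"
      using span_minimal[OF mem sub[OF n(2)]] xn(2) by blast
    have "x n \<notin> x ` {..<n}"
      using mem xn(2) by blast
    then have "card (insert (x n) (x ` {..<n})) = Suc n"
      by (simp add: crd)
    moreover have "insert (x n) (x ` {..<n}) \<subseteq> I (Suc n)"
      using mem xn(1) strict[OF n(1)] by blast
    ultimately show ?case
      using independent_insertI[OF new ind] by (simp only: lessThan_Suc image_insert simp_thms)
  qed
  from this[of m] have "independent (x ` {..<m})" "card (x ` {..<m}) = m" by blast+
  then show ?thesis
    using independent_span_bound[OF B(1), of "x ` {..<m}"] B(2) by simp
qed

text \<open>Ideals are subspaces, so no chain of ideals is longer than the dimension; the given chain attains it.\<close>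

lemma length_of_algebra:
  fixes \<phi> :: "'k::field \<Rightarrow> 't::comm_ring_1"
  assumes \<phi>: "ring_map \<phi>"
    and B: "finite B" "\<And>x. \<exists>u. x = (\<Sum>b\<in>B. \<phi> (u b) * b)"
    and I: "\<And>i. i \<le> card B \<Longrightarrow> ideal (I i) (type_ring :: 't ring)" "\<And>i. i < card B \<Longrightarrow> I i \<subset> I (Suc i)"
  shows "ring_length (type_ring :: 't ring) = enat (card B)"
proof (rule ring_length_eqI[where I = I])
  show "ideal (I i) (type_ring :: 't ring)" if "i \<le> card B" for i
    by (rule I(1)[OF that])
  show "I i \<subset> I (Suc i)" if "i < card B" for i
    by (rule I(2)[OF that])
  interpret vs: vector_space "\<lambda>c x. \<phi> c * x"
    by unfold_locales (simp_all add: ring_mapD[OF \<phi>] algebra_simps)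
  fix m and J :: "nat \<Rightarrow> 't set"
  assume J: "\<And>i. i \<le> m \<Longrightarrow> ideal (J i) type_ring" "\<And>i. i < m \<Longrightarrow> J i \<subset> J (Suc i)"
  have "vs.span B = UNIV"
  proof (intro equalityI subsetI)
    fix x
    obtain u where x: "x = (\<Sum>b\<in>B. \<phi> (u b) * b)" using B(2) by blast
    show "x \<in> vs.span B"
      unfolding x by (intro vs.span_sum vs.span_scale vs.span_base)
  qed simp
  moreover have "vs.subspace (J i)" if "i \<le> m" for i
    using J(1)[OF that] unfolding vs.subspace_def ideal_type_ring_iff by blast
  ultimately show "m \<le> card B"
    using J(2) by (intro vs.subspace_chain_length[OF B(1), of m J])
qed

lemma length_field: "ring_length (type_ring :: 'k::field ring) = 1"
proof -
  have "ring_length (type_ring :: 'k ring) = enat (card {1 :: 'k})"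
  proof (rule length_of_algebra[OF ring_map_id])
    show "\<exists>u. x = (\<Sum>b\<in>{1}. id (u b) * b)" for x :: 'k
      by (rule exI[of _ "\<lambda>_. x"]) simp
    show "ideal (if i = 0 then {0} else UNIV) (type_ring :: 'k ring)" for i :: nat
      by (simp add: ideal_type_ring_iff)
    show "(if i = 0 then {0} else UNIV) \<subset> (if Suc i = 0 then {0} else (UNIV :: 'k set))" if "i < card {1 :: 'k}" for i :: nat
      using that by (auto simp: psubset_eq set_eq_iff intro: exI[of _ 1])
  qed simp
  then show ?thesis by (simp add: one_enat_def)
qed

section \<open>The local algebra at the Fermat quartic\<close>

text \<open>The algebra generated by \<open>\<alpha>, \<beta>, \<gamma>\<close> with \<open>\<beta> \<gamma> = \<alpha>\<^sup>3\<close>, \<open>\<alpha> \<gamma> = \<beta>\<^sup>3\<close>, \<open>\<alpha> \<beta> = \<gamma>\<^sup>3\<close>, \<open>\<alpha>\<^sup>4 = \<beta>\<^sup>4 = \<gamma>\<^sup>4\<close> in which the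
  products of a square of one generator with another generator vanish. The eleven coordinates belong to
  \<open>1, \<alpha>, \<beta>, \<gamma>, \<alpha>\<^sup>2, \<beta>\<^sup>2, \<gamma>\<^sup>2, \<alpha>\<^sup>3, \<beta>\<^sup>3, \<gamma>\<^sup>3, \<alpha>\<^sup>4\<close>, in this order. The fifth power of the maximal ideal is 0.\<close>

datatype 'k fat = Fat 'k 'k 'k 'k 'k 'k 'k 'k 'k 'k 'k

instantiation fat :: (comm_ring_1) comm_ring_1
begin

definition zero_fat :: "'a fat" where "0 = Fat 0 0 0 0 0 0 0 0 0 0 0"

definition one_fat :: "'a fat" where "1 = Fat 1 0 0 0 0 0 0 0 0 0 0"

fun plus_fat :: "'a fat \<Rightarrow> 'a fat \<Rightarrow> 'a fat"
  where "Fat n a b c a2 b2 c2 a3 b3 c3 t + Fat n' a' b' c' a2' b2' c2' a3' b3' c3' t' =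
    Fat (n + n') (a + a') (b + b') (c + c') (a2 + a2') (b2 + b2') (c2 + c2') (a3 + a3') (b3 + b3') (c3 + c3') (t + t')"

fun uminus_fat :: "'a fat \<Rightarrow> 'a fat"
  where "- Fat n a b c a2 b2 c2 a3 b3 c3 t = Fat (- n) (- a) (- b) (- c) (- a2) (- b2) (- c2) (- a3) (- b3) (- c3) (- t)"

definition minus_fat :: "'a fat \<Rightarrow> 'a fat \<Rightarrow> 'a fat"
  where "x - y = x + - (y :: 'a fat)"

fun times_fat :: "'a fat \<Rightarrow> 'a fat \<Rightarrow> 'a fat"
  where "Fat n a b c a2 b2 c2 a3 b3 c3 t * Fat n' a' b' c' a2' b2' c2' a3' b3' c3' t' =
    Fat (n * n') (n * a' + a * n') (n * b' + b * n') (n * c' + c * n')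
     (n * a2' + a * a' + a2 * n') (n * b2' + b * b' + b2 * n') (n * c2' + c * c' + c2 * n')
     (n * a3' + a * a2' + a2 * a' + a3 * n' + b * c' + c * b')
     (n * b3' + b * b2' + b2 * b' + b3 * n' + a * c' + c * a')
     (n * c3' + c * c2' + c2 * c' + c3 * n' + a * b' + b * a')
     (n * t' + t * n' + a * a3' + a2 * a2' + a3 * a' + b * b3' + b2 * b2' + b3 * b' + c * c3' + c2 * c2' + c3 * c')"

instance
proof
  fix x y z :: "'a fat"
  show "x * y * z = x * (y * z)"
    by (cases x; cases y; cases z) (simp add: algebra_simps)
  show "x * y = y * x"
    by (cases x; cases y) (simp add: ac_simps)
  show "1 * x = x"
    by (cases x) (simp add: one_fat_def)
  show "(x + y) * z = x * z + y * z"
    by (cases x; cases y; cases z) (simp add: algebra_simps)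
  show "x + y + z = x + (y + z)"
    by (cases x; cases y; cases z) (simp add: add.assoc)
  show "x + y = y + x"
    by (cases x; cases y) (simp add: add.commute)
  show "0 + x = x" "- x + x = 0"
    by (cases x; simp add: zero_fat_def)+
  show "x - y = x + - y"
    by (simp add: minus_fat_def)
  show "(0 :: 'a fat) \<noteq> 1"
    by (simp add: zero_fat_def one_fat_def)
qed

end

definition fat_const :: "'k::comm_ring_1 \<Rightarrow> 'k fat"
  where "fat_const c = Fat c 0 0 0 0 0 0 0 0 0 0"

lemma ring_map_fat_const: "ring_map fat_const"
  by (simp add: ring_map_def fat_const_def one_fat_def)

fun fat_residue :: "'k fat \<Rightarrow> 'k"
  where "fat_residue (Fat n a b c a2 b2 c2 a3 b3 c3 t) = n"

lemma ring_map_fat_residue: "ring_map (fat_residue :: 'k::comm_ring_1 fat \<Rightarrow> 'k)"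
  unfolding ring_map_def
proof (intro conjI allI)
  fix x y :: "'k fat"
  show "fat_residue (x + y) = fat_residue x + fat_residue y" "fat_residue (x * y) = fat_residue x * fat_residue y"
    by (cases x; cases y; simp)+
qed (simp add: one_fat_def)

text \<open>An element with residue 1 has the form \<open>1 + y\<close> with \<open>y\<^sup>5 = 0\<close> and is inverted by a geometric sum.\<close>

lemma fat_unit:
  fixes x :: "'k::field fat"
  assumes "fat_residue x \<noteq> 0"
  shows "\<exists>u. x * u = 1"
proof -
  obtain n a b c a2 b2 c2 a3 b3 c3 t where x: "x = Fat n a b c a2 b2 c2 a3 b3 c3 t"
    by (cases x)
  have n: "n \<noteq> 0" using assms by (simp add: x)
  define y where "y = fat_const (1 / n) * Fat 0 a b c a2 b2 c2 a3 b3 c3 t"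
  have x': "x = fat_const n * (1 + y)"
    using n by (simp add: y_def x fat_const_def one_fat_def)
  have "y * y * (y * y) * y = 0"
    by (simp add: y_def fat_const_def zero_fat_def)
  then have "(1 + y) * (1 - y + y * y - y * y * y + y * y * (y * y)) = 1"
    by (simp add: algebra_simps)
  moreover have "fat_const n * fat_const (1 / n) = 1"
    using n by (simp add: fat_const_def one_fat_def)
  ultimately have "x * (fat_const (1 / n) * (1 - y + y * y - y * y * y + y * y * (y * y))) = 1"
    unfolding x' by (metis (no_types, opaque_lifting) mult.assoc mult.left_commute mult.right_neutral)
  then show ?thesis by blast
qed

fun fat_coords :: "'k fat \<Rightarrow> 'k list"
  where "fat_coords (Fat n a b c a2 b2 c2 a3 b3 c3 t) = [n, a, b, c, a2, b2, c2, a3, b3, c3, t]"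

text \<open>Multiplication never lowers the position of the first nonzero coordinate, so the coordinate flag consists of ideals.\<close>

lemma length_fat: "ring_length (type_ring :: 'k::field fat ring) = 11"
proof -
  define B where "B = {Fat 1 0 0 0 0 0 0 0 0 0 0, Fat 0 1 0 0 0 0 0 0 0 0 0, Fat 0 0 1 0 0 0 0 0 0 0 0,
    Fat 0 0 0 1 0 0 0 0 0 0 0, Fat 0 0 0 0 1 0 0 0 0 0 0, Fat 0 0 0 0 0 1 0 0 0 0 0, Fat 0 0 0 0 0 0 1 0 0 0 0,
    Fat 0 0 0 0 0 0 0 1 0 0 0, Fat 0 0 0 0 0 0 0 0 1 0 0, Fat 0 0 0 0 0 0 0 0 0 1 0, Fat 0 0 0 0 0 0 0 0 0 0 (1 :: 'k)}"
  have card: "card B = 11" by (simp add: B_def)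
  define I where "I i = {x :: 'k fat. set (take (11 - i) (fat_coords x)) \<subseteq> {0}}" for i
  have split: "i = 0 \<or> i = 1 \<or> i = 2 \<or> i = 3 \<or> i = 4 \<or> i = 5 \<or> i = 6 \<or> i = 7 \<or> i = 8 \<or> i = 9 \<or> i = 10 \<or> i = 11"
    if "i \<le> 11" for i :: nat
    using that by arith
  have "ring_length (type_ring :: 'k fat ring) = enat (card B)"
  proof (rule length_of_algebra[OF ring_map_fat_const, where I = I])
    show "finite B" by (simp add: B_def)
    show "\<exists>u. x = (\<Sum>b\<in>B. fat_const (u b) * b)" for x :: "'k fat"
    proof -
      define u where "u b = sum_list (map2 (*) (fat_coords b) (fat_coords x))" for b
      show ?thesis
        by (rule exI[of _ u], cases x) (simp add: B_def u_def fat_const_def)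
    qed
    show "ideal (I i) type_ring" if "i \<le> card B" for i
      unfolding ideal_type_ring_iff
    proof (intro conjI ballI allI)
      show "0 \<in> I i"
        using split[OF that[unfolded card]] unfolding I_def zero_fat_def
        by (elim disjE) simp_all
      fix x y r assume x: "x \<in> I i"
      show "r * x \<in> I i"
        using split[OF that[unfolded card]] x unfolding I_def
        by (elim disjE; cases r; cases x) simp_all
      assume y: "y \<in> I i"
      show "x + y \<in> I i"
        using split[OF that[unfolded card]] x y unfolding I_def
        by (elim disjE; cases x; cases y) simp_all
    qed
    show "I i \<subset> I (Suc i)" if "i < card B" for i
    proof -
      have "I i \<subseteq> I (Suc i)"
        unfolding I_def using set_take_subset_set_take[OF diff_le_mono2[of i "Suc i" 11]] by fastforce
      moreover have "\<exists>b\<in>B. b \<in> I (Suc i) - I i"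
        using split[OF less_imp_le[OF that[unfolded card]]] that unfolding card I_def B_def
        by (elim disjE) simp_all
      ultimately show ?thesis by blast
    qed
  qed
  then show ?thesis by (simp add: card numeral_eq_enat)
qed

section \<open>Normal forms at the Fermat quartic\<close>

text \<open>The element of the algebra with the given coordinates, written as a polynomial in three elements \<open>\<alpha>, \<beta>, \<gamma>\<close> of some ring
  and made homogeneous of degree four by powers of \<open>s\<close>.\<close>

fun fat_eval :: "('k \<Rightarrow> 'r) \<Rightarrow> 'r \<Rightarrow> 'r \<Rightarrow> 'r \<Rightarrow> 'r \<Rightarrow> 'k fat \<Rightarrow> 'r::comm_ring_1"
  where "fat_eval \<phi> s \<alpha> \<beta> \<gamma> (Fat n a b c a2 b2 c2 a3 b3 c3 t) =
    \<phi> n * s^4 + (\<phi> a * \<alpha> + \<phi> b * \<beta> + \<phi> c * \<gamma>) * s^3 + (\<phi> a2 * \<alpha>^2 + \<phi> b2 * \<beta>^2 + \<phi> c2 * \<gamma>^2) * s^2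
     + (\<phi> a3 * \<alpha>^3 + \<phi> b3 * \<beta>^3 + \<phi> c3 * \<gamma>^3) * s + \<phi> t * \<alpha>^4"

lemma fat_eval_add:
  assumes "ring_map \<phi>"
  shows "fat_eval \<phi> s \<alpha> \<beta> \<gamma> (x + y) = fat_eval \<phi> s \<alpha> \<beta> \<gamma> x + fat_eval \<phi> s \<alpha> \<beta> \<gamma> y"
  by (cases x; cases y) (simp add: ring_mapD[OF assms] distrib_left distrib_right)

lemma fat_eval_0: "ring_map \<phi> \<Longrightarrow> fat_eval \<phi> s \<alpha> \<beta> \<gamma> 0 = 0"
  by (simp add: zero_fat_def ring_mapD(4))

lemma fat_eval_const: "ring_map \<phi> \<Longrightarrow> fat_eval \<phi> s \<alpha> \<beta> \<gamma> (fat_const c) = \<phi> c * s^4"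
  by (simp add: fat_const_def ring_mapD)

text \<open>The left hand side measures how far \<open>fat_eval\<close> is from being compatible with multiplication by the generator \<open>\<alpha>\<close>; the
  right hand side shows the defect as a combination of the relations. The other generators are covered by
  permuting the letters, and for this purpose the top element is an independent letter \<open>\<tau>\<close>.\<close>

lemma fat_generator_identity:
  fixes s :: "'r::comm_ring_1"
  shows "\<alpha> * (n * s^4 + (a * \<alpha> + b * \<beta> + c * \<gamma>) * s^3 + (a2 * \<alpha>^2 + b2 * \<beta>^2 + c2 * \<gamma>^2) * s^2
     + (a3 * \<alpha>^3 + b3 * \<beta>^3 + c3 * \<gamma>^3) * s + t * \<tau>)
     - s * (n * \<alpha> * s^3 + a * \<alpha>^2 * s^2 + (a2 * \<alpha>^3 + c * \<beta>^3 + b * \<gamma>^3) * s + a3 * \<tau>) =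
       s^2 * (b * (s * \<alpha> * \<beta> - \<gamma>^3) + c * (s * \<alpha> * \<gamma> - \<beta>^3) + b2 * (\<beta>^2 * \<alpha>) + c2 * (\<gamma>^2 * \<alpha>))
       + s * (a3 * (\<alpha>^4 - \<tau>) + b3 * \<beta> * (\<beta>^2 * \<alpha>) + c3 * \<gamma> * (\<gamma>^2 * \<alpha>)) + t * (\<tau> * \<alpha>)"
  by (simp only: distrib_left distrib_right right_diff_distrib left_diff_distrib
        power2_eq_square power3_eq_cube power4_eq_xxxx,
      simp only: mult_ac, simp only: diff_conv_add_uminus minus_add_distrib minus_minus, simp only: add_ac, simp)

text \<open>The elements \<open>x\<close> for which the claim holds for all \<open>y\<close> form a subalgebra, because \<open>s\<close> can be cancelled. So it suffices
  to treat constants and the three generators.\<close>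

lemma fat_eval_mult:
  fixes s \<alpha> \<beta> \<gamma> :: "'k::field bipoly" and \<phi> :: "'k \<Rightarrow> 'k bipoly"
  assumes \<phi>: "ring_map \<phi>" and K_ideal: "ideal K bipoly_ring" and cancel: "\<And>F. s * F \<in> K \<Longrightarrow> F \<in> K"
    and rel: "s * \<beta> * \<gamma> - \<alpha>^3 \<in> K" "s * \<alpha> * \<gamma> - \<beta>^3 \<in> K" "s * \<alpha> * \<beta> - \<gamma>^3 \<in> K"
    "\<alpha>^2 * \<beta> \<in> K" "\<alpha>^2 * \<gamma> \<in> K" "\<beta>^2 * \<alpha> \<in> K" "\<beta>^2 * \<gamma> \<in> K" "\<gamma>^2 * \<alpha> \<in> K" "\<gamma>^2 * \<beta> \<in> K"
    "\<alpha>^4 - \<beta>^4 \<in> K" "\<alpha>^4 - \<gamma>^4 \<in> K"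
  shows "fat_eval \<phi> s \<alpha> \<beta> \<gamma> x * fat_eval \<phi> s \<alpha> \<beta> \<gamma> y - s^4 * fat_eval \<phi> s \<alpha> \<beta> \<gamma> (x * y) \<in> K"
proof -
  let ?N = "fat_eval \<phi> s \<alpha> \<beta> \<gamma>"
  note K = ideal_bipolyD[OF K_ideal]
  define good where "good x \<longleftrightarrow> (\<forall>y. ?N x * ?N y - s^4 * ?N (x * y) \<in> K)" for x
  let ?A = "Fat 0 1 0 0 0 0 0 0 0 0 0 :: 'k fat" and ?B = "Fat 0 0 1 0 0 0 0 0 0 0 0 :: 'k fat"
    and ?C = "Fat 0 0 0 1 0 0 0 0 0 0 0 :: 'k fat"
  have const: "good (fat_const c)" for c
    unfolding good_def
  proof
    fix y :: "'k fat"
    have "?N (fat_const c * y) = \<phi> c * ?N y"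
      by (cases y) (simp add: fat_const_def ring_mapD[OF \<phi>] algebra_simps)
    then have "?N (fat_const c) * ?N y - s^4 * ?N (fat_const c * y) = 0"
      by (simp add: fat_eval_const[OF \<phi>])
    then show "?N (fat_const c) * ?N y - s^4 * ?N (fat_const c * y) \<in> K"
      by (simp only: K(1))
  qed
  have shift: "s^3 * (u * Y - s * Z) = u * s^3 * Y - s^4 * Z" for u Y Z
    by (simp only: right_diff_distrib power4_eq_xxxx power3_eq_cube mult_ac)
  have top: "\<alpha>^4 * \<alpha> \<in> K" "\<alpha>^4 * \<beta> \<in> K" "\<alpha>^4 * \<gamma> \<in> K"
  proof -
    have "\<alpha>^4 * \<alpha> = \<alpha> * (\<alpha>^4 - \<beta>^4) + \<beta>^2 * (\<beta>^2 * \<alpha>)"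
      "\<alpha>^4 * \<beta> = \<alpha>^2 * (\<alpha>^2 * \<beta>)" "\<alpha>^4 * \<gamma> = \<alpha>^2 * (\<alpha>^2 * \<gamma>)"
      by (simp_all add: right_diff_distrib power4_eq_xxxx power2_eq_square mult_ac)
    then show "\<alpha>^4 * \<alpha> \<in> K" "\<alpha>^4 * \<beta> \<in> K" "\<alpha>^4 * \<gamma> \<in> K"
      by (simp_all only:, (intro K(2,3) rel)+)
  qed
  have neg: "\<beta>^4 - \<alpha>^4 \<in> K" "\<gamma>^4 - \<alpha>^4 \<in> K" "\<alpha>^4 - \<alpha>^4 \<in> K"
    using K(5)[OF rel(10)] K(5)[OF rel(11)] K(1) by simp_all
  have rel': "s * \<gamma> * \<beta> - \<alpha>^3 \<in> K" "s * \<gamma> * \<alpha> - \<beta>^3 \<in> K" "s * \<beta> * \<alpha> - \<gamma>^3 \<in> K"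
    using rel(1-3) by (simp_all only: mult_ac)
  note rel' = rel' rel neg
  have A: "good ?A" unfolding good_def
  proof
    fix y :: "'k fat"
    obtain n a b c a2 b2 c2 a3 b3 c3 t where y: "y = Fat n a b c a2 b2 c2 a3 b3 c3 t"
      by (cases y)
    have gen: "?N ?A = \<alpha> * s^3"
      by (simp add: ring_mapD[OF \<phi>])
    have prod: "?N (?A * y) = \<phi> n * \<alpha> * s^3 + \<phi> a * \<alpha>^2 * s^2
        + (\<phi> a2 * \<alpha>^3 + \<phi> c * \<beta>^3 + \<phi> b * \<gamma>^3) * s + \<phi> a3 * \<alpha>^4"
      by (simp add: y ring_mapD[OF \<phi>] add_ac)
    have val: "?N y = \<phi> n * s^4 + (\<phi> a * \<alpha> + \<phi> b * \<beta> + \<phi> c * \<gamma>) * s^3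
        + (\<phi> a2 * \<alpha>^2 + \<phi> b2 * \<beta>^2 + \<phi> c2 * \<gamma>^2) * s^2
        + (\<phi> a3 * \<alpha>^3 + \<phi> b3 * \<beta>^3 + \<phi> c3 * \<gamma>^3) * s + \<phi> t * \<alpha>^4"
      by (simp add: y add_ac)
    have "\<alpha> * ?N y - s * ?N (?A * y) \<in> K"
      unfolding val prod fat_generator_identity by (intro K(2,3) rel' top)
    from K(3)[OF this, of "s^3"] show "?N ?A * ?N y - s^4 * ?N (?A * y) \<in> K"
      unfolding gen shift .
  qed
  have B: "good ?B" unfolding good_def
  proof
    fix y :: "'k fat"
    obtain n a b c a2 b2 c2 a3 b3 c3 t where y: "y = Fat n a b c a2 b2 c2 a3 b3 c3 t"
      by (cases y)
    have gen: "?N ?B = \<beta> * s^3"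
      by (simp add: ring_mapD[OF \<phi>])
    have prod: "?N (?B * y) = \<phi> n * \<beta> * s^3 + \<phi> b * \<beta>^2 * s^2
        + (\<phi> b2 * \<beta>^3 + \<phi> c * \<alpha>^3 + \<phi> a * \<gamma>^3) * s + \<phi> b3 * \<alpha>^4"
      by (simp add: y ring_mapD[OF \<phi>] add_ac)
    have val: "?N y = \<phi> n * s^4 + (\<phi> b * \<beta> + \<phi> a * \<alpha> + \<phi> c * \<gamma>) * s^3
        + (\<phi> b2 * \<beta>^2 + \<phi> a2 * \<alpha>^2 + \<phi> c2 * \<gamma>^2) * s^2
        + (\<phi> b3 * \<beta>^3 + \<phi> a3 * \<alpha>^3 + \<phi> c3 * \<gamma>^3) * s + \<phi> t * \<alpha>^4"
      by (simp add: y add_ac)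
    have "\<beta> * ?N y - s * ?N (?B * y) \<in> K"
      unfolding val prod fat_generator_identity by (intro K(2,3) rel' top)
    from K(3)[OF this, of "s^3"] show "?N ?B * ?N y - s^4 * ?N (?B * y) \<in> K"
      unfolding gen shift .
  qed
  have C: "good ?C" unfolding good_def
  proof
    fix y :: "'k fat"
    obtain n a b c a2 b2 c2 a3 b3 c3 t where y: "y = Fat n a b c a2 b2 c2 a3 b3 c3 t"
      by (cases y)
    have gen: "?N ?C = \<gamma> * s^3"
      by (simp add: ring_mapD[OF \<phi>])
    have prod: "?N (?C * y) = \<phi> n * \<gamma> * s^3 + \<phi> c * \<gamma>^2 * s^2
        + (\<phi> c2 * \<gamma>^3 + \<phi> b * \<alpha>^3 + \<phi> a * \<beta>^3) * s + \<phi> c3 * \<alpha>^4"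
      by (simp add: y ring_mapD[OF \<phi>] add_ac)
    have val: "?N y = \<phi> n * s^4 + (\<phi> c * \<gamma> + \<phi> a * \<alpha> + \<phi> b * \<beta>) * s^3
        + (\<phi> c2 * \<gamma>^2 + \<phi> a2 * \<alpha>^2 + \<phi> b2 * \<beta>^2) * s^2
        + (\<phi> c3 * \<gamma>^3 + \<phi> a3 * \<alpha>^3 + \<phi> b3 * \<beta>^3) * s + \<phi> t * \<alpha>^4"
      by (simp add: y add_ac)
    have "\<gamma> * ?N y - s * ?N (?C * y) \<in> K"
      unfolding val prod fat_generator_identity by (intro K(2,3) rel' top)
    from K(3)[OF this, of "s^3"] show "?N ?C * ?N y - s^4 * ?N (?C * y) \<in> K"
      unfolding gen shift .
  qed
  have add: "good (x + x')" if "good x" "good x'" for x x'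
    unfolding good_def
  proof
    fix y
    have "(?N x * ?N y - s^4 * ?N (x * y)) + (?N x' * ?N y - s^4 * ?N (x' * y)) \<in> K"
      by (intro K(2) that[unfolded good_def, rule_format])
    also have "(?N x * ?N y - s^4 * ?N (x * y)) + (?N x' * ?N y - s^4 * ?N (x' * y)) = ?N (x + x') * ?N y - s^4 * ?N ((x + x') * y)"
      by (simp only: fat_eval_add[OF \<phi>] distrib_left distrib_right add_diff_add)
    finally show "?N (x + x') * ?N y - s^4 * ?N ((x + x') * y) \<in> K" .
  qed
  have cancel4: "F \<in> K" if "s^4 * F \<in> K" for F
  proof -
    have "s * (s * (s * (s * F))) \<in> K"
      using that by (simp only: power4_eq_xxxx mult.assoc)
    then show ?thesis by (intro cancel[of F] cancel[of "s * F"] cancel[of "s * (s * F)"] cancel[of "s * (s * (s * F))"])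
  qed
  have mult: "good (x * x')" if "good x" "good x'" for x x'
    unfolding good_def
  proof
    fix y
    have "?N x * (?N x' * ?N y - s^4 * ?N (x' * y)) + s^4 * (?N x * ?N (x' * y) - s^4 * ?N (x * (x' * y)))
        - ?N y * (?N x * ?N x' - s^4 * ?N (x * x')) \<in> K"
      by (intro K(2,3,6) that[unfolded good_def, rule_format])
    also have "?N x * (?N x' * ?N y - s^4 * ?N (x' * y)) + s^4 * (?N x * ?N (x' * y) - s^4 * ?N (x * (x' * y)))
        - ?N y * (?N x * ?N x' - s^4 * ?N (x * x')) = s^4 * (?N (x * x') * ?N y - s^4 * ?N (x * x' * y))"
      by (simp add: right_diff_distrib mult_ac)
    finally show "?N (x * x') * ?N y - s^4 * ?N (x * x' * y) \<in> K"
      by (rule cancel4)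
  qed
  have "good x"
  proof -
    obtain n a b c a2 b2 c2 a3 b3 c3 t where x: "x = Fat n a b c a2 b2 c2 a3 b3 c3 t"
      by (cases x)
    have "x = fat_const n + fat_const a * ?A + fat_const b * ?B + fat_const c * ?C
       + fat_const a2 * (?A * ?A) + fat_const b2 * (?B * ?B) + fat_const c2 * (?C * ?C)
       + fat_const a3 * (?B * ?C) + fat_const b3 * (?A * ?C) + fat_const c3 * (?A * ?B)
       + fat_const t * (?A * ?A * (?A * ?A))"
      by (simp add: x fat_const_def)
    also have "good \<dots>"
      by (intro add mult const A B C)
    finally show ?thesis .
  qed
  then show ?thesis by (simp add: good_def)
qed

text \<open>The quartic over the algebra with \<open>s = 1\<close>, \<open>p = - (3/4) \<alpha>\<^sup>2\<close>, \<open>a = - 3 \<alpha>\<close> and so on: the Fermat quartic together with the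
  infinitesimal neighbourhood in which the fiber is contained.\<close>

definition fat_quartic :: "'k::field_char_0 fat quartic"
  where "fat_quartic = special_quartic 1
    (Fat 0 0 0 0 (- (3 / 4)) 0 0 0 0 0 0) (Fat 0 0 0 0 0 (- (3 / 4)) 0 0 0 0 0) (Fat 0 0 0 0 0 0 (- (3 / 4)) 0 0 0 0)
    (Fat 0 (- 3) 0 0 0 0 0 0 0 0 0) (Fat 0 0 (- 3) 0 0 0 0 0 0 0 0) (Fat 0 0 0 (- 3) 0 0 0 0 0 0 0)"

lemma numeral_fat: "(numeral n :: 'k::comm_ring_1 fat) = Fat (numeral n) 0 0 0 0 0 0 0 0 0 0"
  using ring_mapD(9)[OF ring_map_fat_const, of n] by (simp add: fat_const_def)

text \<open>The fat point lies in the fiber: \<open>H4\<close> sends it to a multiple of \<open>Fer'\<close>, and the factor \<open>48 + (9/4) \<alpha>\<^sup>4\<close> is a unit.\<close>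

lemma H4_fat_quartic: "H4 fat_quartic = (\<lambda>m. Fat 48 0 0 0 0 0 0 0 0 0 (9 / 4) * fat_const (Fer' m))"
  by (rule quartic_eqI, unfold all_mon4 fat_quartic_def H4_special)
    (simp add: Fer'_mo numeral_fat fat_const_def power2_eq_square one_fat_def zero_fat_def)

definition fat_map :: "'k::field_char_0 bipoly \<Rightarrow> 'k fat"
  where "fat_map = msubst fat_const (case_coord fat_quartic (fat_const \<circ> Fer'))"

lemma ring_map_fat_map: "ring_map fat_map"
  unfolding fat_map_def by (rule ring_map_msubst[OF ring_map_fat_const])

lemma fat_map_simps:
  "fat_map (mConst c) = fat_const c" "fat_map (Avec m) = fat_quartic m" "fat_map (Bvec m) = fat_const (Fer' m)"
  by (simp_all add: fat_map_def msubst_mConst msubst_mVar ring_map_fat_const)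

lemma fat_residue_fat_map: "fat_residue (fat_map F) = eval_at Fer Fer' F"
proof -
  have "fat_residue \<circ> (fat_const :: 'a \<Rightarrow> 'a fat) = id"
    by (rule ext) (simp add: fat_const_def)
  moreover have "\<forall>m. fat_residue (fat_quartic m) = (Fer m :: 'a)"
    unfolding all_mon4 by (simp add: fat_quartic_def quartics_special(1) special_quartic_mo one_fat_def zero_fat_def)
  then have "fat_residue \<circ> case_coord fat_quartic (fat_const \<circ> Fer') = case_coord Fer (Fer' :: 'a quartic)"
    by (intro ext) (simp add: fat_const_def split: coord.split)
  ultimately show ?thesis
    unfolding fat_map_def eval_at_def
    by (simp add: ring_map_msubst_comp[OF ring_map_fat_residue ring_map_fat_const])
qed

section \<open>The points of the fiber and their multiplicities\<close>

lemma H4_values: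
  "H4 Fer = (\<lambda>m. 48 * Fer' m :: 'k::field_char_0)"
  "H4 C0 = (\<lambda>m. 192 * Fer' m :: 'k)" "H4 C1 = (\<lambda>m. 192 * Fer' m :: 'k)"
  "H4 C2 = (\<lambda>m. 192 * Fer' m :: 'k)" "H4 C3 = (\<lambda>m. 192 * Fer' m :: 'k)"
  by (rule quartic_eqI, unfold all_mon4 quartics_special H4_special, simp add: special_quartic_mo)+

lemma coefficient_values:
  fixes C :: "'k::field_char_0 quartic"
  assumes "C \<in> {Fer, C0, C1, C2, C3}"
  shows "\<exists>w. w \<noteq> 0 \<and> H4 C = (\<lambda>m. w * Fer' m)" "C (mo 4 0 0) = 1"
proof -
  show "C (mo 4 0 0) = 1"
    using assms by (auto simp: quartics_special special_quartic_mo)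
  show "\<exists>w. w \<noteq> 0 \<and> H4 C = (\<lambda>m. w * Fer' m)"
    using assms H4_values[where 'k = 'k] by (auto intro: exI[of _ 48] exI[of _ 192])
qed

lemma graph_points:
  fixes C :: "'k::field_char_0 quartic"
  assumes "C \<in> {Fer, C0, C1, C2, C3}"
  shows "graph_point C = rational_point C Fer'" "rational_point C Fer' \<in> scheme_points (H_fiber Fer')"
    "H4_defined_at C"
proof -
  obtain w where w: "w \<noteq> 0" "H4 C = (\<lambda>m. w * Fer' m)"
    using coefficient_values(1)[OF assms] by blast
  show "graph_point C = rational_point C Fer'"
    by (rule graph_point_eq[OF w(2,1)])
  have Fer': "(Fer' (mo 4 0 0) :: 'k) = 1"
    by (simp add: Fer'_mo)
  show "rational_point C Fer' \<in> scheme_points (H_fiber Fer')"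
    by (rule rational_point_in_scheme_points[OF w(2,1), of "mo 4 0 0" "mo 4 0 0"])
      (simp_all add: coefficient_values(2)[OF assms] Fer')
  have "H4 C (mo 4 0 0) \<noteq> 0"
    using w Fer' by simp
  then show "H4_defined_at C"
    unfolding H4_defined_at_def by auto
qed

lemma congruent_rational_point:
  fixes C C' :: "'k::field quartic"
  assumes "C (mo 4 0 0) = 1" "\<And>m. Avec m - mConst (C' m) * s_form \<in> rational_point C y"
  shows "C = C'"
proof
  fix m
  have "bihom 1 0 (Avec m - mConst (C' m) * s_form)"
    by (intro bihom_diff bihom_CoA bihom_mult_eq[OF bihom_mConst bihom_CoA]) simp_all
  from bihom_mem_rational_point_iff[OF this, of C y] show "C m = C' m"
    using assms by (simp add: ring_mapD[OF ring_map_eval_at] eval_at_simps)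
qed

lemma rational_point_inj:
  fixes C C' :: "'k::field quartic"
  assumes "C (mo 4 0 0) = 1" "C' (mo 4 0 0) = 1" "rational_point C y = rational_point C' y"
  shows "C = C'"
proof (rule congruent_rational_point[of C, OF assms(1)])
  fix m
  have "bihom 1 0 (Avec m - mConst (C' m) * s_form)"
    by (intro bihom_diff bihom_CoA bihom_mult_eq[OF bihom_mConst bihom_CoA]) simp_all
  then show "Avec m - mConst (C' m) * s_form \<in> rational_point C y"
    unfolding assms(3)
    by (simp add: bihom_mem_rational_point_iff ring_mapD[OF ring_map_eval_at] eval_at_simps assms(2))
qed

lemma quartics_distinct: "distinct [Fer :: 'k::field_char_0 quartic, C0, C1, C2, C3]"
proof -
  have "C \<noteq> C'" if "C (mo 0 2 2) \<noteq> C' (mo 0 2 2) \<or> C (mo 2 0 2) \<noteq> C' (mo 2 0 2)" for C C' :: "'k quartic"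
    using that by auto
  then show ?thesis
    unfolding distinct.simps list.set by (intro conjI) (simp_all add: quartics_special special_quartic_mo)
qed

lemma graph_points_distinct:
  "distinct [graph_point (Fer :: 'k::field_char_0 quartic), graph_point C0, graph_point C1, graph_point C2, graph_point C3]"
proof -
  have "inj_on graph_point {Fer :: 'k quartic, C0, C1, C2, C3}"
  proof (rule inj_onI)
    fix C C' :: "'k quartic"
    assume C: "C \<in> {Fer, C0, C1, C2, C3}" "C' \<in> {Fer, C0, C1, C2, C3}" "graph_point C = graph_point C'"
    show "C = C'"
      using C(3) unfolding graph_points(1)[OF C(1)] graph_points(1)[OF C(2)]
      by (rule rational_point_inj[of C C', OF coefficient_values(2)[OF C(1)] coefficient_values(2)[OF C(2)]])
  qed
  then have "distinct (map graph_point [Fer :: 'k quartic, C0, C1, C2, C3])"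
    unfolding distinct_map using quartics_distinct by (metis list.set(1,2))
  then show ?thesis by simp
qed

lemma fiber_points:
  "scheme_points (H_fiber (Fer' :: 'k::field_char_0 quartic)) =
     {graph_point Fer, graph_point C0, graph_point C1, graph_point C2, graph_point C3}"
proof
  have "graph_point C \<in> scheme_points (H_fiber Fer')" if "C \<in> {Fer, C0, C1, C2, C3}" for C :: "'k quartic"
    using graph_points[OF that] by simp
  then show "{graph_point Fer, graph_point C0, graph_point C1, graph_point C2, graph_point C3}
      \<subseteq> scheme_points (H_fiber (Fer' :: 'k quartic))"
    by simp
  show "scheme_points (H_fiber (Fer' :: 'k quartic)) \<subseteq>
     {graph_point Fer, graph_point C0, graph_point C1, graph_point C2, graph_point C3}"
  proof
    fix P :: "'k bipoly set" assume P: "P \<in> scheme_points (H_fiber Fer')"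
    have "\<exists>C\<in>{Fer, C0, C1, C2, C3}. \<forall>m. Avec m - mConst (C m) * s_form \<in> P"
    proof (cases "Avec (mo 0 2 2) \<in> P")
      case True
      then show ?thesis using Fermat_case(7)[OF P] by blast
    next
      case False
      then show ?thesis using reduced_points[OF P] K_subset_P[OF P] by blast
    qed
    then obtain C where C: "C \<in> {Fer, C0, C1, C2, C3}" "\<And>m. Avec m - mConst (C m) * s_form \<in> P"
      by blast
    have "P = graph_point C"
      unfolding graph_points(1)[OF C(1)] by (rule P_eq_rational_point[OF P C(2)])
    then show "P \<in> {graph_point Fer, graph_point C0, graph_point C1, graph_point C2, graph_point C3}"
      using C(1) by blast
  qed
qed

text \<open>By \<open>reduced_points\<close> the coordinates are congruent to multiples of the coefficients of one of the four
  quartics, which can only be \<open>C\<close> itself. So evaluation at \<open>C\<close> identifies the local ring with the ground field.\<close>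

lemma multiplicity_reduced:
  fixes C :: "'k::field_char_0 quartic"
  assumes C: "C \<in> {C0, C1, C2, C3}"
  shows "multiplicity_at (H_fiber Fer') (graph_point C) = 1"
proof -
  let ?P = "rational_point C Fer'" and ?J = "H_fiber Fer' :: 'k bipoly set"
  have C': "C \<in> {Fer, C0, C1, C2, C3}" using C by simp
  note P = graph_points(2)[OF C']
  obtain w where w: "w \<noteq> 0" "H4 C = (\<lambda>m. w * Fer' m)"
    using coefficient_values(1)[OF C'] by blast
  have "C (mo 0 2 2) \<noteq> 0"
    using C by (auto simp: quartics_special special_quartic_mo)
  then have "Avec (mo 0 2 2) \<notin> ?P"
    using bihom_mem_rational_point_iff[OF bihom_CoA[of "mo 0 2 2"], of C Fer'] by (simp add: eval_at_simps)
  from reduced_points[OF P this] obtain D where D: "\<And>m. Avec m - mConst (D m) * s_form \<in> local_kernel ?J ?P"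
    by blast
  have "C = D"
    by (rule congruent_rational_point[of C, OF coefficient_values(2)[OF C'] subsetD[OF K_subset_P[OF P] D]])
  with D have A: "Avec m - mConst (C m) * s_form \<in> local_kernel ?J ?P" for m by simp
  have "multiplicity_at ?J ?P = ring_length (type_ring :: 'k ring)"
  proof (rule local_ring_length[OF P_prime[OF P] ring_map_eval_at])
    show "eval_at C Fer' F = 0" if "F \<in> ?J" for F
      using H_fiber_vanish[OF ring_map_id, of C w Fer' "inverse w" F] w that by (simp add: eval_at_def)
    show "\<exists>u. eval_at C Fer' s * u = 1" if "bihom d e s" "s \<notin> ?P" for d e s
      using that bihom_mem_rational_point_iff[OF that(1), of C Fer'] by (intro exI[of _ "inverse (eval_at C Fer' s)"]) simp
    show "F \<in> local_kernel ?J ?P" if "bihom d e F" "eval_at C Fer' F = 0" for d e F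
      by (rule congruent_evaluation_K[OF P A that])
    show "\<exists>f s. (f, s) \<in> fracs ?P \<and> eval_at C Fer' f = t * eval_at C Fer' s" for t
    proof (intro exI conjI)
      show "(mConst t, 1) \<in> fracs ?P"
        using prime_bipolyD(2)[OF P_prime[OF P]] by (auto simp: fracs_def)
      show "eval_at C Fer' (mConst t) = t * eval_at C Fer' 1"
        by (simp add: eval_at_simps ring_mapD(1)[OF ring_map_eval_at])
    qed
  qed
  then show ?thesis
    by (simp add: length_field graph_points(1)[OF C'])
qed

text \<open>The local ring is isomorphic to the algebra \<open>fat\<close>: the fat point maps the ideal of the fiber to 0, and the local relations
  allow every form to be rewritten as \<open>fat_eval\<close> of its value.\<close>

lemma multiplicity_Fermat:
  "multiplicity_at (H_fiber (Fer' :: 'k::field_char_0 quartic)) (graph_point Fer) = 11"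
proof -
  let ?P = "rational_point Fer Fer' :: 'k bipoly set" and ?J = "H_fiber Fer' :: 'k bipoly set"
  let ?K = "local_kernel ?J ?P"
  have Fer: "(Fer :: 'k quartic) \<in> {Fer, C0, C1, C2, C3}" by simp
  note P = graph_points(2)[OF Fer]
  have p: "Avec (mo 0 2 2) \<in> ?P"
    using bihom_mem_rational_point_iff[OF bihom_CoA[of "mo 0 2 2"], of Fer "Fer' :: 'k quartic"]
    by (simp add: eval_at_simps quartics_special(1) special_quartic_mo)
  note s = Fermat_case(8)[OF P p]
  define \<alpha> \<beta> \<gamma> :: "'k bipoly" where greek: "\<alpha> = mConst (- 1 / 3) * Avec (mo 2 1 1)"
    "\<beta> = mConst (- 1 / 3) * Avec (mo 1 2 1)" "\<gamma> = mConst (- 1 / 3) * Avec (mo 1 1 2)"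
  note rel = Fermat_local_relations[OF P p, folded greek]
  note K = ideal_bipolyD[OF K_ideal[OF P]]
  have cancel: "F \<in> ?K" if "s_form * F \<in> ?K" for F
    by (rule K_cancel[OF P that bihom_CoA s])
  define N where "N = fat_eval mConst s_form \<alpha> \<beta> \<gamma>"
  note lin = linear_relations[OF P]
  have hom: "bihom 1 0 \<alpha>" "bihom 1 0 \<beta>" "bihom 1 0 \<gamma>" "bihom 1 0 (s_form :: 'k bipoly)"
    unfolding greek by (intro bihom_mult_eq[OF bihom_mConst bihom_CoA] bihom_CoA; simp)+
  have unit: "\<exists>u. fat_map F * u = 1" if "bihom d e F" "F \<notin> ?P" for d e F
    by (rule fat_unit) (use that in \<open>simp add: fat_residue_fat_map bihom_mem_rational_point_iff\<close>)
  have third: "a - mConst (- 3) * (mConst (- 1 / 3) * a) = 0" for a :: "'k bipoly"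
    by (simp add: mult.assoc[symmetric] mConst_mult[symmetric])
  have quarter: "s_form ^ 4 * p - s_form * (mConst (- (3 / 4)) * x^2 * s_form^2) \<in> ?K" if "4 * s_form * p + 3 * x^2 \<in> ?K" for p x
  proof -
    have c: "mConst (1 / 4) * 4 = (1 :: 'k bipoly)" "mConst (- (3 / 4)) = - (mConst (1 / 4) * 3 :: 'k bipoly)"
      by (simp_all add: ring_mapD(5,9)[OF ring_map_mConst, symmetric] mConst_mult[symmetric])
    have "s_form ^ 4 * p = mConst (1 / 4) * 4 * (s_form ^ 4 * p)"
      by (simp add: c(1))
    then have "s_form ^ 4 * p - s_form * (mConst (- (3 / 4)) * x^2 * s_form^2) =
        mConst (1 / 4) * s_form ^ 3 * (4 * s_form * p + 3 * x^2)"
      by (simp only: c(2) power4_eq_xxxx power3_eq_cube power2_eq_square distrib_left mult_ac) simp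
    then show ?thesis using K(3)[OF that] by (simp only:)
  qed
  have pure: "s_form ^ 4 * a - s_form * s_form ^ 4 \<in> ?K" if "a - s_form \<in> ?K" for a
    using K(3)[OF that, of "s_form ^ 4"] by (simp only: right_diff_distrib mult.commute[of "s_form ^ 4" s_form])
  have cubic: "s_form ^ 4 * a - s_form * (mConst (- 3) * (mConst (- 1 / 3) * a) * s_form ^ 3) \<in> ?K" for a
  proof -
    have "s_form ^ 4 * a - s_form * (mConst (- 3) * (mConst (- 1 / 3) * a) * s_form ^ 3)
        = s_form ^ 4 * (a - mConst (- 3) * (mConst (- 1 / 3) * a))"
      by (simp only: right_diff_distrib power4_eq_xxxx power3_eq_cube mult_ac)
    then show ?thesis by (simp only: third mult_zero_right K(1))
  qed
  \<comment> \<open>The coordinates of the fat quartic are constants, multiples of squares and multiples of generators; for each kind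
    the lift by \<open>N\<close> has to agree with the coordinate modulo the local equations.\<close>
  have N_values: "N 0 = 0" "N 1 = s_form ^ 4"
    "N (Fat 0 0 0 0 (- (3 / 4)) 0 0 0 0 0 0) = mConst (- (3 / 4)) * \<alpha>^2 * s_form^2"
    "N (Fat 0 0 0 0 0 (- (3 / 4)) 0 0 0 0 0) = mConst (- (3 / 4)) * \<beta>^2 * s_form^2"
    "N (Fat 0 0 0 0 0 0 (- (3 / 4)) 0 0 0 0) = mConst (- (3 / 4)) * \<gamma>^2 * s_form^2"
    "N (Fat 0 (- 3) 0 0 0 0 0 0 0 0 0) = mConst (- 3) * \<alpha> * s_form^3"
    "N (Fat 0 0 (- 3) 0 0 0 0 0 0 0 0) = mConst (- 3) * \<beta> * s_form^3"
    "N (Fat 0 0 0 (- 3) 0 0 0 0 0 0 0) = mConst (- 3) * \<gamma> * s_form^3"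
    by (simp_all add: N_def one_fat_def zero_fat_def)
  have N_A: "\<forall>m. s_form ^ 4 * Avec m - s_form * N (fat_map (Avec m)) \<in> ?K"
    unfolding all_mon4 fat_map_simps fat_quartic_def
    using pure[OF lin(7)] pure[OF lin(8)] quarter[OF rel(1)] quarter[OF rel(2)] quarter[OF rel(3)]
      cubic[of "Avec (mo 2 1 1)", folded greek] cubic[of "Avec (mo 1 2 1)", folded greek]
      cubic[of "Avec (mo 1 1 2)", folded greek]
      lin(1-6)[THEN K(3), of "s_form ^ 4"]
    by (simp add: special_quartic_mo N_values K(1))
  have normal: "s_form ^ 4 * F - s_form ^ d * u_form ^ e * N (fat_map F) \<in> ?K" if "bihom d e F" for d e F
  proof (rule normal_form[OF K_ideal[OF P] ring_map_fat_map cancel _ _ _ _ _ _ that])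
    show "N (a + b) = N a + N b" for a b
      unfolding N_def by (rule fat_eval_add[OF ring_map_mConst])
    show "N 0 = 0"
      unfolding N_def by (rule fat_eval_0[OF ring_map_mConst])
    show "N a * N b - s_form ^ 4 * N (a * b) \<in> ?K" for a b
      unfolding N_def by (rule fat_eval_mult[OF ring_map_mConst K_ideal[OF P] cancel rel(4-14)])
    show "N (fat_map (mConst c)) = mConst c * s_form ^ 4" for c
      unfolding N_def fat_map_simps by (rule fat_eval_const[OF ring_map_mConst])
    show "s_form ^ 4 * Avec m - s_form * N (fat_map (Avec m)) \<in> ?K" for m
      using N_A by blast
    show "s_form ^ 4 * Bvec m - u_form * N (fat_map (Bvec m)) \<in> ?K" for m
    proof -
      have "s_form ^ 4 * (Bvec m - mConst (Fer' m) * u_form) \<in> ?K"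
        by (intro K(3) subsetD[OF fiber_subset_K[OF P] Bvec_congruent])
      then show ?thesis
        unfolding N_def fat_map_simps fat_eval_const[OF ring_map_mConst] by (simp only: right_diff_distrib mult_ac)
    qed
  qed
  have "multiplicity_at ?J ?P = ring_length (type_ring :: 'k fat ring)"
  proof (rule local_ring_length[OF P_prime[OF P] ring_map_fat_map])
    show "fat_map F = 0" if "F \<in> ?J" for F
    proof -
      obtain w' where "Fat 48 0 0 0 0 0 0 0 0 0 (9 / 4) * w' = (1 :: 'k fat)"
        using fat_unit[of "Fat 48 0 0 0 0 0 0 0 0 0 (9 / 4) :: 'k fat"] by auto
      from H_fiber_vanish[OF ring_map_fat_const H4_fat_quartic this that] show ?thesis
        by (simp only: fat_map_def)
    qed
    show "\<exists>u. fat_map s * u = 1" if "bihom d e s" "s \<notin> ?P" for d e s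
      by (rule unit[OF that])
    show "F \<in> ?K" if F: "bihom d e F" "fat_map F = 0" for d e F
    proof -
      have "s_form ^ 4 * F \<in> ?K"
        using normal[OF F(1)] by (simp add: F(2) N_def fat_eval_0[OF ring_map_mConst])
      then have "s_form * (s_form * (s_form * (s_form * F))) \<in> ?K"
        by (simp only: power4_eq_xxxx mult.assoc)
      then show ?thesis by (blast intro: cancel)
    qed
    show "\<exists>f s. (f, s) \<in> fracs ?P \<and> fat_map f = t * fat_map s" for t
    proof (intro exI conjI)
      obtain n a b c a2 b2 c2 a3 b3 c3 f where t: "t = Fat n a b c a2 b2 c2 a3 b3 c3 f"
        by (cases t)
      have pow: "bihom j 0 (x ^ j)" if "bihom 1 0 x" for x :: "'k bipoly" and j
        using bihom_power[OF that, of j] by simp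
      have monomial1: "bihom 1 0 (mConst e * x)" and monomial: "bihom j 0 (mConst e * x ^ j)"
        if "bihom 1 0 x" for x :: "'k bipoly" and j e
        by (rule bihom_mult_eq[OF bihom_mConst that], simp_all)
          (rule bihom_mult_eq[OF bihom_mConst pow[OF that]], simp_all)
      have linear: "bihom 1 0 (mConst x * \<alpha> + mConst y * \<beta> + mConst z * \<gamma>)"
        and square: "bihom 2 0 (mConst x * \<alpha>^2 + mConst y * \<beta>^2 + mConst z * \<gamma>^2)"
        and cube: "bihom 3 0 (mConst x * \<alpha>^3 + mConst y * \<beta>^3 + mConst z * \<gamma>^3)" for x y z
        by (intro bihom_add monomial1 monomial hom)+
      have "bihom 4 0 (N t)"
        unfolding N_def t fat_eval.simps
        by (intro bihom_add monomial hom bihom_mult_eq[OF linear pow[OF hom(4)]]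
            bihom_mult_eq[OF square pow[OF hom(4)]] bihom_mult_eq[OF cube hom(4)]) simp_all
      moreover have "s_form ^ 4 \<notin> ?P"
        using s by (simp add: power4_eq_xxxx prime_bipolyD(3)[OF P_prime[OF P]])
      ultimately show "(N t, s_form ^ 4) \<in> fracs ?P"
        using pow[OF hom(4), of 4] unfolding fracs_def by blast
      have gens: "fat_map s_form = 1" "fat_map \<alpha> = Fat 0 1 0 0 0 0 0 0 0 0 0"
        "fat_map \<beta> = Fat 0 0 1 0 0 0 0 0 0 0 0" "fat_map \<gamma> = Fat 0 0 0 1 0 0 0 0 0 0 0"
        unfolding greek ring_mapD(3)[OF ring_map_fat_map] fat_map_simps fat_quartic_def
        by (simp_all add: special_quartic_mo fat_const_def)
      show "fat_map (N t) = t * fat_map (s_form ^ 4)"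
        by (simp add: N_def t ring_mapD[OF ring_map_fat_map] gens fat_map_simps(1) fat_const_def
            power2_eq_square power3_eq_cube power4_eq_xxxx)
    qed
  qed
  then show ?thesis
    by (simp only: length_fat graph_points(1)[OF Fer])
qed

theorem theorem2p1:
  shows "(\<forall>C\<in>{Fer :: 'k::field_char_0 quartic, C0, C1, C2, C3}. H4_defined_at C) \<and>
    distinct [graph_point (Fer :: 'k quartic), graph_point C0, graph_point C1,
      graph_point C2, graph_point C3] \<and>
    scheme_points (H_fiber (Fer' :: 'k quartic)) =
      {graph_point Fer, graph_point C0, graph_point C1, graph_point C2, graph_point C3} \<and>
    multiplicity_at (H_fiber (Fer' :: 'k quartic)) (graph_point Fer) = 11 \<and>
    (\<forall>C\<in>{C0, C1, C2, C3}. multiplicity_at (H_fiber (Fer' :: 'k quartic)) (graph_point C) = 1)"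
proof (intro conjI ballI)
  show "H4_defined_at C" if "C \<in> {Fer :: 'k quartic, C0, C1, C2, C3}" for C
    by (rule graph_points(3)[OF that])
  show "distinct [graph_point (Fer :: 'k quartic), graph_point C0, graph_point C1, graph_point C2, graph_point C3]"
    by (rule graph_points_distinct)
  show "scheme_points (H_fiber (Fer' :: 'k quartic)) =
      {graph_point Fer, graph_point C0, graph_point C1, graph_point C2, graph_point C3}"
    by (rule fiber_points)
  show "multiplicity_at (H_fiber (Fer' :: 'k quartic)) (graph_point Fer) = 11"
    by (rule multiplicity_Fermat)
  show "multiplicity_at (H_fiber (Fer' :: 'k quartic)) (graph_point C) = 1" if "C \<in> {C0, C1, C2, C3}" for C
    by (rule multiplicity_reduced[OF that])
qed

end
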